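(* Let $\mathcal{P}=S^{-1}(P_\Lambda/I)$ be a Poisson algebra over a field $K$, where $P_\Lambda=K[x_i]_{i\in\Lambda}$ is a polynomial algebra (in an arbitrary set of variables), $I=(f_s)_{s\in\Gamma}$ is an ideal of $P_\Lambda$ and $S$ is a multiplicative subset of $P_\Lambda/I$ consisting of regular elements. Then: (1) The map $F_{ab}\to F_{ab}^{op}$, $a\mapsto a$, $\delta_i\mapsto-\delta_i$ ($a\in\mathcal{P}$, $i\in\Lambda$) is an algebra isomorphism. (2) The map $\mathcal{U}(\mathcal{P})\to\mathcal{U}(\mathcal{P})^{op}$, $a\mapsto a$, $\delta_i\mapsto-\delta_i$ ($a\in\mathcal{P}$, $i\in\Lambda$) is an algebra isomorphism; i.e. for each Poisson algebra its Poisson enveloping algebra is isomorphic to its opposite algebra. (3) For all elements $f\in\mathcal{P}$, $\sum_{j\in\Lambda}\big\{\frac{\partial f}{\partial x_j},x_j\big\}=0$.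
   Context: A Poisson algebra is a commutative associative unital $K$-algebra with a $K$-bilinear Lie bracket $\{\cdot,\cdot\}$ satisfying $\{a,xy\}=\{a,x\}y+x\{a,y\}$. The opposite algebra $A^{op}$ of an algebra $A$ is $A$ as a vector space with product $a\cdot b=ba$. The Poisson enveloping algebra of $\mathcal{P}$ is the universal triple $(\mathcal{U}(\mathcal{P}),\alpha,\beta)$ with $\mathcal{U}(\mathcal{P})$ an associative algebra, $\alpha:\mathcal{P}\to\mathcal{U}(\mathcal{P})$ an algebra homomorphism, $\beta:\mathcal{P}\to\mathcal{U}(\mathcal{P})$ a Lie algebra homomorphism such that $[\beta(a),\alpha(b)]=\alpha(\{a,b\})$ and $\beta(ab)=\beta(a)\alpha(b)+\alpha(a)\beta(b)$ for all $a,b\in\mathcal{P}$. One writes $a=\alpha(a)$, $\delta_i=\delta_{x_i}=\beta(x_i)$. $F_{ab}$ is the $K$-algebra generated by the algebra $\mathcal{P}$ and free generators $\{\delta_i\mid i\in\Lambda\}$ modulo the two-sided ideal generated by the elements $[\delta_i,\delta_j]-\sum_{k\in\Lambda}\frac{\partial\{x_i,x_j\}}{\partial x_k}\delta_k$ and $[\delta_i,x_j]-\{x_i,x_j\}$ for all $i,j\in\Lambda$. Here and in (3), a partial derivative $\frac{\partial g}{\partial x_k}$ of an element $g\in\mathcal{P}$ means the image in $\mathcal{P}$ of the corresponding partial derivative of a (fixed) representative of $g$ in the appropriate localization of $P_\Lambda$. The algebra $\mathcal{U}(\mathcal{P})$ is the factor algebra of $F_{ab}$ by the ideal generated by the elements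 $\sum_{i\in\Lambda}\frac{\partial f_s}{\partial x_i}\delta_i$, $s\in\Gamma$. *)

theory Defs
  imports "HOL-Algebra.Algebra"
begin

section \<open>Associative algebras over a commutative ring\<close>

text \<open>The library locale \<^locale>\<open>algebra\<close> covers commutative algebras only. All algebras are unital,
  and homomorphisms preserve the unit (as \<^const>\<open>ring_hom\<close> does).\<close>

locale assoc_algebra = module R A + ring A for R (structure) and A (structure) +
  assumes smult_mult_left:
      "\<lbrakk>c \<in> carrier R; x \<in> carrier A; y \<in> carrier A\<rbrakk> \<Longrightarrow>
        (c \<odot>\<^bsub>A\<^esub> x) \<otimes>\<^bsub>A\<^esub> y = c \<odot>\<^bsub>A\<^esub> (x \<otimes>\<^bsub>A\<^esub> y)"
    and smult_mult_right:
      "\<lbrakk>c \<in> carrier R; x \<in> carrier A; y \<in> carrier A\<rbrakk> \<Longrightarrow>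
        x \<otimes>\<^bsub>A\<^esub> (c \<odot>\<^bsub>A\<^esub> y) = c \<odot>\<^bsub>A\<^esub> (x \<otimes>\<^bsub>A\<^esub> y)"

definition alg_hom :: "'k ring \<Rightarrow> ('k, 'a) module \<Rightarrow> ('k, 'b) module \<Rightarrow> ('a \<Rightarrow> 'b) set" where
  "alg_hom K A B = {h \<in> ring_hom A B.
     \<forall>c\<in>carrier K. \<forall>x\<in>carrier A. h (c \<odot>\<^bsub>A\<^esub> x) = c \<odot>\<^bsub>B\<^esub> h x}"

definition alg_iso :: "'k ring \<Rightarrow> ('k, 'a) module \<Rightarrow> ('k, 'b) module \<Rightarrow> ('a \<Rightarrow> 'b) set" where
  "alg_iso K A B = {h \<in> alg_hom K A B. bij_betw h (carrier A) (carrier B)}"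

definition opp_alg :: "('k, 'a) module \<Rightarrow> ('k, 'a) module" where
  "opp_alg A = A\<lparr>monoid.mult := \<lambda>a b. b \<otimes>\<^bsub>A\<^esub> a\<rparr>"

definition commutator :: "('k, 'a) module \<Rightarrow> 'a \<Rightarrow> 'a \<Rightarrow> 'a" where
  "commutator A x y = x \<otimes>\<^bsub>A\<^esub> y \<ominus>\<^bsub>A\<^esub> y \<otimes>\<^bsub>A\<^esub> x"

text \<open>Sum of a family with finite support over a possibly infinite index set
  (\<^const>\<open>finsum\<close> itself is zero on infinite sets).\<close>

definition fsum :: "('k, 'a) module \<Rightarrow> 'i set \<Rightarrow> ('i \<Rightarrow> 'a) \<Rightarrow> 'a" where
  "fsum A J h = finsum A h {j \<in> J. h j \<noteq> \<zero>\<^bsub>A\<^esub>}"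

text \<open>The ring \<open>A Quot J\<close> with the induced scalar action; the union is over the members of the
  coset \<open>C\<close>, all of which give the same coset.\<close>

definition quot_alg :: "('k, 'a) module \<Rightarrow> 'a set \<Rightarrow> ('k, 'a set) module" where
  "quot_alg A J =
    \<lparr>carrier = carrier (A Quot J), monoid.mult = monoid.mult (A Quot J), one = one (A Quot J),
     ring.zero = ring.zero (A Quot J), ring.add = ring.add (A Quot J),
     smult = (\<lambda>c C. \<Union>x\<in>C. J +>\<^bsub>A\<^esub> (c \<odot>\<^bsub>A\<^esub> x))\<rparr>"


section \<open>Polynomial algebras and free algebras\<close>

definition monoid_algebra :: "'k ring \<Rightarrow> 'a monoid \<Rightarrow> ('k, 'a \<Rightarrow> 'k) module" where
  "monoid_algebra K M =
    \<lparr>carrier = {f. (\<forall>m. f m \<in> carrier K) \<and> (\<forall>m. m \<notin> carrier M \<longrightarrow> f m = \<zero>\<^bsub>K\<^esub>) \<and>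
                   finite {m. f m \<noteq> \<zero>\<^bsub>K\<^esub>}},
     monoid.mult = (\<lambda>f g m. finsum K (\<lambda>(a, b). f a \<otimes>\<^bsub>K\<^esub> g b)
        {(a, b). f a \<noteq> \<zero>\<^bsub>K\<^esub> \<and> g b \<noteq> \<zero>\<^bsub>K\<^esub> \<and> a \<otimes>\<^bsub>M\<^esub> b = m}),
     one = (\<lambda>m. if m = \<one>\<^bsub>M\<^esub> then \<one>\<^bsub>K\<^esub> else \<zero>\<^bsub>K\<^esub>),
     ring.zero = (\<lambda>m. \<zero>\<^bsub>K\<^esub>),
     ring.add = (\<lambda>f g m. f m \<oplus>\<^bsub>K\<^esub> g m),
     smult = (\<lambda>c f m. c \<otimes>\<^bsub>K\<^esub> f m)\<rparr>"

definition basis_elem :: "'k ring \<Rightarrow> 'a \<Rightarrow> 'a \<Rightarrow> 'k" where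
  "basis_elem K m = (\<lambda>m'. if m' = m then \<one>\<^bsub>K\<^esub> else \<zero>\<^bsub>K\<^esub>)"

text \<open>A monomial is the multiset of its variables, as in \<^theory>\<open>HOL-Algebra.Indexed_Polynomials\<close>.\<close>

type_synonym ('k, 'x) poly_fun = "'x multiset \<Rightarrow> 'k"

definition poly_alg :: "'k ring \<Rightarrow> 'x set \<Rightarrow> ('k, ('k, 'x) poly_fun) module" where
  "poly_alg K \<Lambda> =
    monoid_algebra K \<lparr>carrier = {m. set_mset m \<subseteq> \<Lambda>}, monoid.mult = (+), one = {#}\<rparr>"

definition poly_var :: "'k ring \<Rightarrow> 'x \<Rightarrow> ('k, 'x) poly_fun" where
  "poly_var K i = basis_elem K {#i#}"

text \<open>The coefficient of \<open>m\<close> in \<open>\<partial>p/\<partial>x\<^sub>k\<close> is (exponent of \<open>x\<^sub>k\<close> in \<open>m x\<^sub>k\<close>) times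
  the coefficient of \<open>m x\<^sub>k\<close> in \<open>p\<close>.\<close>

definition poly_pderiv :: "'k ring \<Rightarrow> 'x \<Rightarrow> ('k, 'x) poly_fun \<Rightarrow> ('k, 'x) poly_fun" where
  "poly_pderiv K k p = (\<lambda>m. [Suc (count m k)] \<cdot>\<^bsub>K\<^esub> p (add_mset k m))"

text \<open>The free associative algebra, with words as basis.\<close>

definition free_alg :: "'k ring \<Rightarrow> 'g set \<Rightarrow> ('k, 'g list \<Rightarrow> 'k) module" where
  "free_alg K G = monoid_algebra K \<lparr>carrier = lists G, monoid.mult = (@), one = []\<rparr>"


section \<open>Localization\<close>

definition loc_frac :: "('k, 'a) module \<Rightarrow> 'a set \<Rightarrow> 'a \<Rightarrow> 'a \<Rightarrow> ('a \<times> 'a) set" where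
  "loc_frac R S a s = {(b, t). b \<in> carrier R \<and> t \<in> S \<and>
     (\<exists>u\<in>S. u \<otimes>\<^bsub>R\<^esub> (a \<otimes>\<^bsub>R\<^esub> t \<ominus>\<^bsub>R\<^esub> b \<otimes>\<^bsub>R\<^esub> s) = \<zero>\<^bsub>R\<^esub>)}"

text \<open>In each operation the unions range over the fractions representing the arguments, all of
  which give the same class.\<close>

definition localization :: "('k, 'a) module \<Rightarrow> 'a set \<Rightarrow> ('k, ('a \<times> 'a) set) module" where
  "localization R S =
    \<lparr>carrier = {loc_frac R S a s |a s. a \<in> carrier R \<and> s \<in> S},
     monoid.mult = (\<lambda>u v. \<Union>(a, s)\<in>u. \<Union>(b, t)\<in>v. loc_frac R S (a \<otimes>\<^bsub>R\<^esub> b) (s \<otimes>\<^bsub>R\<^esub> t)),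
     one = loc_frac R S \<one>\<^bsub>R\<^esub> \<one>\<^bsub>R\<^esub>,
     ring.zero = loc_frac R S \<zero>\<^bsub>R\<^esub> \<one>\<^bsub>R\<^esub>,
     ring.add = (\<lambda>u v. \<Union>(a, s)\<in>u. \<Union>(b, t)\<in>v.
              loc_frac R S (a \<otimes>\<^bsub>R\<^esub> t \<oplus>\<^bsub>R\<^esub> b \<otimes>\<^bsub>R\<^esub> s) (s \<otimes>\<^bsub>R\<^esub> t)),
     smult = (\<lambda>c u. \<Union>(a, s)\<in>u. loc_frac R S (c \<odot>\<^bsub>R\<^esub> a) s)\<rparr>"

definition regular_elem :: "('k, 'a) module \<Rightarrow> 'a \<Rightarrow> bool" where
  "regular_elem R r \<longleftrightarrow>
     r \<in> carrier R \<and> (\<forall>a\<in>carrier R. r \<otimes>\<^bsub>R\<^esub> a = \<zero>\<^bsub>R\<^esub> \<longrightarrow> a = \<zero>\<^bsub>R\<^esub>)"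


section \<open>Poisson algebras and Poisson enveloping algebras\<close>

locale poisson_algebra = algebra K P for K :: "'k ring" (structure) and P :: "('k, 'p) module" (structure) +
  fixes br :: "'p \<Rightarrow> 'p \<Rightarrow> 'p"
  assumes br_closed: "\<lbrakk>a \<in> carrier P; b \<in> carrier P\<rbrakk> \<Longrightarrow> br a b \<in> carrier P"
    and br_add_left: "\<lbrakk>a \<in> carrier P; b \<in> carrier P; c \<in> carrier P\<rbrakk> \<Longrightarrow>
      br (a \<oplus>\<^bsub>P\<^esub> b) c = br a c \<oplus>\<^bsub>P\<^esub> br b c"
    and br_add_right: "\<lbrakk>a \<in> carrier P; b \<in> carrier P; c \<in> carrier P\<rbrakk> \<Longrightarrow>
      br a (b \<oplus>\<^bsub>P\<^esub> c) = br a b \<oplus>\<^bsub>P\<^esub> br a c"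
    and br_smult_left: "\<lbrakk>r \<in> carrier K; a \<in> carrier P; b \<in> carrier P\<rbrakk> \<Longrightarrow>
      br (r \<odot>\<^bsub>P\<^esub> a) b = r \<odot>\<^bsub>P\<^esub> br a b"
    and br_smult_right: "\<lbrakk>r \<in> carrier K; a \<in> carrier P; b \<in> carrier P\<rbrakk> \<Longrightarrow>
      br a (r \<odot>\<^bsub>P\<^esub> b) = r \<odot>\<^bsub>P\<^esub> br a b"
    and br_alternating: "a \<in> carrier P \<Longrightarrow> br a a = \<zero>\<^bsub>P\<^esub>"
    and br_jacobi: "\<lbrakk>a \<in> carrier P; b \<in> carrier P; c \<in> carrier P\<rbrakk> \<Longrightarrow>
      br a (br b c) \<oplus>\<^bsub>P\<^esub> br b (br c a) \<oplus>\<^bsub>P\<^esub> br c (br a b) = \<zero>\<^bsub>P\<^esub>"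
    and br_leibniz: "\<lbrakk>a \<in> carrier P; x \<in> carrier P; y \<in> carrier P\<rbrakk> \<Longrightarrow>
      br a (x \<otimes>\<^bsub>P\<^esub> y) = br a x \<otimes>\<^bsub>P\<^esub> y \<oplus>\<^bsub>P\<^esub> x \<otimes>\<^bsub>P\<^esub> br a y"

definition poisson_triple ::
    "'k ring \<Rightarrow> ('k, 'p) module \<Rightarrow> ('p \<Rightarrow> 'p \<Rightarrow> 'p) \<Rightarrow> ('k, 'u) module \<Rightarrow> ('p \<Rightarrow> 'u) \<Rightarrow> ('p \<Rightarrow> 'u) \<Rightarrow> bool"
  where
  "poisson_triple K P br U \<alpha> \<beta> \<longleftrightarrow>
     assoc_algebra K U \<and> \<alpha> \<in> alg_hom K P U \<and> \<beta> \<in> carrier P \<rightarrow> carrier U \<and>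
     (\<forall>a\<in>carrier P. \<forall>b\<in>carrier P. \<beta> (a \<oplus>\<^bsub>P\<^esub> b) = \<beta> a \<oplus>\<^bsub>U\<^esub> \<beta> b) \<and>
     (\<forall>c\<in>carrier K. \<forall>a\<in>carrier P. \<beta> (c \<odot>\<^bsub>P\<^esub> a) = c \<odot>\<^bsub>U\<^esub> \<beta> a) \<and>
     (\<forall>a\<in>carrier P. \<forall>b\<in>carrier P. \<beta> (br a b) = commutator U (\<beta> a) (\<beta> b)) \<and>
     (\<forall>a\<in>carrier P. \<forall>b\<in>carrier P. commutator U (\<beta> a) (\<alpha> b) = \<alpha> (br a b)) \<and>
     (\<forall>a\<in>carrier P. \<forall>b\<in>carrier P.
        \<beta> (a \<otimes>\<^bsub>P\<^esub> b) = \<beta> a \<otimes>\<^bsub>U\<^esub> \<alpha> b \<oplus>\<^bsub>U\<^esub> \<alpha> a \<otimes>\<^bsub>U\<^esub> \<beta> b)"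

text \<open>HOL cannot quantify over types inside a formula, so the universal property ranges over the
  target algebras \<open>B\<close> whose elements have the same type as those of \<open>U\<close>. The unrestricted
  universal property implies this one, so a theorem that assumes
  \<open>poisson_enveloping_algebra\<close> applies to every Poisson enveloping algebra.\<close>

definition poisson_enveloping_algebra ::
    "'k ring \<Rightarrow> ('k, 'p) module \<Rightarrow> ('p \<Rightarrow> 'p \<Rightarrow> 'p) \<Rightarrow> ('k, 'u) module \<Rightarrow> ('p \<Rightarrow> 'u) \<Rightarrow> ('p \<Rightarrow> 'u) \<Rightarrow> bool"
  where
  "poisson_enveloping_algebra K P br U \<alpha> \<beta> \<longleftrightarrow>
     poisson_triple K P br U \<alpha> \<beta> \<and>
     (\<forall>(B :: ('k, 'u) module) \<gamma> \<delta>. poisson_triple K P br B \<gamma> \<delta> \<longrightarrow>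
        (\<exists>h\<in>alg_hom K U B.
           (\<forall>a\<in>carrier P. h (\<alpha> a) = \<gamma> a \<and> h (\<beta> a) = \<delta> a) \<and>
           (\<forall>h'\<in>alg_hom K U B. (\<forall>a\<in>carrier P. h' (\<alpha> a) = \<gamma> a \<and> h' (\<beta> a) = \<delta> a) \<longrightarrow>
              (\<forall>u\<in>carrier U. h' u = h u))))"


section \<open>The algebra \<open>S\<^sup>-\<^sup>1(P\<^sub>\<Lambda>/I)\<close> and its partial derivatives\<close>

type_synonym ('k, 'x) loc_elem = "(('k, 'x) poly_fun set \<times> ('k, 'x) poly_fun set) set"

definition rel_ideal :: "'k ring \<Rightarrow> 'x set \<Rightarrow> 's set \<Rightarrow> ('s \<Rightarrow> ('k, 'x) poly_fun) \<Rightarrow> ('k, 'x) poly_fun set" where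
  "rel_ideal K \<Lambda> \<Gamma> f = Idl\<^bsub>poly_alg K \<Lambda>\<^esub> (f ` \<Gamma>)"

definition coord_alg ::
    "'k ring \<Rightarrow> 'x set \<Rightarrow> 's set \<Rightarrow> ('s \<Rightarrow> ('k, 'x) poly_fun) \<Rightarrow> ('k, ('k, 'x) poly_fun set) module" where
  "coord_alg K \<Lambda> \<Gamma> f = quot_alg (poly_alg K \<Lambda>) (rel_ideal K \<Lambda> \<Gamma> f)"

context
  fixes K :: "'k ring" and \<Lambda> :: "'x set" and \<Gamma> :: "'s set" and f :: "'s \<Rightarrow> ('k, 'x) poly_fun"
    and S :: "('k, 'x) poly_fun set set"
begin

definition poly_class :: "('k, 'x) poly_fun \<Rightarrow> ('k, 'x) poly_fun set" where
  "poly_class p = rel_ideal K \<Lambda> \<Gamma> f +>\<^bsub>poly_alg K \<Lambda>\<^esub> p"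

definition frac_image :: "('k, 'x) poly_fun \<Rightarrow> ('k, 'x) poly_fun \<Rightarrow> ('k, 'x) loc_elem" where
  "frac_image p q = loc_frac (coord_alg K \<Lambda> \<Gamma> f) S (poly_class p) (poly_class q)"

definition var_image :: "'x \<Rightarrow> ('k, 'x) loc_elem" where
  "var_image i = frac_image (poly_var K i) \<one>\<^bsub>poly_alg K \<Lambda>\<^esub>"

text \<open>The fractions \<open>p/q\<close> in the localization of \<open>P\<^sub>\<Lambda>\<close> at the preimage of \<open>S\<close> that map to \<open>g\<close>.\<close>

definition representatives :: "('k, 'x) loc_elem \<Rightarrow> (('k, 'x) poly_fun \<times> ('k, 'x) poly_fun) set" where
  "representatives g = {(p, q). p \<in> carrier (poly_alg K \<Lambda>) \<and> q \<in> carrier (poly_alg K \<Lambda>) \<and>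
     poly_class q \<in> S \<and> frac_image p q = g}"

text \<open>Image of \<open>\<partial>(p/q)/\<partial>x\<^sub>k\<close>, by the quotient rule. It depends only on the fraction \<open>p/q\<close>, but not
  only on its image in \<open>S\<^sup>-\<^sup>1(P\<^sub>\<Lambda>/I)\<close>.\<close>

definition frac_pderiv :: "'x \<Rightarrow> ('k, 'x) poly_fun \<times> ('k, 'x) poly_fun \<Rightarrow> ('k, 'x) loc_elem" where
  "frac_pderiv k = (\<lambda>(p, q). let R = poly_alg K \<Lambda> in
     frac_image (poly_pderiv K k p \<otimes>\<^bsub>R\<^esub> q \<ominus>\<^bsub>R\<^esub> p \<otimes>\<^bsub>R\<^esub> poly_pderiv K k q) (q \<otimes>\<^bsub>R\<^esub> q))"

text \<open>Image of \<open>\<partial>f\<^sub>s/\<partial>x\<^sub>k\<close>: the polynomial \<open>f\<^sub>s\<close> itself is differentiated, its class being zero.\<close>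

definition rel_pderiv :: "'s \<Rightarrow> 'x \<Rightarrow> ('k, 'x) loc_elem" where
  "rel_pderiv s k = frac_image (poly_pderiv K k (f s)) \<one>\<^bsub>poly_alg K \<Lambda>\<^esub>"

end


section \<open>The algebra \<open>F\<^sub>a\<^sub>b\<close> and the explicit enveloping algebra\<close>

text \<open>Parameters: \<open>x i\<close> is the image of the variable \<open>x\<^sub>i\<close> in \<open>P\<close>, \<open>D g k\<close> is \<open>\<partial>g/\<partial>x\<^sub>k\<close>, and \<open>E s k\<close> is
  \<open>\<partial>f\<^sub>s/\<partial>x\<^sub>k\<close>. In the free algebra on \<open>Sum_Type.Plus (carrier P) \<Lambda>\<close>, the letter \<open>Inl a\<close> stands for the element \<open>a\<close> of
  \<open>P\<close>, the letter \<open>Inr i\<close> for \<open>\<delta>\<^sub>i\<close>. The first quotient, by the relations that hold in \<open>P\<close>, is the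
  algebra generated by the algebra \<open>P\<close> and free generators \<open>\<delta>\<^sub>i\<close>.\<close>

type_synonym ('k, 'p, 'x) word_poly = "('p + 'x) list \<Rightarrow> 'k"

context
  fixes K :: "'k ring" and \<Lambda> :: "'x set" and P :: "('k, 'p) module"
begin

definition word_alg :: "('k, ('k, 'p, 'x) word_poly) module" where
  "word_alg = free_alg K (Sum_Type.Plus (carrier P) \<Lambda>)"

definition letter :: "'p + 'x \<Rightarrow> ('k, 'p, 'x) word_poly" where
  "letter z = basis_elem K [z]"

definition alg_relations :: "('k, 'p, 'x) word_poly set" where
  "alg_relations =
     {letter (Inl (a \<oplus>\<^bsub>P\<^esub> b)) \<ominus>\<^bsub>word_alg\<^esub> (letter (Inl a) \<oplus>\<^bsub>word_alg\<^esub> letter (Inl b))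
        |a b. a \<in> carrier P \<and> b \<in> carrier P} \<union>
     {letter (Inl (a \<otimes>\<^bsub>P\<^esub> b)) \<ominus>\<^bsub>word_alg\<^esub> (letter (Inl a) \<otimes>\<^bsub>word_alg\<^esub> letter (Inl b))
        |a b. a \<in> carrier P \<and> b \<in> carrier P} \<union>
     {letter (Inl (c \<odot>\<^bsub>P\<^esub> a)) \<ominus>\<^bsub>word_alg\<^esub> (c \<odot>\<^bsub>word_alg\<^esub> letter (Inl a))
        |c a. c \<in> carrier K \<and> a \<in> carrier P} \<union>
     {letter (Inl \<one>\<^bsub>P\<^esub>) \<ominus>\<^bsub>word_alg\<^esub> \<one>\<^bsub>word_alg\<^esub>}"

definition free_ext :: "('k, ('k, 'p, 'x) word_poly set) module" where
  "free_ext = quot_alg word_alg (Idl\<^bsub>word_alg\<^esub> alg_relations)"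

definition free_ext_incl :: "'p \<Rightarrow> ('k, 'p, 'x) word_poly set" where
  "free_ext_incl a = (Idl\<^bsub>word_alg\<^esub> alg_relations) +>\<^bsub>word_alg\<^esub> letter (Inl a)"

definition free_ext_delta :: "'x \<Rightarrow> ('k, 'p, 'x) word_poly set" where
  "free_ext_delta i = (Idl\<^bsub>word_alg\<^esub> alg_relations) +>\<^bsub>word_alg\<^esub> letter (Inr i)"

context
  fixes br :: "'p \<Rightarrow> 'p \<Rightarrow> 'p" and x :: "'x \<Rightarrow> 'p" and D :: "'p \<Rightarrow> 'x \<Rightarrow> 'p"
begin

definition F_ab_ideal :: "('k, 'p, 'x) word_poly set set" where
  "F_ab_ideal = Idl\<^bsub>free_ext\<^esub>
     ({commutator free_ext (free_ext_delta i) (free_ext_delta j) \<ominus>\<^bsub>free_ext\<^esub>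
         fsum free_ext \<Lambda> (\<lambda>k. free_ext_incl (D (br (x i) (x j)) k) \<otimes>\<^bsub>free_ext\<^esub> free_ext_delta k)
        |i j. i \<in> \<Lambda> \<and> j \<in> \<Lambda>} \<union>
      {commutator free_ext (free_ext_delta i) (free_ext_incl (x j)) \<ominus>\<^bsub>free_ext\<^esub>
         free_ext_incl (br (x i) (x j))
        |i j. i \<in> \<Lambda> \<and> j \<in> \<Lambda>})"

definition F_ab :: "('k, ('k, 'p, 'x) word_poly set set) module" where
  "F_ab = quot_alg free_ext F_ab_ideal"

definition F_ab_incl :: "'p \<Rightarrow> ('k, 'p, 'x) word_poly set set" where
  "F_ab_incl a = F_ab_ideal +>\<^bsub>free_ext\<^esub> free_ext_incl a"

definition F_ab_delta :: "'x \<Rightarrow> ('k, 'p, 'x) word_poly set set" where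
  "F_ab_delta i = F_ab_ideal +>\<^bsub>free_ext\<^esub> free_ext_delta i"

context
  fixes \<Gamma> :: "'s set" and E :: "'s \<Rightarrow> 'x \<Rightarrow> 'p"
begin

definition env_ideal :: "('k, 'p, 'x) word_poly set set set" where
  "env_ideal = Idl\<^bsub>F_ab\<^esub>
     {fsum F_ab \<Lambda> (\<lambda>i. F_ab_incl (E s i) \<otimes>\<^bsub>F_ab\<^esub> F_ab_delta i) |s. s \<in> \<Gamma>}"

definition env_alg :: "('k, ('k, 'p, 'x) word_poly set set set) module" where
  "env_alg = quot_alg F_ab env_ideal"

definition env_incl :: "'p \<Rightarrow> ('k, 'p, 'x) word_poly set set set" where
  "env_incl a = env_ideal +>\<^bsub>F_ab\<^esub> F_ab_incl a"

definition env_delta :: "'x \<Rightarrow> ('k, 'p, 'x) word_poly set set set" where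
  "env_delta i = env_ideal +>\<^bsub>F_ab\<^esub> F_ab_delta i"

end

end

end


section \<open>The map \<open>a \<mapsto> a\<close>, \<open>\<delta>\<^sub>i \<mapsto> -\<delta>\<^sub>i\<close>\<close>

definition sign_flip ::
    "'k ring \<Rightarrow> 'p set \<Rightarrow> 'x set \<Rightarrow> ('k, 'a) module \<Rightarrow> ('p \<Rightarrow> 'a) \<Rightarrow> ('x \<Rightarrow> 'a) \<Rightarrow> ('a \<Rightarrow> 'a) \<Rightarrow> bool" where
  "sign_flip K C \<Lambda> A \<iota> d \<phi> \<longleftrightarrow>
     \<phi> \<in> alg_hom K A (opp_alg A) \<and>
     (\<forall>a\<in>C. \<phi> (\<iota> a) = \<iota> a) \<and> (\<forall>i\<in>\<Lambda>. \<phi> (d i) = \<ominus>\<^bsub>A\<^esub> d i)"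

text \<open>``The map given on generators by ... is an isomorphism'': a homomorphism with these values
  exists, is unique on the carrier, and is bijective.\<close>

definition sign_flip_is_iso ::
    "'k ring \<Rightarrow> 'p set \<Rightarrow> 'x set \<Rightarrow> ('k, 'a) module \<Rightarrow> ('p \<Rightarrow> 'a) \<Rightarrow> ('x \<Rightarrow> 'a) \<Rightarrow> bool" where
  "sign_flip_is_iso K C \<Lambda> A \<iota> d \<longleftrightarrow>
     (\<exists>\<phi>. sign_flip K C \<Lambda> A \<iota> d \<phi> \<and> \<phi> \<in> alg_iso K A (opp_alg A) \<and>
        (\<forall>\<psi>. sign_flip K C \<Lambda> A \<iota> d \<psi> \<longrightarrow> (\<forall>u\<in>carrier A. \<psi> u = \<phi> u)))"

end

theory Submission
  imports Defs
begin

text \<open>Call \<open>(v\<^sub>k)\<close> a gradient of \<open>a \<in> P\<close> if it has finite support, \<open>{y, a} = \<Sum> v\<^sub>k {y, x\<^sub>k}\<close> for all \<open>y\<close>, and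
  \<open>\<Sum> {v\<^sub>k, x\<^sub>k} = 0\<close>. Elements with a gradient are closed under linear combinations, products and
  inverses of units, with the gradient given by the usual rules; hence the partial derivatives of any
  representative of \<open>g\<close> form a gradient of \<open>g\<close>, which is (3), and those of \<open>f\<^sub>s\<close> form a gradient
  of \<open>0\<close>. Moreover \<open>[\<delta>\<^sub>k, a] = {x\<^sub>k, a}\<close> for all \<open>a \<in> P\<close>, since both sides are derivations in \<open>a\<close>. Therefore
  \<open>\<Sum> (-\<delta>\<^sub>k) v\<^sub>k = -\<Sum> v\<^sub>k \<delta>\<^sub>k\<close> for every gradient \<open>v\<close>, so the flipped generators satisfy the defining
  relations in the opposite algebra. The induced homomorphism is its own inverse. For an abstract
  enveloping algebra \<open>(U, \<alpha>, \<beta>)\<close> the triple \<open>(U\<^sup>o\<^sup>p, \<alpha>, -\<beta>)\<close> again satisfies the defining identities.\<close>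

section \<open>Algebra homomorphisms, opposite algebras and quotients\<close>

text \<open>Everything hinges on one correction term. In the opposite algebra the product of
  \<open>v k\<close> and \<open>-\<delta> k\<close> is
  \<open>-(v k) (\<delta> k) + {v k, x k}\<close>, so flipping a sum
  \<open>\<Sum> (v k) (\<delta> k)\<close> gives its negative plus the image of the divergence
  \<open>\<Sum> {v k, x k}\<close>. Hence (3) is not a by-product of (1) and (2) but the fact that
  makes them work. The obstacle to (3) is that partial derivatives do not descend to
  \<open>P\<close>: two representatives of one element may differ by multiples of the relators, and
  a choice of representatives respects neither sums nor products. An induction over \<open>P\<close>
  with \<open>D\<close> is therefore impossible. Being a gradient is a relation between an element
  and a vector, and the induction runs over polynomials and then fractions, whose formal derivatives
  do obey the rules. The target of a flip is an opposite algebra, which has the same carrier type as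
  the algebra itself. For this reason the universal property restricted to one type suffices for
  abstract enveloping algebras.\<close>

lemma alg_homI:
  assumes "\<And>x. x \<in> carrier A \<Longrightarrow> h x \<in> carrier B"
    and "\<And>x y. \<lbrakk>x \<in> carrier A; y \<in> carrier A\<rbrakk> \<Longrightarrow> h (x \<otimes>\<^bsub>A\<^esub> y) = h x \<otimes>\<^bsub>B\<^esub> h y"
    and "\<And>x y. \<lbrakk>x \<in> carrier A; y \<in> carrier A\<rbrakk> \<Longrightarrow> h (x \<oplus>\<^bsub>A\<^esub> y) = h x \<oplus>\<^bsub>B\<^esub> h y"
    and "h \<one>\<^bsub>A\<^esub> = \<one>\<^bsub>B\<^esub>"
    and "\<And>c x. \<lbrakk>c \<in> carrier K; x \<in> carrier A\<rbrakk> \<Longrightarrow> h (c \<odot>\<^bsub>A\<^esub> x) = c \<odot>\<^bsub>B\<^esub> h x"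
  shows "h \<in> alg_hom K A B"
  using assms by (auto simp: alg_hom_def intro!: ring_hom_memI)

lemma
  assumes "h \<in> alg_hom K A B"
  shows alg_hom_closed: "x \<in> carrier A \<Longrightarrow> h x \<in> carrier B"
    and alg_hom_mult: "\<lbrakk>x \<in> carrier A; y \<in> carrier A\<rbrakk> \<Longrightarrow> h (x \<otimes>\<^bsub>A\<^esub> y) = h x \<otimes>\<^bsub>B\<^esub> h y"
    and alg_hom_add: "\<lbrakk>x \<in> carrier A; y \<in> carrier A\<rbrakk> \<Longrightarrow> h (x \<oplus>\<^bsub>A\<^esub> y) = h x \<oplus>\<^bsub>B\<^esub> h y"
    and alg_hom_one: "h \<one>\<^bsub>A\<^esub> = \<one>\<^bsub>B\<^esub>"
    and alg_hom_smult: "\<lbrakk>c \<in> carrier K; x \<in> carrier A\<rbrakk> \<Longrightarrow> h (c \<odot>\<^bsub>A\<^esub> x) = c \<odot>\<^bsub>B\<^esub> h x"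
  using assms by (auto simp: alg_hom_def ring_hom_memE)

lemma alg_hom_ring_hom_ring:
  assumes "h \<in> alg_hom K A B" "ring A" "ring B"
  shows "ring_hom_ring A B h"
  using assms by (auto simp: alg_hom_def intro: ring_hom_ringI2)

lemma
  assumes "h \<in> alg_hom K A B" "ring A" "ring B"
  shows alg_hom_zero: "h \<zero>\<^bsub>A\<^esub> = \<zero>\<^bsub>B\<^esub>"
    and alg_hom_a_inv: "x \<in> carrier A \<Longrightarrow> h (\<ominus>\<^bsub>A\<^esub> x) = \<ominus>\<^bsub>B\<^esub> h x"
    and alg_hom_minus: "\<lbrakk>x \<in> carrier A; y \<in> carrier A\<rbrakk> \<Longrightarrow> h (x \<ominus>\<^bsub>A\<^esub> y) = h x \<ominus>\<^bsub>B\<^esub> h y"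
    and alg_hom_finsum: "t \<in> N \<rightarrow> carrier A \<Longrightarrow> h (finsum A t N) = finsum B (\<lambda>i. h (t i)) N"
    and alg_hom_commutator:
      "\<lbrakk>x \<in> carrier A; y \<in> carrier A\<rbrakk> \<Longrightarrow> h (commutator A x y) = commutator B (h x) (h y)"
proof -
  interpret ring_hom_ring A B h
    using assms by (rule alg_hom_ring_hom_ring)
  show "h \<zero>\<^bsub>A\<^esub> = \<zero>\<^bsub>B\<^esub>" by simp
  show "x \<in> carrier A \<Longrightarrow> h (\<ominus>\<^bsub>A\<^esub> x) = \<ominus>\<^bsub>B\<^esub> h x" by simp
  show *: "\<lbrakk>x \<in> carrier A; y \<in> carrier A\<rbrakk> \<Longrightarrow> h (x \<ominus>\<^bsub>A\<^esub> y) = h x \<ominus>\<^bsub>B\<^esub> h y" for x y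
    by (simp add: a_minus_def)
  show "t \<in> N \<rightarrow> carrier A \<Longrightarrow> h (finsum A t N) = finsum B (\<lambda>i. h (t i)) N"
    by (simp add: comp_def)
  show "\<lbrakk>x \<in> carrier A; y \<in> carrier A\<rbrakk> \<Longrightarrow> h (commutator A x y) = commutator B (h x) (h y)"
    by (simp add: commutator_def *)
qed

lemma alg_hom_id: "(\<lambda>a. a) \<in> alg_hom K A A"
  by (rule alg_homI) auto

lemma alg_hom_compose:
  assumes "h \<in> alg_hom K A B" "g \<in> alg_hom K B C"
  shows "(\<lambda>a. g (h a)) \<in> alg_hom K A C"
  using assms by (intro alg_homI) (auto simp: alg_hom_closed alg_hom_mult alg_hom_add alg_hom_one alg_hom_smult)

lemma (in assoc_algebra) ring_A: "ring A" ..

lemma (in algebra) ring_M: "ring M"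
  using M_cring by (rule cring.axioms)

lemma opp_alg_simps [simp]:
  "carrier (opp_alg A) = carrier A" "x \<otimes>\<^bsub>opp_alg A\<^esub> y = y \<otimes>\<^bsub>A\<^esub> x"
  "\<one>\<^bsub>opp_alg A\<^esub> = \<one>\<^bsub>A\<^esub>" "\<zero>\<^bsub>opp_alg A\<^esub> = \<zero>\<^bsub>A\<^esub>"
  "x \<oplus>\<^bsub>opp_alg A\<^esub> y = x \<oplus>\<^bsub>A\<^esub> y" "c \<odot>\<^bsub>opp_alg A\<^esub> x = c \<odot>\<^bsub>A\<^esub> x"
  by (simp_all add: opp_alg_def)

lemma opp_alg_derived_simps [simp]:
  "\<ominus>\<^bsub>opp_alg A\<^esub> x = \<ominus>\<^bsub>A\<^esub> x" "x \<ominus>\<^bsub>opp_alg A\<^esub> y = x \<ominus>\<^bsub>A\<^esub> y"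
  "finsum (opp_alg A) t N = finsum A t N" "fsum (opp_alg A) J t = fsum A J t"
  by (simp_all add: opp_alg_def a_inv_def a_minus_def finsum_def fsum_def)

lemma opp_opp_alg [simp]: "opp_alg (opp_alg A) = A"
  by (simp add: opp_alg_def)

text \<open>Together with \<open>opp_opp_alg\<close>, this lets a flip from \<open>A\<close> to
  \<open>opp_alg A\<close> be followed by itself, giving an endomorphism of
  \<open>A\<close>.\<close>

lemma alg_hom_opp: "h \<in> alg_hom K A B \<Longrightarrow> h \<in> alg_hom K (opp_alg A) (opp_alg B)"
  by (auto simp: alg_hom_def ring_hom_def)

lemma assoc_algebra_opp:
  assumes "assoc_algebra K A"
  shows "assoc_algebra K (opp_alg A)"
proof -
  interpret assoc_algebra K A by fact
  have "abelian_group (opp_alg A)"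
    by (intro abelian_groupI) (auto simp: M.a_ac intro: bexI[of _ "\<ominus>\<^bsub>A\<^esub> x" for x] M.l_neg)
  moreover have "ring (opp_alg A)"
    by (intro ringI calculation monoidI) (auto simp: m_assoc l_distr r_distr)
  moreover have "module K (opp_alg A)"
    by (intro moduleI calculation R.is_cring) (auto simp: smult_l_distr smult_r_distr smult_assoc1)
  ultimately show ?thesis
    by (intro assoc_algebra.intro assoc_algebra_axioms.intro)
      (auto simp: smult_mult_left smult_mult_right)
qed

text \<open>\<open>fsum\<close> sums over the exact support, which changes with the family. Passing
  to a common finite superset makes sums of different families comparable termwise.\<close>

lemma fsum_eq_finsum:
  assumes "abelian_monoid A" "finite N" "N \<subseteq> J" "\<And>k. k \<in> N \<Longrightarrow> t k \<in> carrier A"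
    and "\<And>k. k \<in> J - N \<Longrightarrow> t k = \<zero>\<^bsub>A\<^esub>"
  shows "fsum A J t = finsum A t N"
proof -
  interpret abelian_monoid A by fact
  show ?thesis
    unfolding fsum_def using assms
    by (intro add.finprod_mono_neutral_cong_left) auto
qed

text \<open>All axioms transport along a surjection that respects the operations, so none has to be
  verified on cosets. The equations are oriented to rewrite computations in \<open>B\<close> into
  computations in \<open>A\<close>.\<close>

lemma assoc_algebra_image:
  assumes "assoc_algebra K A" and surj: "h ` carrier A = carrier B"
    and h_mult: "\<And>x y. \<lbrakk>x \<in> carrier A; y \<in> carrier A\<rbrakk> \<Longrightarrow> h x \<otimes>\<^bsub>B\<^esub> h y = h (x \<otimes>\<^bsub>A\<^esub> y)"
    and h_add: "\<And>x y. \<lbrakk>x \<in> carrier A; y \<in> carrier A\<rbrakk> \<Longrightarrow> h x \<oplus>\<^bsub>B\<^esub> h y = h (x \<oplus>\<^bsub>A\<^esub> y)"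
    and h_one: "\<one>\<^bsub>B\<^esub> = h \<one>\<^bsub>A\<^esub>" and h_zero: "\<zero>\<^bsub>B\<^esub> = h \<zero>\<^bsub>A\<^esub>"
    and h_smult: "\<And>c x. \<lbrakk>c \<in> carrier K; x \<in> carrier A\<rbrakk> \<Longrightarrow> c \<odot>\<^bsub>B\<^esub> h x = h (c \<odot>\<^bsub>A\<^esub> x)"
  shows "assoc_algebra K B"
proof -
  interpret assoc_algebra K A by fact
  have ag: "abelian_group B"
  proof (rule abelian_groupI)
    fix z assume "z \<in> carrier B"
    then obtain x where x: "x \<in> carrier A" "z = h x"
      by (auto simp: surj[symmetric])
    show "\<exists>y\<in>carrier B. y \<oplus>\<^bsub>B\<^esub> z = \<zero>\<^bsub>B\<^esub>"
      by (rule bexI[of _ "h (\<ominus>\<^bsub>A\<^esub> x)"]) (use x in \<open>auto simp: surj[symmetric] h_add h_zero M.l_neg\<close>)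
  qed (auto simp: surj[symmetric] h_add h_zero M.a_assoc, simp add: M.a_comm)
  moreover have "ring B"
    by (intro ringI ag monoidI)
      (auto simp: surj[symmetric] h_add h_mult h_one m_assoc l_distr r_distr)
  moreover have "module K B"
    by (intro moduleI ag R.is_cring)
      (auto simp: surj[symmetric] h_add h_smult smult_l_distr smult_r_distr smult_assoc1)
  ultimately show ?thesis
    by (intro assoc_algebra.intro assoc_algebra_axioms.intro)
      (auto simp: surj[symmetric] h_mult h_smult smult_mult_left smult_mult_right)
qed

section \<open>Quotients by two-sided ideals\<close>

locale quot_algebra = assoc_algebra R A + ideal J A
  for R :: "'k ring" (structure) and A :: "('k, 'a) module" (structure) and J
begin

lemma carrier_quot: "carrier (quot_alg A J) = (\<lambda>a. J +>\<^bsub>A\<^esub> a) ` carrier A"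
  by (auto simp: quot_alg_def FactRing_simps)

lemma coset_eqI:
  assumes "a \<in> carrier A" "b \<in> carrier A" "a \<ominus>\<^bsub>A\<^esub> b \<in> J"
  shows "J +>\<^bsub>A\<^esub> a = J +>\<^bsub>A\<^esub> b"
  using assms quotient_eq_iff_same_a_r_cos[OF ideal_axioms] by simp

lemma coset_mem:
  assumes "a \<in> carrier A" "b \<in> J +>\<^bsub>A\<^esub> a"
  shows "b \<in> carrier A" "b \<ominus>\<^bsub>A\<^esub> a \<in> J"
proof -
  obtain j where j: "j \<in> J" "b = j \<oplus>\<^bsub>A\<^esub> a"
    using assms by (auto simp: a_r_coset_def r_coset_def)
  then have [simp]: "j \<in> carrier A"
    by (simp add: a_Hcarr)
  show "b \<in> carrier A"
    using assms j by simp
  have "b \<ominus>\<^bsub>A\<^esub> a = j"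
    using assms j by (simp add: a_minus_def M.a_assoc M.r_neg)
  then show "b \<ominus>\<^bsub>A\<^esub> a \<in> J"
    using j by simp
qed

text \<open>A ring ideal of a unital algebra is automatically a subspace, because scaling by
  \<open>c\<close> is multiplication by \<open>c 1\<close>.\<close>

lemma smult_J:
  assumes "c \<in> carrier R" "a \<in> J"
  shows "c \<odot>\<^bsub>A\<^esub> a \<in> J"
proof -
  have "c \<odot>\<^bsub>A\<^esub> a = (c \<odot>\<^bsub>A\<^esub> \<one>\<^bsub>A\<^esub>) \<otimes>\<^bsub>A\<^esub> a"
    using assms by (simp add: smult_mult_left a_Hcarr)
  then show ?thesis
    using assms by (simp add: I_l_closed)
qed

lemma quot_simps:
  shows "\<lbrakk>a \<in> carrier A; b \<in> carrier A\<rbrakk> \<Longrightarrow>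
      (J +>\<^bsub>A\<^esub> a) \<otimes>\<^bsub>quot_alg A J\<^esub> (J +>\<^bsub>A\<^esub> b) = J +>\<^bsub>A\<^esub> (a \<otimes>\<^bsub>A\<^esub> b)"
    and "\<lbrakk>a \<in> carrier A; b \<in> carrier A\<rbrakk> \<Longrightarrow>
      (J +>\<^bsub>A\<^esub> a) \<oplus>\<^bsub>quot_alg A J\<^esub> (J +>\<^bsub>A\<^esub> b) = J +>\<^bsub>A\<^esub> (a \<oplus>\<^bsub>A\<^esub> b)"
    and "\<one>\<^bsub>quot_alg A J\<^esub> = J +>\<^bsub>A\<^esub> \<one>\<^bsub>A\<^esub>" and "\<zero>\<^bsub>quot_alg A J\<^esub> = J +>\<^bsub>A\<^esub> \<zero>\<^bsub>A\<^esub>"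
    and "\<lbrakk>c \<in> carrier R; a \<in> carrier A\<rbrakk> \<Longrightarrow> c \<odot>\<^bsub>quot_alg A J\<^esub> (J +>\<^bsub>A\<^esub> a) = J +>\<^bsub>A\<^esub> (c \<odot>\<^bsub>A\<^esub> a)"
proof -
  show "\<lbrakk>a \<in> carrier A; b \<in> carrier A\<rbrakk> \<Longrightarrow>
      (J +>\<^bsub>A\<^esub> a) \<otimes>\<^bsub>quot_alg A J\<^esub> (J +>\<^bsub>A\<^esub> b) = J +>\<^bsub>A\<^esub> (a \<otimes>\<^bsub>A\<^esub> b)"
    by (simp add: quot_alg_def FactRing_def rcoset_mult_add)
  show "\<lbrakk>a \<in> carrier A; b \<in> carrier A\<rbrakk> \<Longrightarrow>
      (J +>\<^bsub>A\<^esub> a) \<oplus>\<^bsub>quot_alg A J\<^esub> (J +>\<^bsub>A\<^esub> b) = J +>\<^bsub>A\<^esub> (a \<oplus>\<^bsub>A\<^esub> b)"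
    by (simp add: quot_alg_def FactRing_def a_rcos_sum)
  show "\<one>\<^bsub>quot_alg A J\<^esub> = J +>\<^bsub>A\<^esub> \<one>\<^bsub>A\<^esub>"
    by (simp add: quot_alg_def FactRing_def)
  show "\<zero>\<^bsub>quot_alg A J\<^esub> = J +>\<^bsub>A\<^esub> \<zero>\<^bsub>A\<^esub>"
    by (simp add: quot_alg_def FactRing_def a_coset_add_zero a_subset)
  show "c \<odot>\<^bsub>quot_alg A J\<^esub> (J +>\<^bsub>A\<^esub> a) = J +>\<^bsub>A\<^esub> (c \<odot>\<^bsub>A\<^esub> a)" if c: "c \<in> carrier R" and a: "a \<in> carrier A"
  proof -
    \<comment> \<open>The scalar action of \<open>quot_alg\<close> is a union over all members of
      the coset; this shows that the family is constant, so the union collapses.\<close>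
    have "J +>\<^bsub>A\<^esub> (c \<odot>\<^bsub>A\<^esub> b) = J +>\<^bsub>A\<^esub> (c \<odot>\<^bsub>A\<^esub> a)" if b: "b \<in> J +>\<^bsub>A\<^esub> a" for b
    proof (rule coset_eqI)
      have "c \<odot>\<^bsub>A\<^esub> b \<ominus>\<^bsub>A\<^esub> c \<odot>\<^bsub>A\<^esub> a = c \<odot>\<^bsub>A\<^esub> (b \<ominus>\<^bsub>A\<^esub> a)"
        using coset_mem[OF a b] a c by (simp add: a_minus_def smult_r_distr smult_r_minus)
      then show "c \<odot>\<^bsub>A\<^esub> b \<ominus>\<^bsub>A\<^esub> c \<odot>\<^bsub>A\<^esub> a \<in> J"
        using smult_J[OF c coset_mem(2)[OF a b]] by simp
    qed (use coset_mem[OF a b] a c in auto)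
    moreover have "a \<in> J +>\<^bsub>A\<^esub> a"
      using a by (rule a_rcos_self)
    ultimately show ?thesis
      unfolding quot_alg_def module.simps by (intro SUP_eq_const) blast+
  qed
qed

lemma assoc_algebra_quot: "assoc_algebra R (quot_alg A J)"
  by (rule assoc_algebra_image[OF assoc_algebra_axioms carrier_quot[symmetric]])
    (simp_all add: quot_simps)

lemma coset_hom: "(\<lambda>a. J +>\<^bsub>A\<^esub> a) \<in> alg_hom R A (quot_alg A J)"
  by (rule alg_homI) (auto simp: quot_simps carrier_quot)

lemma coset_zero: "a \<in> J \<Longrightarrow> J +>\<^bsub>A\<^esub> a = \<zero>\<^bsub>quot_alg A J\<^esub>"
  by (simp add: quot_simps a_coset_add_zero a_subset a_rcos_const)

lemma alg_hom_quot_unique: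
  assumes "\<And>a. a \<in> carrier A \<Longrightarrow> h (J +>\<^bsub>A\<^esub> a) = h' (J +>\<^bsub>A\<^esub> a)" "u \<in> carrier (quot_alg A J)"
  shows "h u = h' u"
  using assms by (auto simp: carrier_quot)

end

lemma quot_algebra_genideal:
  assumes "assoc_algebra K A" "G \<subseteq> carrier A"
  shows "quot_algebra K A (Idl\<^bsub>A\<^esub> G)"
  by (intro quot_algebra.intro ring.genideal_ideal assoc_algebra.ring_A[OF assms(1)] assms)

lemma alg_hom_kernel_ideal:
  assumes h: "h \<in> alg_hom K A B" and "ring A" "ring B"
  shows "ideal {a \<in> carrier A. h a = \<zero>\<^bsub>B\<^esub>} A"
proof -
  interpret ring_hom_ring A B h
    using assms by (rule alg_hom_ring_hom_ring)
  show ?thesis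
    using kernel_is_ideal unfolding a_kernel_def' .
qed

lemma alg_hom_quot_lift:
  assumes "assoc_algebra K A" and B: "assoc_algebra K B" and G: "G \<subseteq> carrier A"
    and h: "h \<in> alg_hom K A B" and hG: "\<And>g. g \<in> G \<Longrightarrow> h g = \<zero>\<^bsub>B\<^esub>"
  obtains h' where "h' \<in> alg_hom K (quot_alg A (Idl\<^bsub>A\<^esub> G)) B"
    "\<And>a. a \<in> carrier A \<Longrightarrow> h' (Idl\<^bsub>A\<^esub> G +>\<^bsub>A\<^esub> a) = h a"
proof -
  interpret assoc_algebra K A by fact
  interpret B: assoc_algebra K B by fact
  interpret Q: quot_algebra K A "Idl\<^bsub>A\<^esub> G"
    using assms(1) G by (rule quot_algebra_genideal)
  have J: "Idl\<^bsub>A\<^esub> G \<subseteq> {a \<in> carrier A. h a = \<zero>\<^bsub>B\<^esub>}"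
    by (rule genideal_minimal[OF alg_hom_kernel_ideal[OF h ring_A B.ring_A]]) (use G hG in auto)
  \<comment> \<open>The induced map evaluates \<open>h\<close> at a chosen member of the coset. The
    choice does not matter: two members differ by an element of the ideal, which by \<open>J\<close>
    lies in the kernel of \<open>h\<close>.\<close>
  define h' where "h' C = h (SOME a. a \<in> C)" for C
  have eq: "h' (Idl\<^bsub>A\<^esub> G +>\<^bsub>A\<^esub> a) = h a" if a: "a \<in> carrier A" for a
  proof -
    define b where "b = (SOME b. b \<in> Idl\<^bsub>A\<^esub> G +>\<^bsub>A\<^esub> a)"
    have b: "b \<in> Idl\<^bsub>A\<^esub> G +>\<^bsub>A\<^esub> a"
      unfolding b_def by (rule someI) (rule Q.a_rcos_self[OF a])
    have "h b \<ominus>\<^bsub>B\<^esub> h a = \<zero>\<^bsub>B\<^esub>"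
      using J Q.coset_mem[OF a b] a by (auto simp: alg_hom_minus[OF h ring_A B.ring_A, symmetric])
    then have "h b = h a"
      using Q.coset_mem[OF a b] a by (simp add: alg_hom_closed[OF h])
    then show ?thesis
      by (simp add: h'_def b_def)
  qed
  have "h' \<in> alg_hom K (quot_alg A (Idl\<^bsub>A\<^esub> G)) B"
    by (rule alg_homI)
      (auto simp: Q.carrier_quot Q.quot_simps eq alg_hom_closed[OF h] alg_hom_mult[OF h] alg_hom_add[OF h]
        alg_hom_one[OF h] alg_hom_smult[OF h])
  then show thesis
    using eq that by blast
qed

section \<open>Monoid algebras\<close>

text \<open>Polynomial algebras and free algebras are both instances, for multisets under addition
  and for words under concatenation, so the algebra axioms are proved once for both.\<close>

locale monoid_alg = K: cring K + M: monoid M for K :: "'k ring" and M :: "'a monoid"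
begin

abbreviation "A \<equiv> monoid_algebra K M"
abbreviation "e \<equiv> basis_elem K"

lemma mem_carrier_iff:
  "f \<in> carrier A \<longleftrightarrow> (\<forall>m. f m \<in> carrier K) \<and> (\<forall>m. m \<notin> carrier M \<longrightarrow> f m = \<zero>\<^bsub>K\<^esub>) \<and>
     finite {m. f m \<noteq> \<zero>\<^bsub>K\<^esub>}"
  by (simp add: monoid_algebra_def)

lemma coeff_closed: "f \<in> carrier A \<Longrightarrow> f m \<in> carrier K"
  by (simp add: mem_carrier_iff)

lemma zero_apply: "\<zero>\<^bsub>A\<^esub> m = \<zero>\<^bsub>K\<^esub>"
  and add_apply: "(f \<oplus>\<^bsub>A\<^esub> g) m = f m \<oplus>\<^bsub>K\<^esub> g m"
  and smult_apply: "(c \<odot>\<^bsub>A\<^esub> f) m = c \<otimes>\<^bsub>K\<^esub> f m"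
  and one_eq: "\<one>\<^bsub>A\<^esub> = e \<one>\<^bsub>M\<^esub>"
  by (simp_all add: monoid_algebra_def basis_elem_def)

lemma module_A: "module K A"
proof (rule moduleI[OF K.is_cring])
  have fin: "finite {m. f m \<oplus>\<^bsub>K\<^esub> g m \<noteq> \<zero>\<^bsub>K\<^esub>}" if "f \<in> carrier A" "g \<in> carrier A" for f g
    by (rule finite_subset[of _ "{m. f m \<noteq> \<zero>\<^bsub>K\<^esub>} \<union> {m. g m \<noteq> \<zero>\<^bsub>K\<^esub>}"])
      (use that in \<open>auto simp: mem_carrier_iff\<close>)
  have "\<exists>g\<in>carrier A. g \<oplus>\<^bsub>A\<^esub> f = \<zero>\<^bsub>A\<^esub>" if "f \<in> carrier A" for f
  proof (rule bexI)
    show "(\<lambda>m. \<ominus>\<^bsub>K\<^esub> f m) \<oplus>\<^bsub>A\<^esub> f = \<zero>\<^bsub>A\<^esub>"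
      using that by (auto simp: add_apply zero_apply mem_carrier_iff K.l_neg)
    have "finite {m. \<ominus>\<^bsub>K\<^esub> f m \<noteq> \<zero>\<^bsub>K\<^esub>}"
      by (rule finite_subset[of _ "{m. f m \<noteq> \<zero>\<^bsub>K\<^esub>}"]) (use that in \<open>auto simp: mem_carrier_iff\<close>)
    then show "(\<lambda>m. \<ominus>\<^bsub>K\<^esub> f m) \<in> carrier A"
      using that by (auto simp: mem_carrier_iff)
  qed
  then show "abelian_group A"
    by (intro abelian_groupI)
      (auto simp: fun_eq_iff add_apply zero_apply coeff_closed K.a_ac, auto simp: mem_carrier_iff add_apply zero_apply fin)
  show "c \<odot>\<^bsub>A\<^esub> f \<in> carrier A" if "c \<in> carrier K" "f \<in> carrier A" for c f
  proof -
    have "finite {m. c \<otimes>\<^bsub>K\<^esub> f m \<noteq> \<zero>\<^bsub>K\<^esub>}"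
      by (rule finite_subset[of _ "{m. f m \<noteq> \<zero>\<^bsub>K\<^esub>}"]) (use that in \<open>auto simp: mem_carrier_iff\<close>)
    then show ?thesis
      using that by (simp add: mem_carrier_iff smult_apply)
  qed
qed (auto simp: fun_eq_iff add_apply smult_apply coeff_closed K.l_distr K.r_distr K.m_assoc)

sublocale A: module K A
  by (rule module_A)

lemma basis_closed: "m \<in> carrier M \<Longrightarrow> e m \<in> carrier A"
proof -
  assume "m \<in> carrier M"
  moreover have "finite {m'. e m m' \<noteq> \<zero>\<^bsub>K\<^esub>}"
    by (rule finite_subset[of _ "{m}"]) (auto simp: basis_elem_def)
  ultimately show ?thesis
    by (auto simp: mem_carrier_iff basis_elem_def)
qed

text \<open>One basis term is split off the support at a time. Associativity, commutativity and
  multiplicativity of linear extensions are multilinear and thereby reduce to basis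
  elements.\<close>

lemma induct_basis [consumes 1, case_names zero add]:
  assumes "f \<in> carrier A" and zero: "Q \<zero>\<^bsub>A\<^esub>"
    and add: "\<And>c m g. \<lbrakk>c \<in> carrier K; m \<in> carrier M; g \<in> carrier A; Q g\<rbrakk> \<Longrightarrow> Q (c \<odot>\<^bsub>A\<^esub> e m \<oplus>\<^bsub>A\<^esub> g)"
  shows "Q f"
proof -
  have "f \<in> carrier A \<Longrightarrow> {m. f m \<noteq> \<zero>\<^bsub>K\<^esub>} \<subseteq> N \<Longrightarrow> Q f" if "finite N" for N f
    using that
  proof (induction N arbitrary: f rule: finite_induct)
    case empty
    then have "f = \<zero>\<^bsub>A\<^esub>" by (auto simp: zero_apply)
    then show ?case using zero by simp
  next
    case (insert m N)
    define g where "g = f(m := \<zero>\<^bsub>K\<^esub>)"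
    have f: "f \<in> carrier A" by fact
    have fin: "finite {m. g m \<noteq> \<zero>\<^bsub>K\<^esub>}"
      by (rule finite_subset[of _ "{m. f m \<noteq> \<zero>\<^bsub>K\<^esub>}"]) (use f in \<open>auto simp: mem_carrier_iff g_def\<close>)
    have g: "g \<in> carrier A"
      using f fin by (auto simp: mem_carrier_iff g_def)
    have Qg: "Q g"
      using insert.prems by (intro insert.IH g) (auto simp: g_def)
    show ?case
    \<comment> \<open>\<open>N\<close> only bounds the support, so \<open>m\<close> need not occur
      in \<open>f\<close>; that \<open>m\<close> belongs to the monoid is known only when its
      coefficient is nonzero.\<close>
    proof (cases "f m = \<zero>\<^bsub>K\<^esub>")
      case True
      then have "f = g" by (auto simp: g_def)
      then show ?thesis using Qg by simp
    next
      case False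
      then have m: "m \<in> carrier M"
        using f by (auto simp: mem_carrier_iff)
      have "f = f m \<odot>\<^bsub>A\<^esub> e m \<oplus>\<^bsub>A\<^esub> g"
        using coeff_closed[OF f] by (auto simp: fun_eq_iff add_apply smult_apply basis_elem_def g_def)
      then show ?thesis
        using add[OF coeff_closed[OF f] m g Qg] by metis
    qed
  qed
  then show ?thesis
    using assms(1) by (auto simp: mem_carrier_iff)
qed

text \<open>The defining sum runs over exact supports. Allowing arbitrary finite supersets
  \<open>V\<close> and \<open>W\<close> puts the products in a distributive or scaling law on one
  index set.\<close>

lemma mult_apply:
  assumes f: "f \<in> carrier A" "finite V" "\<And>m. f m \<noteq> \<zero>\<^bsub>K\<^esub> \<Longrightarrow> m \<in> V"
    and g: "g \<in> carrier A" "finite W" "\<And>m. g m \<noteq> \<zero>\<^bsub>K\<^esub> \<Longrightarrow> m \<in> W"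
  shows "(f \<otimes>\<^bsub>A\<^esub> g) m =
    finsum K (\<lambda>(a, b). f a \<otimes>\<^bsub>K\<^esub> g b) {(a, b). a \<in> V \<and> b \<in> W \<and> a \<otimes>\<^bsub>M\<^esub> b = m}"
proof -
  have "finite {(a, b). a \<in> V \<and> b \<in> W \<and> a \<otimes>\<^bsub>M\<^esub> b = m}"
    by (rule finite_subset[of _ "V \<times> W"]) (use f g in auto)
  then show ?thesis
    unfolding monoid_algebra_def monoid.simps
    by (intro K.add.finprod_mono_neutral_cong_left)
      (use f(3) g(3) coeff_closed[OF f(1)] coeff_closed[OF g(1)] in \<open>auto\<close>)
qed

lemma basis_mult:
  assumes "a \<in> carrier M" "b \<in> carrier M"
  shows "e a \<otimes>\<^bsub>A\<^esub> e b = e (a \<otimes>\<^bsub>M\<^esub> b)"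
proof
  fix m
  have "(e a \<otimes>\<^bsub>A\<^esub> e b) m =
      finsum K (\<lambda>(a', b'). e a a' \<otimes>\<^bsub>K\<^esub> e b b') {(a', b'). a' \<in> {a} \<and> b' \<in> {b} \<and> a' \<otimes>\<^bsub>M\<^esub> b' = m}"
    by (intro mult_apply basis_closed assms) (auto simp: basis_elem_def split: if_splits)
  also have "{(a', b'). a' \<in> {a} \<and> b' \<in> {b} \<and> a' \<otimes>\<^bsub>M\<^esub> b' = m} = (if a \<otimes>\<^bsub>M\<^esub> b = m then {(a, b)} else {})"
    by auto
  also have "finsum K (\<lambda>(a', b'). e a a' \<otimes>\<^bsub>K\<^esub> e b b') \<dots> = e (a \<otimes>\<^bsub>M\<^esub> b) m"
    by (auto simp: basis_elem_def)
  finally show "(e a \<otimes>\<^bsub>A\<^esub> e b) m = e (a \<otimes>\<^bsub>M\<^esub> b) m" .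
qed

lemma mult_closed:
  assumes "f \<in> carrier A" "g \<in> carrier A"
  shows "f \<otimes>\<^bsub>A\<^esub> g \<in> carrier A"
proof -
  let ?V = "{m. f m \<noteq> \<zero>\<^bsub>K\<^esub>}" and ?W = "{m. g m \<noteq> \<zero>\<^bsub>K\<^esub>}"
  have fin: "finite ?V" "finite ?W" and M: "?V \<subseteq> carrier M" "?W \<subseteq> carrier M"
    using assms by (auto simp: mem_carrier_iff)
  have eq: "(f \<otimes>\<^bsub>A\<^esub> g) m =
    finsum K (\<lambda>(a, b). f a \<otimes>\<^bsub>K\<^esub> g b) {(a, b). a \<in> ?V \<and> b \<in> ?W \<and> a \<otimes>\<^bsub>M\<^esub> b = m}" for m
    by (rule mult_apply) (use assms fin in auto)
  have supp: "m \<in> (\<lambda>(a, b). a \<otimes>\<^bsub>M\<^esub> b) ` (?V \<times> ?W)" if "(f \<otimes>\<^bsub>A\<^esub> g) m \<noteq> \<zero>\<^bsub>K\<^esub>" for m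
  proof (rule ccontr)
    assume "m \<notin> (\<lambda>(a, b). a \<otimes>\<^bsub>M\<^esub> b) ` (?V \<times> ?W)"
    then have empty: "{(a, b). a \<in> ?V \<and> b \<in> ?W \<and> a \<otimes>\<^bsub>M\<^esub> b = m} = {}"
      by force
    show False
      using that unfolding eq empty by simp
  qed
  have "finite {m. (f \<otimes>\<^bsub>A\<^esub> g) m \<noteq> \<zero>\<^bsub>K\<^esub>}"
    by (rule finite_subset[OF _ finite_imageI[OF finite_cartesian_product[OF fin]]]) (use supp in blast)
  moreover have "(f \<otimes>\<^bsub>A\<^esub> g) m = \<zero>\<^bsub>K\<^esub>" if "m \<notin> carrier M" for m
  proof (rule ccontr)
    assume "(f \<otimes>\<^bsub>A\<^esub> g) m \<noteq> \<zero>\<^bsub>K\<^esub>"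
    then obtain a b where "a \<in> ?V" "b \<in> ?W" "m = a \<otimes>\<^bsub>M\<^esub> b"
      using supp[of m] by (auto elim!: imageE)
    with M have "m \<in> carrier M"
      by (metis M.m_closed subsetD)
    then show False
      using that by simp
  qed
  moreover have "(f \<otimes>\<^bsub>A\<^esub> g) m \<in> carrier K" for m
    unfolding eq by (intro K.finsum_closed) (use assms coeff_closed in auto)
  ultimately show ?thesis
    by (simp add: mem_carrier_iff)
qed

lemma
  assumes f: "f \<in> carrier A" and g: "g \<in> carrier A" and h: "h \<in> carrier A"
  shows mult_add_left: "(f \<oplus>\<^bsub>A\<^esub> g) \<otimes>\<^bsub>A\<^esub> h = f \<otimes>\<^bsub>A\<^esub> h \<oplus>\<^bsub>A\<^esub> g \<otimes>\<^bsub>A\<^esub> h"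
    and mult_add_right: "h \<otimes>\<^bsub>A\<^esub> (f \<oplus>\<^bsub>A\<^esub> g) = h \<otimes>\<^bsub>A\<^esub> f \<oplus>\<^bsub>A\<^esub> h \<otimes>\<^bsub>A\<^esub> g"
    and mult_smult_left: "c \<in> carrier K \<Longrightarrow> (c \<odot>\<^bsub>A\<^esub> f) \<otimes>\<^bsub>A\<^esub> h = c \<odot>\<^bsub>A\<^esub> (f \<otimes>\<^bsub>A\<^esub> h)"
    and mult_smult_right: "c \<in> carrier K \<Longrightarrow> h \<otimes>\<^bsub>A\<^esub> (c \<odot>\<^bsub>A\<^esub> f) = c \<odot>\<^bsub>A\<^esub> (h \<otimes>\<^bsub>A\<^esub> f)"
proof -
  let ?V = "{m. f m \<noteq> \<zero>\<^bsub>K\<^esub>} \<union> {m. g m \<noteq> \<zero>\<^bsub>K\<^esub>}" and ?W = "{m. h m \<noteq> \<zero>\<^bsub>K\<^esub>}"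
  have fin: "finite ?V" "finite ?W"
    using assms by (auto simp: mem_carrier_iff)
  have fin2: "finite {(a, b). a \<in> ?V \<and> b \<in> ?W \<and> a \<otimes>\<^bsub>M\<^esub> b = m}" for m
    by (rule finite_subset[OF _ finite_cartesian_product[OF fin]]) auto
  have fin3: "finite {(a, b). a \<in> ?W \<and> b \<in> ?V \<and> a \<otimes>\<^bsub>M\<^esub> b = m}" for m
    by (rule finite_subset[OF _ finite_cartesian_product[OF fin(2) fin(1)]]) auto
  note [simp] = coeff_closed[OF f] coeff_closed[OF g] coeff_closed[OF h]
  have fg: "m \<in> ?V" if "(f \<oplus>\<^bsub>A\<^esub> g) m \<noteq> \<zero>\<^bsub>K\<^esub>" for m
    using that by (auto simp: add_apply)
  have cf: "m \<in> ?V" if "c \<in> carrier K" "(c \<odot>\<^bsub>A\<^esub> f) m \<noteq> \<zero>\<^bsub>K\<^esub>" for m c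
    using that by (auto simp: smult_apply)
  note L = mult_apply[OF _ fin(1) _ h fin(2)] and R = mult_apply[OF h fin(2) _ _ fin(1)]
  show "(f \<oplus>\<^bsub>A\<^esub> g) \<otimes>\<^bsub>A\<^esub> h = f \<otimes>\<^bsub>A\<^esub> h \<oplus>\<^bsub>A\<^esub> g \<otimes>\<^bsub>A\<^esub> h"
  proof
    fix m
    show "((f \<oplus>\<^bsub>A\<^esub> g) \<otimes>\<^bsub>A\<^esub> h) m = (f \<otimes>\<^bsub>A\<^esub> h \<oplus>\<^bsub>A\<^esub> g \<otimes>\<^bsub>A\<^esub> h) m"
      using L[OF A.a_closed[OF f g] fg, of m] L[OF f, of m] L[OF g, of m]
      by (auto simp: add_apply K.l_distr split_def simp flip: K.finsum_addf intro!: K.finsum_cong)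
  qed
  show "h \<otimes>\<^bsub>A\<^esub> (f \<oplus>\<^bsub>A\<^esub> g) = h \<otimes>\<^bsub>A\<^esub> f \<oplus>\<^bsub>A\<^esub> h \<otimes>\<^bsub>A\<^esub> g"
  proof
    fix m
    show "(h \<otimes>\<^bsub>A\<^esub> (f \<oplus>\<^bsub>A\<^esub> g)) m = (h \<otimes>\<^bsub>A\<^esub> f \<oplus>\<^bsub>A\<^esub> h \<otimes>\<^bsub>A\<^esub> g) m"
      using R[OF _ A.a_closed[OF f g] fg, of m] R[OF _ f, of m] R[OF _ g, of m]
      by (auto simp: add_apply K.r_distr split_def simp flip: K.finsum_addf intro!: K.finsum_cong)
  qed
  assume c: "c \<in> carrier K"
  show "(c \<odot>\<^bsub>A\<^esub> f) \<otimes>\<^bsub>A\<^esub> h = c \<odot>\<^bsub>A\<^esub> (f \<otimes>\<^bsub>A\<^esub> h)"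
  proof
    fix m
    show "((c \<odot>\<^bsub>A\<^esub> f) \<otimes>\<^bsub>A\<^esub> h) m = (c \<odot>\<^bsub>A\<^esub> (f \<otimes>\<^bsub>A\<^esub> h)) m"
      using L[OF A.smult_closed[OF c f] cf[OF c], of m] L[OF f, of m] fin2[of m] c
      by (auto simp: smult_apply K.m_assoc K.finsum_rdistr split_def intro!: K.finsum_cong)
  qed
  show "h \<otimes>\<^bsub>A\<^esub> (c \<odot>\<^bsub>A\<^esub> f) = c \<odot>\<^bsub>A\<^esub> (h \<otimes>\<^bsub>A\<^esub> f)"
  proof
    fix m
    show "(h \<otimes>\<^bsub>A\<^esub> (c \<odot>\<^bsub>A\<^esub> f)) m = (c \<odot>\<^bsub>A\<^esub> (h \<otimes>\<^bsub>A\<^esub> f)) m"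
      using R[OF _ A.smult_closed[OF c f] cf[OF c], of m] R[OF _ f, of m] fin3[of m] c
      by (auto simp: smult_apply K.m_lcomm[of _ c] K.finsum_rdistr split_def intro!: K.finsum_cong)
  qed
qed

lemmas mult_linear = mult_add_left mult_add_right mult_smult_left mult_smult_right

text \<open>Obtained from homogeneity with the scalar \<open>0\<close>, since the ring axioms are
  not yet available here.\<close>

lemma zero_mult: "h \<in> carrier A \<Longrightarrow> \<zero>\<^bsub>A\<^esub> \<otimes>\<^bsub>A\<^esub> h = \<zero>\<^bsub>A\<^esub>"
  and mult_zero: "h \<in> carrier A \<Longrightarrow> h \<otimes>\<^bsub>A\<^esub> \<zero>\<^bsub>A\<^esub> = \<zero>\<^bsub>A\<^esub>"
  using mult_smult_left[of "\<zero>\<^bsub>A\<^esub>" "\<zero>\<^bsub>A\<^esub>" h "\<zero>\<^bsub>K\<^esub>"] mult_smult_right[of "\<zero>\<^bsub>A\<^esub>" "\<zero>\<^bsub>A\<^esub>" h "\<zero>\<^bsub>K\<^esub>"]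
  by (simp_all add: mult_closed)

text \<open>The middle factor and then the last one are reduced to basis elements, where the claim
  is associativity of the monoid. \<open>ring_A\<close> reduces the remaining first factor.\<close>

lemma basis_mult_assoc:
  assumes a: "a \<in> carrier M" and g: "g \<in> carrier A" and h: "h \<in> carrier A"
  shows "(e a \<otimes>\<^bsub>A\<^esub> g) \<otimes>\<^bsub>A\<^esub> h = e a \<otimes>\<^bsub>A\<^esub> (g \<otimes>\<^bsub>A\<^esub> h)"
  using g
proof (induction g rule: induct_basis)
  case zero
  then show ?case using a h by (simp add: zero_mult mult_zero basis_closed)
next
  case (add c b g)
  have "(e a \<otimes>\<^bsub>A\<^esub> e b) \<otimes>\<^bsub>A\<^esub> h = e a \<otimes>\<^bsub>A\<^esub> (e b \<otimes>\<^bsub>A\<^esub> h)"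
    using h
  proof (induction h rule: induct_basis)
    case zero
    then show ?case using a add by (simp add: mult_zero basis_closed mult_closed)
  next
    case (add d m h)
    then show ?case using a \<open>b \<in> carrier M\<close>
      by (simp add: mult_linear basis_closed mult_closed basis_mult M.m_assoc)
  qed
  then show ?case
    using a h add by (simp add: mult_linear basis_closed mult_closed)
qed

lemma ring_A: "ring A"
proof (intro ringI monoidI)
  fix f assume "f \<in> carrier A"
  then show "\<one>\<^bsub>A\<^esub> \<otimes>\<^bsub>A\<^esub> f = f" "f \<otimes>\<^bsub>A\<^esub> \<one>\<^bsub>A\<^esub> = f"
    by (induction f rule: induct_basis)
      (simp_all add: one_eq mult_zero zero_mult mult_linear basis_closed mult_closed basis_mult)
next
  fix f g h assume f: "f \<in> carrier A" and gh: "g \<in> carrier A" "h \<in> carrier A"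
  show "f \<otimes>\<^bsub>A\<^esub> g \<otimes>\<^bsub>A\<^esub> h = f \<otimes>\<^bsub>A\<^esub> (g \<otimes>\<^bsub>A\<^esub> h)"
    using f by (induction f rule: induct_basis)
      (use gh in \<open>simp_all add: mult_zero zero_mult mult_linear basis_closed mult_closed basis_mult_assoc\<close>)
qed (auto simp: mult_closed one_eq basis_closed mult_linear module.axioms(2)[OF module_A])

lemma assoc_algebra_A: "assoc_algebra K A"
  by (intro assoc_algebra.intro assoc_algebra_axioms.intro module_A ring_A)
    (auto intro: mult_smult_left mult_smult_right)

lemma mult_comm:
  assumes comm: "\<And>a b. \<lbrakk>a \<in> carrier M; b \<in> carrier M\<rbrakk> \<Longrightarrow> a \<otimes>\<^bsub>M\<^esub> b = b \<otimes>\<^bsub>M\<^esub> a"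
    and f: "f \<in> carrier A" and g: "g \<in> carrier A"
  shows "f \<otimes>\<^bsub>A\<^esub> g = g \<otimes>\<^bsub>A\<^esub> f"
  using f
proof (induction f rule: induct_basis)
  case zero
  then show ?case using g by (simp add: mult_zero zero_mult)
next
  case (add c a f)
  have "e a \<otimes>\<^bsub>A\<^esub> g = g \<otimes>\<^bsub>A\<^esub> e a"
    using g
    by (induction g rule: induct_basis)
      (use add in \<open>simp_all add: mult_zero zero_mult mult_linear basis_closed mult_closed basis_mult comm\<close>)
  then show ?case
    using add g by (simp add: mult_linear basis_closed mult_closed)
qed

lemma alg_hom_eqI:
  assumes "h \<in> alg_hom K A B" "h' \<in> alg_hom K A B" "assoc_algebra K B"
    and eq: "\<And>m. m \<in> carrier M \<Longrightarrow> h (e m) = h' (e m)" and f: "f \<in> carrier A"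
  shows "h f = h' f"
proof -
  interpret B: assoc_algebra K B by fact
  note homs = assms(1,2)
  show ?thesis
    using f
  proof (induction f rule: induct_basis)
    case zero
    then show ?case by (simp add: alg_hom_zero[OF homs(1) ring_A B.ring_A] alg_hom_zero[OF homs(2) ring_A B.ring_A])
  next
    case (add c m g)
    then show ?case
      by (simp add: homs[THEN alg_hom_add] homs[THEN alg_hom_smult] basis_closed eq)
  qed
qed

text \<open>The linear extension of a monoid homomorphism \<open>ev\<close>. Its multiplicativity is
  checked with a basis element on the left first (\<open>mult_basis\<close>), then in
  general.\<close>

lemma alg_hom_exists:
  assumes "assoc_algebra K B" and ev: "\<And>m. m \<in> carrier M \<Longrightarrow> ev m \<in> carrier B"
    and ev_one: "ev \<one>\<^bsub>M\<^esub> = \<one>\<^bsub>B\<^esub>"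
    and ev_mult: "\<And>a b. \<lbrakk>a \<in> carrier M; b \<in> carrier M\<rbrakk> \<Longrightarrow> ev (a \<otimes>\<^bsub>M\<^esub> b) = ev a \<otimes>\<^bsub>B\<^esub> ev b"
  obtains h where "h \<in> alg_hom K A B" "\<And>m. m \<in> carrier M \<Longrightarrow> h (e m) = ev m"
proof -
  interpret B: assoc_algebra K B by fact
  interpret R: ring A by (rule ring_A)
  define h where "h f = (\<Oplus>\<^bsub>B\<^esub>m \<in> {m. f m \<noteq> \<zero>\<^bsub>K\<^esub>}. f m \<odot>\<^bsub>B\<^esub> ev m)" for f
  have h_eq: "h f = (\<Oplus>\<^bsub>B\<^esub>m \<in> N. f m \<odot>\<^bsub>B\<^esub> ev m)"
    if "f \<in> carrier A" "finite N" "N \<subseteq> carrier M" "\<And>m. f m \<noteq> \<zero>\<^bsub>K\<^esub> \<Longrightarrow> m \<in> N" for f N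
    unfolding h_def using that coeff_closed
    by (intro B.M.add.finprod_mono_neutral_cong_left) (auto simp: ev subset_iff)
  have supp: "finite {m. f m \<noteq> \<zero>\<^bsub>K\<^esub>}" "{m. f m \<noteq> \<zero>\<^bsub>K\<^esub>} \<subseteq> carrier M" if "f \<in> carrier A" for f
    using that by (auto simp: mem_carrier_iff)
  have closed: "h f \<in> carrier B" if "f \<in> carrier A" for f
    unfolding h_def using supp[OF that] coeff_closed[OF that]
    by (intro B.M.finsum_closed) (auto intro!: B.smult_closed ev)
  have add: "h (f \<oplus>\<^bsub>A\<^esub> g) = h f \<oplus>\<^bsub>B\<^esub> h g" if f: "f \<in> carrier A" and g: "g \<in> carrier A" for f g
  proof -
    let ?N = "{m. f m \<noteq> \<zero>\<^bsub>K\<^esub>} \<union> {m. g m \<noteq> \<zero>\<^bsub>K\<^esub>}"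
    have N: "finite ?N" "?N \<subseteq> carrier M" using supp[OF f] supp[OF g] by auto
    have "h (f \<oplus>\<^bsub>A\<^esub> g) = (\<Oplus>\<^bsub>B\<^esub>m \<in> ?N. (f \<oplus>\<^bsub>A\<^esub> g) m \<odot>\<^bsub>B\<^esub> ev m)"
      using N f g by (intro h_eq) (auto simp: add_apply)
    also have "\<dots> = (\<Oplus>\<^bsub>B\<^esub>m \<in> ?N. f m \<odot>\<^bsub>B\<^esub> ev m \<oplus>\<^bsub>B\<^esub> g m \<odot>\<^bsub>B\<^esub> ev m)"
      using N coeff_closed[OF f] coeff_closed[OF g]
      by (intro B.M.finsum_cong') (auto simp: add_apply B.smult_l_distr ev subset_iff)
    also have "\<dots> = (\<Oplus>\<^bsub>B\<^esub>m \<in> ?N. f m \<odot>\<^bsub>B\<^esub> ev m) \<oplus>\<^bsub>B\<^esub> (\<Oplus>\<^bsub>B\<^esub>m \<in> ?N. g m \<odot>\<^bsub>B\<^esub> ev m)"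
      using N coeff_closed[OF f] coeff_closed[OF g]
      by (intro B.M.finsum_addf) (auto simp: ev subset_iff)
    also have "\<dots> = h f \<oplus>\<^bsub>B\<^esub> h g"
      using N f g by (intro arg_cong2[of _ _ _ _ "(\<oplus>\<^bsub>B\<^esub>)"] h_eq[symmetric]) auto
    finally show ?thesis .
  qed
  have smult: "h (c \<odot>\<^bsub>A\<^esub> f) = c \<odot>\<^bsub>B\<^esub> h f" if c: "c \<in> carrier K" and f: "f \<in> carrier A" for c f
  proof -
    let ?N = "{m. f m \<noteq> \<zero>\<^bsub>K\<^esub>}"
    have "h (c \<odot>\<^bsub>A\<^esub> f) = (\<Oplus>\<^bsub>B\<^esub>m \<in> ?N. (c \<odot>\<^bsub>A\<^esub> f) m \<odot>\<^bsub>B\<^esub> ev m)"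
      using supp[OF f] c f by (intro h_eq) (auto simp: smult_apply)
    also have "\<dots> = (\<Oplus>\<^bsub>B\<^esub>m \<in> ?N. c \<odot>\<^bsub>B\<^esub> (f m \<odot>\<^bsub>B\<^esub> ev m))"
      using supp[OF f] coeff_closed[OF f] c
      by (intro B.M.finsum_cong') (auto simp: smult_apply B.smult_assoc1 ev subset_iff)
    also have "\<dots> = c \<odot>\<^bsub>B\<^esub> h f"
      unfolding h_def using supp[OF f] coeff_closed[OF f] c
      by (intro B.finsum_smult_ldistr[symmetric]) (auto simp: ev subset_iff)
    finally show ?thesis .
  qed
  have basis: "h (e m) = ev m" if "m \<in> carrier M" for m
  proof -
    have "h (e m) = (\<Oplus>\<^bsub>B\<^esub>m' \<in> {m}. e m m' \<odot>\<^bsub>B\<^esub> ev m')"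
      using that by (intro h_eq basis_closed) (auto simp: basis_elem_def split: if_splits)
    also have "\<dots> = ev m"
      using ev[OF that] by (simp add: basis_elem_def)
    finally show ?thesis .
  qed
  have zero: "h \<zero>\<^bsub>A\<^esub> = \<zero>\<^bsub>B\<^esub>"
    by (simp add: h_def zero_apply)
  have mult_basis: "h (e a \<otimes>\<^bsub>A\<^esub> g) = ev a \<otimes>\<^bsub>B\<^esub> h g" if a: "a \<in> carrier M" and g: "g \<in> carrier A" for a g
    using g
    by (induction g rule: induct_basis)
      (use a in \<open>simp_all add: mult_zero zero mult_linear basis_closed mult_closed basis_mult ev_mult
         add smult basis closed ev B.r_distr B.smult_mult_right\<close>)
  have mult: "h (f \<otimes>\<^bsub>A\<^esub> g) = h f \<otimes>\<^bsub>B\<^esub> h g" if f: "f \<in> carrier A" and g: "g \<in> carrier A" for f g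
    using f
    by (induction f rule: induct_basis)
      (use g in \<open>simp_all add: zero_mult zero mult_linear basis_closed mult_closed mult_basis
         add smult basis closed ev B.l_distr B.smult_mult_left\<close>)
  have "h \<in> alg_hom K A B"
    by (rule alg_homI) (auto simp: closed add smult mult one_eq basis ev_one)
  then show thesis
    using basis that by blast
qed

end

section \<open>Universal properties of the presented algebras\<close>

lemma monoid_lists: "monoid \<lparr>carrier = lists G, monoid.mult = (@), one = []\<rparr>"
  by (rule monoidI) auto

lemma monoid_alg_lists: "cring K \<Longrightarrow> monoid_alg K \<lparr>carrier = lists G, monoid.mult = (@), one = []\<rparr>"
  by (intro monoid_alg.intro monoid_lists)

lemma assoc_algebra_free_alg: "cring K \<Longrightarrow> assoc_algebra K (free_alg K G)"
  unfolding free_alg_def by (intro monoid_alg.assoc_algebra_A monoid_alg_lists)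

lemma basis_elem_free_alg_closed: "cring K \<Longrightarrow> w \<in> lists G \<Longrightarrow> basis_elem K w \<in> carrier (free_alg K G)"
  unfolding free_alg_def by (intro monoid_alg.basis_closed monoid_alg_lists) auto

lemma free_alg_lift:
  assumes "cring K" "assoc_algebra K B" and \<phi>: "\<And>z. z \<in> G \<Longrightarrow> \<phi> z \<in> carrier B"
  shows "\<exists>h\<in>alg_hom K (free_alg K G) B. \<forall>z\<in>G. h (basis_elem K [z]) = \<phi> z"
proof -
  interpret B: assoc_algebra K B by fact
  define ev where "ev w = foldr (\<lambda>z b. \<phi> z \<otimes>\<^bsub>B\<^esub> b) w \<one>\<^bsub>B\<^esub>" for w
  have ev: "ev w \<in> carrier B" if "w \<in> lists G" for w
    using that by (induction w) (auto simp: ev_def \<phi>)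
  have ev_append: "ev (v @ w) = ev v \<otimes>\<^bsub>B\<^esub> ev w" if "v \<in> lists G" "w \<in> lists G" for v w
    using that(1)
  proof (induction v)
    case (Cons z v)
    then show ?case
      using ev[of v] ev[of w] that(2) by (simp add: ev_def \<phi> B.m_assoc)
  qed (use ev[of w] that(2) in \<open>simp add: ev_def\<close>)
  obtain h where "h \<in> alg_hom K (free_alg K G) B" "\<And>w. w \<in> lists G \<Longrightarrow> h (basis_elem K w) = ev w"
    using monoid_alg.alg_hom_exists[OF monoid_alg_lists[OF assms(1), of G] assms(2), of ev] ev ev_append
    unfolding free_alg_def by (auto simp: ev_def)
  then show ?thesis
    using \<phi> by (auto simp: ev_def intro!: bexI[of _ h])
qed

lemma free_alg_hom_eqI:
  assumes "cring K" "assoc_algebra K B" and h: "h \<in> alg_hom K (free_alg K G) B"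
    and h': "h' \<in> alg_hom K (free_alg K G) B"
    and eq: "\<And>z. z \<in> G \<Longrightarrow> h (basis_elem K [z]) = h' (basis_elem K [z])"
    and f: "f \<in> carrier (free_alg K G)"
  shows "h f = h' f"
proof -
  let ?M = "\<lparr>carrier = lists G, monoid.mult = (@), one = []\<rparr>"
  interpret MA: monoid_alg K ?M
    using assms(1) by (rule monoid_alg_lists)
  have A: "free_alg K G = MA.A"
    by (simp add: free_alg_def)
  have "h (basis_elem K w) = h' (basis_elem K w)" if "w \<in> lists G" for w
    using that
  proof (induction w)
    case Nil
    then show ?case
      using alg_hom_one[OF h] alg_hom_one[OF h'] by (simp add: A MA.one_eq)
  next
    case (Cons z w)
    have "basis_elem K (z # w) = basis_elem K [z] \<otimes>\<^bsub>free_alg K G\<^esub> basis_elem K w"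
      using MA.basis_mult[of "[z]" w] Cons.hyps by (simp add: A)
    then show ?case
      using Cons by (simp add: alg_hom_mult[OF h] alg_hom_mult[OF h'] basis_elem_free_alg_closed assms(1) eq)
  qed
  then show ?thesis
    using MA.alg_hom_eqI[OF h[unfolded A] h'[unfolded A] assms(2) _ f[unfolded A]] by simp
qed

text \<open>Turns a relator \<open>u - v\<close> into an equation in the quotient; the relations of
  \<open>Fr\<close> and \<open>Fab\<close> are read off in this form.\<close>

lemma genideal_coset_eqI:
  fixes K :: "'k ring" and A :: "('k, 'a) module"
  assumes "assoc_algebra K A" "G \<subseteq> carrier A" "u \<in> carrier A" "v \<in> carrier A" "u \<ominus>\<^bsub>A\<^esub> v \<in> G"
  shows "Idl\<^bsub>A\<^esub> G +>\<^bsub>A\<^esub> u = Idl\<^bsub>A\<^esub> G +>\<^bsub>A\<^esub> v"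
proof -
  interpret assoc_algebra K A by fact
  interpret quot_algebra K A "Idl\<^bsub>A\<^esub> G"
    using assms by (intro quot_algebra_genideal)
  show ?thesis
    using assms genideal_self[OF assms(2)] by (intro coset_eqI) auto
qed

text \<open>Finite support in \<open>A\<close> matters: \<open>finsum\<close> over an infinite set
  is zero, while the image family could have finite support and a nonzero sum.\<close>

lemma alg_hom_fsum:
  assumes "h \<in> alg_hom K A B" "ring A" "ring B" "\<And>k. k \<in> J \<Longrightarrow> t k \<in> carrier A"
    and "finite {k \<in> J. t k \<noteq> \<zero>\<^bsub>A\<^esub>}"
  shows "h (fsum A J t) = fsum B J (\<lambda>k. h (t k))"
proof -
  interpret A: ring A by fact
  interpret B: ring B by fact
  let ?N = "{k \<in> J. t k \<noteq> \<zero>\<^bsub>A\<^esub>}"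
  have "fsum B J (\<lambda>k. h (t k)) = finsum B (\<lambda>k. h (t k)) ?N"
    using assms by (intro fsum_eq_finsum B.abelian_monoid_axioms)
      (auto simp: alg_hom_closed[OF assms(1)] alg_hom_zero[OF assms(1-3)])
  then show ?thesis
    using assms by (simp add: fsum_def alg_hom_finsum[OF assms(1-3)])
qed

lemma fsum_closed:
  assumes "abelian_monoid A" "\<And>k. k \<in> J \<Longrightarrow> t k \<in> carrier A"
  shows "fsum A J t \<in> carrier A"
  unfolding fsum_def using assms by (intro abelian_monoid.finsum_closed) auto

lemma fsum_cong:
  assumes "abelian_monoid A" "\<And>k. k \<in> J \<Longrightarrow> s k = t k" "\<And>k. k \<in> J \<Longrightarrow> t k \<in> carrier A"
  shows "fsum A J s = fsum A J t"
proof -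
  have "{k \<in> J. s k \<noteq> \<zero>\<^bsub>A\<^esub>} = {k \<in> J. t k \<noteq> \<zero>\<^bsub>A\<^esub>}"
    using assms(2) by auto
  then show ?thesis
    unfolding fsum_def using assms by (intro abelian_monoid.finsum_cong') auto
qed

section \<open>The algebra generated by \<open>P\<close> and free letters\<close>

locale word_presentation = algebra K P for K :: "'k ring" (structure) and P :: "('k, 'p) module" (structure) +
  fixes \<Lambda> :: "'x set"
begin

abbreviation "W \<equiv> word_alg K \<Lambda> P"
abbreviation "Fr \<equiv> free_ext K \<Lambda> P"
abbreviation "inc \<equiv> free_ext_incl K \<Lambda> P"
abbreviation "del \<equiv> free_ext_delta K \<Lambda> P"

lemma assoc_algebra_W: "assoc_algebra K W"
  unfolding word_alg_def by (intro assoc_algebra_free_alg R_cring)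

interpretation W: assoc_algebra K W
  by (rule assoc_algebra_W)

lemma letter_closed:
  "a \<in> carrier P \<Longrightarrow> letter K (Inl a) \<in> carrier W" "i \<in> \<Lambda> \<Longrightarrow> letter K (Inr i) \<in> carrier W"
  unfolding word_alg_def letter_def by (intro basis_elem_free_alg_closed R_cring; auto)+

lemma alg_relations_closed: "alg_relations K \<Lambda> P \<subseteq> carrier W"
  unfolding alg_relations_def by (auto simp: letter_closed)

interpretation Q: quot_algebra K W "Idl\<^bsub>W\<^esub> (alg_relations K \<Lambda> P)"
  by (intro quot_algebra_genideal assoc_algebra_W alg_relations_closed)

lemma word_alg_hom_eqI:
  assumes B: "assoc_algebra K B" and h: "h \<in> alg_hom K W B" and h': "h' \<in> alg_hom K W B"
    and eq: "\<And>a. a \<in> carrier P \<Longrightarrow> h (letter K (Inl a)) = h' (letter K (Inl a))"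
      "\<And>i. i \<in> \<Lambda> \<Longrightarrow> h (letter K (Inr i)) = h' (letter K (Inr i))"
    and w: "w \<in> carrier W"
  shows "h w = h' w"
proof (rule free_alg_hom_eqI[OF R_cring B h[unfolded word_alg_def] h'[unfolded word_alg_def] _ w[unfolded word_alg_def]])
  fix z assume "z \<in> Sum_Type.Plus (carrier P) \<Lambda>"
  then show "h (basis_elem K [z]) = h' (basis_elem K [z])"
    using eq by (auto simp: letter_def)
qed

lemma assoc_algebra_free_ext: "assoc_algebra K Fr"
  unfolding free_ext_def by (rule Q.assoc_algebra_quot)

text \<open>In the free algebra the letters of elements of \<open>P\<close> are independent. Each of
  the four families in \<open>alg_relations\<close> forces one homomorphism law.\<close>

lemma free_ext_incl_hom: "inc \<in> alg_hom K P Fr"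
proof -
  note eqI = genideal_coset_eqI[OF assoc_algebra_W alg_relations_closed]
  note hom = alg_hom_add[OF Q.coset_hom] alg_hom_mult[OF Q.coset_hom] alg_hom_one[OF Q.coset_hom]
    alg_hom_smult[OF Q.coset_hom]
  show ?thesis
    unfolding free_ext_incl_def free_ext_def
  proof (rule alg_homI, goal_cases)
    case (1 a)
    then show ?case by (intro alg_hom_closed[OF Q.coset_hom] letter_closed)
  next
    case (2 a b)
    then show ?case
      unfolding hom(2)[OF letter_closed(1)[OF 2(1)] letter_closed(1)[OF 2(2)], symmetric]
      by (intro eqI letter_closed W.m_closed m_closed) (auto simp: alg_relations_def)
  next
    case (3 a b)
    then show ?case
      unfolding hom(1)[OF letter_closed(1)[OF 3(1)] letter_closed(1)[OF 3(2)], symmetric]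
      by (intro eqI letter_closed W.M.a_closed M.a_closed) (auto simp: alg_relations_def)
  next
    case 4
    show ?case
      unfolding hom(3)[symmetric] by (intro eqI letter_closed) (auto simp: alg_relations_def)
  next
    case (5 c a)
    then show ?case
      unfolding hom(4)[OF 5(1) letter_closed(1)[OF 5(2)], symmetric]
      by (intro eqI letter_closed W.smult_closed smult_closed) (auto simp: alg_relations_def)
  qed
qed

lemma free_ext_delta_closed: "i \<in> \<Lambda> \<Longrightarrow> del i \<in> carrier Fr"
  unfolding free_ext_delta_def free_ext_def by (intro alg_hom_closed[OF Q.coset_hom] letter_closed)

text \<open>With \<open>free_ext_hom_eqI\<close>, this identifies \<open>Fr\<close> as the coproduct
  of \<open>P\<close> and the free algebra on \<open>\<Lambda>\<close> among unital associative
  algebras.\<close>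

lemma free_ext_lift:
  assumes B: "assoc_algebra K B" and \<alpha>: "\<alpha> \<in> alg_hom K P B" and d: "\<And>i. i \<in> \<Lambda> \<Longrightarrow> d i \<in> carrier B"
  obtains h where "h \<in> alg_hom K Fr B" "\<And>a. a \<in> carrier P \<Longrightarrow> h (inc a) = \<alpha> a"
    "\<And>i. i \<in> \<Lambda> \<Longrightarrow> h (del i) = d i"
proof -
  interpret B: assoc_algebra K B by fact
  have C: "case_sum \<alpha> d z \<in> carrier B" if "z \<in> Sum_Type.Plus (carrier P) \<Lambda>" for z
    using that by (auto simp: d alg_hom_closed[OF \<alpha>])
  obtain h where h: "h \<in> alg_hom K W B"
    and letters: "\<And>z. z \<in> Sum_Type.Plus (carrier P) \<Lambda> \<Longrightarrow> h (letter K z) = case_sum \<alpha> d z"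
    using free_alg_lift[OF R_cring B, of "Sum_Type.Plus (carrier P) \<Lambda>" "case_sum \<alpha> d", OF C]
    unfolding word_alg_def letter_def by auto
  have h_Inl: "h (letter K (Inl a)) = \<alpha> a" if "a \<in> carrier P" for a
    using letters[OF InlI[OF that]] by simp
  note homs = alg_hom_minus[OF h assoc_algebra.ring_A[OF assoc_algebra_W] B.ring_A]
    alg_hom_add[OF h] alg_hom_mult[OF h] alg_hom_one[OF h] alg_hom_smult[OF h]
    alg_hom_add[OF \<alpha>] alg_hom_mult[OF \<alpha>] alg_hom_one[OF \<alpha>] alg_hom_smult[OF \<alpha>]
  have "h g = \<zero>\<^bsub>B\<^esub>" if "g \<in> alg_relations K \<Lambda> P" for g
    using that unfolding alg_relations_def
    by (auto simp: homs h_Inl letter_closed alg_hom_closed[OF \<alpha>])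
  then obtain h' where h': "h' \<in> alg_hom K Fr B"
    and "\<And>a. a \<in> carrier W \<Longrightarrow> h' (Idl\<^bsub>W\<^esub> (alg_relations K \<Lambda> P) +>\<^bsub>W\<^esub> a) = h a"
    using alg_hom_quot_lift[OF assoc_algebra_W B alg_relations_closed h] unfolding free_ext_def by blast
  then have "h' (inc a) = \<alpha> a" if "a \<in> carrier P" for a
    using that by (simp add: free_ext_incl_def letter_closed h_Inl)
  moreover have "h' (del i) = d i" if "i \<in> \<Lambda>" for i
    using that letters[OF InrI[OF that]] \<open>\<And>a. a \<in> carrier W \<Longrightarrow> h' _ = h a\<close>
    by (simp add: free_ext_delta_def letter_closed)
  ultimately show thesis
    using h' that by blast
qed

text \<open>A map out of a quotient is determined by its composite with the projection, so
  uniqueness descends from the free algebra. \<open>F_ab_hom_eqI\<close> and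
  \<open>env_hom_eqI\<close> continue the descent in the same way.\<close>

lemma free_ext_hom_eqI:
  assumes B: "assoc_algebra K B" and h: "h \<in> alg_hom K Fr B" and h': "h' \<in> alg_hom K Fr B"
    and inc: "\<And>a. a \<in> carrier P \<Longrightarrow> h (inc a) = h' (inc a)" and del: "\<And>i. i \<in> \<Lambda> \<Longrightarrow> h (del i) = h' (del i)"
    and u: "u \<in> carrier Fr"
  shows "h u = h' u"
proof (rule Q.alg_hom_quot_unique[OF _ u[unfolded free_ext_def]])
  fix w assume "w \<in> carrier W"
  then show "h (Idl\<^bsub>W\<^esub> (alg_relations K \<Lambda> P) +>\<^bsub>W\<^esub> w) = h' (Idl\<^bsub>W\<^esub> (alg_relations K \<Lambda> P) +>\<^bsub>W\<^esub> w)"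
    by (rule word_alg_hom_eqI[OF B alg_hom_compose[OF Q.coset_hom h[unfolded free_ext_def]]
          alg_hom_compose[OF Q.coset_hom h'[unfolded free_ext_def]], rotated -1])
      (simp_all add: inc[unfolded free_ext_incl_def] del[unfolded free_ext_delta_def])
qed

end

text \<open>Of \<open>D\<close> only values in \<open>P\<close> and finite supports are required,
  because derivatives of chosen representatives satisfy no sum or product rule.\<close>

locale poisson_vars = poisson_algebra K P br
  for K :: "'k ring" (structure) and P :: "('k, 'p) module" (structure) and br +
  fixes \<Lambda> :: "'x set" and x :: "'x \<Rightarrow> 'p" and D :: "'p \<Rightarrow> 'x \<Rightarrow> 'p"
  assumes x_closed: "i \<in> \<Lambda> \<Longrightarrow> x i \<in> carrier P"
    and D_closed: "\<lbrakk>g \<in> carrier P; k \<in> \<Lambda>\<rbrakk> \<Longrightarrow> D g k \<in> carrier P"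
    and D_finite: "g \<in> carrier P \<Longrightarrow> finite {k \<in> \<Lambda>. D g k \<noteq> \<zero>\<^bsub>P\<^esub>}"
begin

sublocale word_presentation K P \<Lambda> ..

lemma fsum_mult_hom:
  assumes A: "assoc_algebra K A" and B: "assoc_algebra K B" and h: "h \<in> alg_hom K A B"
    and \<alpha>: "\<alpha> \<in> alg_hom K P A" and d: "\<And>i. i \<in> \<Lambda> \<Longrightarrow> d i \<in> carrier A"
    and v: "\<And>k. k \<in> \<Lambda> \<Longrightarrow> v k \<in> carrier P" "finite {k \<in> \<Lambda>. v k \<noteq> \<zero>\<^bsub>P\<^esub>}"
  shows "h (fsum A \<Lambda> (\<lambda>k. \<alpha> (v k) \<otimes>\<^bsub>A\<^esub> d k)) = fsum B \<Lambda> (\<lambda>k. h (\<alpha> (v k)) \<otimes>\<^bsub>B\<^esub> h (d k))"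
proof -
  interpret A: assoc_algebra K A by fact
  interpret B: assoc_algebra K B by fact
  have "finite {k \<in> \<Lambda>. \<alpha> (v k) \<otimes>\<^bsub>A\<^esub> d k \<noteq> \<zero>\<^bsub>A\<^esub>}"
    by (rule finite_subset[OF _ v(2)]) (auto simp: d alg_hom_zero[OF \<alpha> ring_M A.ring_A])
  then have "h (fsum A \<Lambda> (\<lambda>k. \<alpha> (v k) \<otimes>\<^bsub>A\<^esub> d k)) = fsum B \<Lambda> (\<lambda>k. h (\<alpha> (v k) \<otimes>\<^bsub>A\<^esub> d k))"
    by (intro alg_hom_fsum[OF h A.ring_A B.ring_A]) (auto simp: d v alg_hom_closed[OF \<alpha>])
  also have "\<dots> = fsum B \<Lambda> (\<lambda>k. h (\<alpha> (v k)) \<otimes>\<^bsub>B\<^esub> h (d k))"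
    by (intro fsum_cong B.M.abelian_monoid_axioms)
      (auto simp: alg_hom_mult[OF h] d v alg_hom_closed[OF \<alpha>] alg_hom_closed[OF h])
  finally show ?thesis .
qed

text \<open>The relations of \<open>F_ab\<close> as a property of an arbitrary target, so that they
  can be asserted for the opposite algebra with negated generators.\<close>

definition ab_relations :: "('k, 'b) module \<Rightarrow> ('p \<Rightarrow> 'b) \<Rightarrow> ('x \<Rightarrow> 'b) \<Rightarrow> bool" where
  "ab_relations B \<alpha> d \<longleftrightarrow> (\<forall>i\<in>\<Lambda>. \<forall>j\<in>\<Lambda>.
     commutator B (d i) (d j) = fsum B \<Lambda> (\<lambda>k. \<alpha> (D (br (x i) (x j)) k) \<otimes>\<^bsub>B\<^esub> d k) \<and>
     commutator B (d i) (\<alpha> (x j)) = \<alpha> (br (x i) (x j)))"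

lemma ab_relations_hom:
  assumes A: "assoc_algebra K A" and B: "assoc_algebra K B" and h: "h \<in> alg_hom K A B"
    and \<alpha>: "\<alpha> \<in> alg_hom K P A" and d: "\<And>i. i \<in> \<Lambda> \<Longrightarrow> d i \<in> carrier A"
    and rel: "ab_relations A \<alpha> d"
  shows "ab_relations B (\<lambda>a. h (\<alpha> a)) (\<lambda>i. h (d i))"
  unfolding ab_relations_def
proof (intro ballI conjI)
  fix i j assume ij: "i \<in> \<Lambda>" "j \<in> \<Lambda>"
  have g: "br (x i) (x j) \<in> carrier P"
    using ij by (intro br_closed x_closed)
  note comm = alg_hom_commutator[OF h A[THEN assoc_algebra.ring_A] B[THEN assoc_algebra.ring_A], symmetric]
  show "commutator B (h (d i)) (h (d j)) =
      fsum B \<Lambda> (\<lambda>k. h (\<alpha> (D (br (x i) (x j)) k)) \<otimes>\<^bsub>B\<^esub> h (d k))"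
    using rel ij fsum_mult_hom[OF A B h \<alpha> d D_closed[OF g] D_finite[OF g]]
    by (simp add: comm d ab_relations_def)
  show "commutator B (h (d i)) (h (\<alpha> (x j))) = h (\<alpha> (br (x i) (x j)))"
    using rel ij by (simp add: comm d x_closed alg_hom_closed[OF \<alpha>] ab_relations_def)
qed

abbreviation "Fab \<equiv> F_ab K \<Lambda> P br x D"
abbreviation "fi \<equiv> F_ab_incl K \<Lambda> P br x D"
abbreviation "fd \<equiv> F_ab_delta K \<Lambda> P br x D"

definition ab_gens :: "('k, 'p, 'x) word_poly set set" where
  "ab_gens = {commutator Fr (del i) (del j) \<ominus>\<^bsub>Fr\<^esub>
         fsum Fr \<Lambda> (\<lambda>k. inc (D (br (x i) (x j)) k) \<otimes>\<^bsub>Fr\<^esub> del k) |i j. i \<in> \<Lambda> \<and> j \<in> \<Lambda>} \<union>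
      {commutator Fr (del i) (inc (x j)) \<ominus>\<^bsub>Fr\<^esub> inc (br (x i) (x j)) |i j. i \<in> \<Lambda> \<and> j \<in> \<Lambda>}"

lemma F_ab_ideal_eq: "F_ab_ideal K \<Lambda> P br x D = Idl\<^bsub>Fr\<^esub> ab_gens"
  by (simp add: F_ab_ideal_def ab_gens_def)

interpretation Fr: assoc_algebra K Fr
  by (rule assoc_algebra_free_ext)

lemma commutator_Fr_closed: "\<lbrakk>u \<in> carrier Fr; v \<in> carrier Fr\<rbrakk> \<Longrightarrow> commutator Fr u v \<in> carrier Fr"
  by (simp add: commutator_def)

lemma inc_closed: "a \<in> carrier P \<Longrightarrow> inc a \<in> carrier Fr"
  by (rule alg_hom_closed[OF free_ext_incl_hom])

lemma fsum_Fr_closed: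
  "g \<in> carrier P \<Longrightarrow> fsum Fr \<Lambda> (\<lambda>k. inc (D g k) \<otimes>\<^bsub>Fr\<^esub> del k) \<in> carrier Fr"
  by (intro fsum_closed Fr.M.abelian_monoid_axioms Fr.m_closed inc_closed D_closed free_ext_delta_closed)

lemma ab_gens_closed: "ab_gens \<subseteq> carrier Fr"
  unfolding ab_gens_def
  by (auto simp: commutator_Fr_closed inc_closed free_ext_delta_closed x_closed br_closed fsum_Fr_closed)

interpretation QF: quot_algebra K Fr "F_ab_ideal K \<Lambda> P br x D"
  unfolding F_ab_ideal_eq by (intro quot_algebra_genideal assoc_algebra_free_ext ab_gens_closed)

lemma assoc_algebra_F_ab: "assoc_algebra K Fab"
  unfolding F_ab_def by (rule QF.assoc_algebra_quot)

lemma F_ab_proj_hom: "(\<lambda>u. F_ab_ideal K \<Lambda> P br x D +>\<^bsub>Fr\<^esub> u) \<in> alg_hom K Fr Fab"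
  unfolding F_ab_def by (rule QF.coset_hom)

lemma F_ab_incl_hom: "fi \<in> alg_hom K P Fab"
  using alg_hom_compose[OF free_ext_incl_hom F_ab_proj_hom] by (simp add: F_ab_incl_def[abs_def])

lemma F_ab_delta_closed: "i \<in> \<Lambda> \<Longrightarrow> fd i \<in> carrier Fab"
  unfolding F_ab_delta_def by (intro alg_hom_closed[OF F_ab_proj_hom] free_ext_delta_closed)

lemma F_ab_relations: "ab_relations Fab fi fd"
  unfolding ab_relations_def
proof (intro ballI conjI)
  fix i j assume ij: "i \<in> \<Lambda>" "j \<in> \<Lambda>"
  have g: "br (x i) (x j) \<in> carrier P"
    using ij by (intro br_closed x_closed)
  note comm = alg_hom_commutator[OF F_ab_proj_hom Fr.ring_A assoc_algebra.ring_A[OF assoc_algebra_F_ab], symmetric]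
  note eqI = genideal_coset_eqI[OF assoc_algebra_free_ext ab_gens_closed, folded F_ab_ideal_eq]
  let ?\<pi> = "\<lambda>u. F_ab_ideal K \<Lambda> P br x D +>\<^bsub>Fr\<^esub> u"
  have fsum: "?\<pi> (fsum Fr \<Lambda> (\<lambda>k. inc (D (br (x i) (x j)) k) \<otimes>\<^bsub>Fr\<^esub> del k)) =
      fsum Fab \<Lambda> (\<lambda>k. ?\<pi> (inc (D (br (x i) (x j)) k)) \<otimes>\<^bsub>Fab\<^esub> ?\<pi> (del k))"
    by (rule fsum_mult_hom[OF assoc_algebra_free_ext assoc_algebra_F_ab F_ab_proj_hom free_ext_incl_hom])
      (auto simp: free_ext_delta_closed D_closed g D_finite)
  show "commutator Fab (fd i) (fd j) = fsum Fab \<Lambda> (\<lambda>k. fi (D (br (x i) (x j)) k) \<otimes>\<^bsub>Fab\<^esub> fd k)"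
    unfolding F_ab_incl_def F_ab_delta_def fsum[symmetric]
    comm[OF free_ext_delta_closed[OF ij(1)] free_ext_delta_closed[OF ij(2)]]
    using ij g by (intro eqI commutator_Fr_closed free_ext_delta_closed fsum_Fr_closed) (auto simp: ab_gens_def)
  show "commutator Fab (fd i) (fi (x j)) = fi (br (x i) (x j))"
    unfolding F_ab_incl_def F_ab_delta_def comm[OF free_ext_delta_closed[OF ij(1)] inc_closed[OF x_closed[OF ij(2)]]]
    using ij g by (intro eqI commutator_Fr_closed free_ext_delta_closed inc_closed x_closed) (auto simp: ab_gens_def)
qed

text \<open>With \<open>F_ab_relations\<close> and \<open>F_ab_hom_eqI\<close>, this makes
  \<open>Fab\<close> universal for \<open>ab_relations\<close>. The flip arises by taking
  \<open>opp_alg Fab\<close> as the target.\<close>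

lemma F_ab_lift:
  assumes B: "assoc_algebra K B" and \<alpha>: "\<alpha> \<in> alg_hom K P B" and d: "\<And>i. i \<in> \<Lambda> \<Longrightarrow> d i \<in> carrier B"
    and rel: "ab_relations B \<alpha> d"
  obtains h where "h \<in> alg_hom K Fab B" "\<And>a. a \<in> carrier P \<Longrightarrow> h (fi a) = \<alpha> a"
    "\<And>i. i \<in> \<Lambda> \<Longrightarrow> h (fd i) = d i"
proof -
  interpret B: assoc_algebra K B by fact
  obtain h where h: "h \<in> alg_hom K Fr B" and h_inc: "\<And>a. a \<in> carrier P \<Longrightarrow> h (inc a) = \<alpha> a"
    and h_del: "\<And>i. i \<in> \<Lambda> \<Longrightarrow> h (del i) = d i"
    using free_ext_lift[OF B \<alpha>, of d] d by blast
  have fsum: "h (fsum Fr \<Lambda> (\<lambda>k. inc (D g k) \<otimes>\<^bsub>Fr\<^esub> del k)) = fsum B \<Lambda> (\<lambda>k. \<alpha> (D g k) \<otimes>\<^bsub>B\<^esub> d k)"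
    if g: "g \<in> carrier P" for g
  proof -
    have "h (fsum Fr \<Lambda> (\<lambda>k. inc (D g k) \<otimes>\<^bsub>Fr\<^esub> del k)) = fsum B \<Lambda> (\<lambda>k. h (inc (D g k)) \<otimes>\<^bsub>B\<^esub> h (del k))"
      by (rule fsum_mult_hom[OF assoc_algebra_free_ext B h free_ext_incl_hom])
        (auto simp: free_ext_delta_closed D_closed g D_finite)
    also have "\<dots> = fsum B \<Lambda> (\<lambda>k. \<alpha> (D g k) \<otimes>\<^bsub>B\<^esub> d k)"
      by (rule fsum_cong) (auto simp: h_inc h_del D_closed g d alg_hom_closed[OF \<alpha>] B.M.abelian_monoid_axioms)
    finally show ?thesis .
  qed
  have "h u = \<zero>\<^bsub>B\<^esub>" if "u \<in> ab_gens" for u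
    using that rel unfolding ab_gens_def ab_relations_def
    by (auto simp: alg_hom_minus[OF h Fr.ring_A B.ring_A] alg_hom_commutator[OF h Fr.ring_A B.ring_A]
        commutator_Fr_closed inc_closed free_ext_delta_closed x_closed br_closed fsum_Fr_closed
        fsum h_inc h_del alg_hom_closed[OF \<alpha>]
        intro!: B.r_right_minus_eq[THEN iffD2] fsum_closed B.M.abelian_monoid_axioms d B.m_closed
          alg_hom_closed[OF \<alpha>] D_closed br_closed x_closed)
  then obtain h' where h': "h' \<in> alg_hom K Fab B"
    and eq: "\<And>u. u \<in> carrier Fr \<Longrightarrow> h' (F_ab_ideal K \<Lambda> P br x D +>\<^bsub>Fr\<^esub> u) = h u"
    using alg_hom_quot_lift[OF assoc_algebra_free_ext B ab_gens_closed h]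
    unfolding F_ab_def F_ab_ideal_eq by blast
  show thesis
    by (rule that[OF h'])
      (simp_all add: F_ab_incl_def F_ab_delta_def eq inc_closed free_ext_delta_closed h_inc h_del)
qed

lemma F_ab_hom_eqI:
  assumes B: "assoc_algebra K B" and h: "h \<in> alg_hom K Fab B" and h': "h' \<in> alg_hom K Fab B"
    and fi: "\<And>a. a \<in> carrier P \<Longrightarrow> h (fi a) = h' (fi a)" and fd: "\<And>i. i \<in> \<Lambda> \<Longrightarrow> h (fd i) = h' (fd i)"
    and u: "u \<in> carrier Fab"
  shows "h u = h' u"
proof (rule QF.alg_hom_quot_unique[OF _ u[unfolded F_ab_def]])
  fix w assume "w \<in> carrier Fr"
  then show "h (F_ab_ideal K \<Lambda> P br x D +>\<^bsub>Fr\<^esub> w) = h' (F_ab_ideal K \<Lambda> P br x D +>\<^bsub>Fr\<^esub> w)"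
    by (rule free_ext_hom_eqI[OF B alg_hom_compose[OF F_ab_proj_hom h]
          alg_hom_compose[OF F_ab_proj_hom h'], rotated -1])
      (simp_all add: fi[unfolded F_ab_incl_def] fd[unfolded F_ab_delta_def])
qed

end

text \<open>The vectors \<open>E s\<close> are data separate from \<open>D\<close>: the class of
  \<open>f s\<close> in the coordinate algebra is zero, so the derivatives of the relators cannot be
  recovered from elements of \<open>P\<close>.\<close>

locale poisson_vars_rel = poisson_vars K P br \<Lambda> x D
  for K :: "'k ring" (structure) and P :: "('k, 'p) module" (structure) and br
    and \<Lambda> :: "'x set" and x D +
  fixes \<Gamma> :: "'s set" and E :: "'s \<Rightarrow> 'x \<Rightarrow> 'p"
  assumes E_closed: "\<lbrakk>s \<in> \<Gamma>; k \<in> \<Lambda>\<rbrakk> \<Longrightarrow> E s k \<in> carrier P"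
    and E_finite: "s \<in> \<Gamma> \<Longrightarrow> finite {k \<in> \<Lambda>. E s k \<noteq> \<zero>\<^bsub>P\<^esub>}"
begin

abbreviation "U \<equiv> env_alg K \<Lambda> P br x D \<Gamma> E"
abbreviation "ui \<equiv> env_incl K \<Lambda> P br x D \<Gamma> E"
abbreviation "ud \<equiv> env_delta K \<Lambda> P br x D \<Gamma> E"
abbreviation "env_id \<equiv> env_ideal K \<Lambda> P br x D \<Gamma> E"

definition env_gens :: "('k, 'p, 'x) word_poly set set set" where
  "env_gens = {fsum Fab \<Lambda> (\<lambda>i. fi (E s i) \<otimes>\<^bsub>Fab\<^esub> fd i) |s. s \<in> \<Gamma>}"

lemma env_ideal_eq: "env_id = Idl\<^bsub>Fab\<^esub> env_gens"
  by (simp add: env_ideal_def env_gens_def)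

interpretation Fab: assoc_algebra K Fab
  by (rule assoc_algebra_F_ab)

lemma env_gens_closed: "env_gens \<subseteq> carrier Fab"
  unfolding env_gens_def
  by (auto intro!: fsum_closed Fab.M.abelian_monoid_axioms Fab.m_closed F_ab_delta_closed E_closed
      alg_hom_closed[OF F_ab_incl_hom])

interpretation QU: quot_algebra K Fab env_id
  unfolding env_ideal_eq by (intro quot_algebra_genideal assoc_algebra_F_ab env_gens_closed)

lemma assoc_algebra_env: "assoc_algebra K U"
  unfolding env_alg_def by (rule QU.assoc_algebra_quot)

lemma env_proj_hom: "(\<lambda>u. env_id +>\<^bsub>Fab\<^esub> u) \<in> alg_hom K Fab U"
  unfolding env_alg_def by (rule QU.coset_hom)

lemma env_incl_hom: "ui \<in> alg_hom K P U"
  using alg_hom_compose[OF F_ab_incl_hom env_proj_hom] by (simp add: env_incl_def[abs_def])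

lemma env_delta_closed: "i \<in> \<Lambda> \<Longrightarrow> ud i \<in> carrier U"
  unfolding env_delta_def by (intro alg_hom_closed[OF env_proj_hom] F_ab_delta_closed)

lemma env_ab_relations: "ab_relations U ui ud"
  using ab_relations_hom[OF assoc_algebra_F_ab assoc_algebra_env env_proj_hom F_ab_incl_hom
      F_ab_delta_closed F_ab_relations]
  by (simp add: env_incl_def[abs_def] env_delta_def[abs_def])

lemma env_relation:
  assumes s: "s \<in> \<Gamma>"
  shows "fsum U \<Lambda> (\<lambda>i. ui (E s i) \<otimes>\<^bsub>U\<^esub> ud i) = \<zero>\<^bsub>U\<^esub>"
proof -
  have "fsum U \<Lambda> (\<lambda>i. ui (E s i) \<otimes>\<^bsub>U\<^esub> ud i) = env_id +>\<^bsub>Fab\<^esub> fsum Fab \<Lambda> (\<lambda>i. fi (E s i) \<otimes>\<^bsub>Fab\<^esub> fd i)"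
    unfolding env_incl_def env_delta_def
    by (rule fsum_mult_hom[OF assoc_algebra_F_ab assoc_algebra_env env_proj_hom F_ab_incl_hom
        F_ab_delta_closed E_closed[OF s] E_finite[OF s], symmetric])
  also have "\<dots> = \<zero>\<^bsub>U\<^esub>"
    unfolding env_alg_def using Fab.genideal_self[OF env_gens_closed] s
    by (intro QU.coset_zero) (auto simp: env_ideal_eq env_gens_def)
  finally show ?thesis .
qed

lemma env_lift:
  assumes B: "assoc_algebra K B" and \<alpha>: "\<alpha> \<in> alg_hom K P B" and d: "\<And>i. i \<in> \<Lambda> \<Longrightarrow> d i \<in> carrier B"
    and rel: "ab_relations B \<alpha> d"
    and rel_E: "\<And>s. s \<in> \<Gamma> \<Longrightarrow> fsum B \<Lambda> (\<lambda>i. \<alpha> (E s i) \<otimes>\<^bsub>B\<^esub> d i) = \<zero>\<^bsub>B\<^esub>"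
  obtains h where "h \<in> alg_hom K U B" "\<And>a. a \<in> carrier P \<Longrightarrow> h (ui a) = \<alpha> a"
    "\<And>i. i \<in> \<Lambda> \<Longrightarrow> h (ud i) = d i"
proof -
  interpret B: assoc_algebra K B by fact
  obtain h where h: "h \<in> alg_hom K Fab B" and h_fi: "\<And>a. a \<in> carrier P \<Longrightarrow> h (fi a) = \<alpha> a"
    and h_fd: "\<And>i. i \<in> \<Lambda> \<Longrightarrow> h (fd i) = d i"
    using F_ab_lift[OF B \<alpha> _ rel] d by blast
  have "h (fsum Fab \<Lambda> (\<lambda>k. fi (E s k) \<otimes>\<^bsub>Fab\<^esub> fd k)) = fsum B \<Lambda> (\<lambda>k. \<alpha> (E s k) \<otimes>\<^bsub>B\<^esub> d k)"
    if s: "s \<in> \<Gamma>" for s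
  proof -
    have "h (fsum Fab \<Lambda> (\<lambda>k. fi (E s k) \<otimes>\<^bsub>Fab\<^esub> fd k)) = fsum B \<Lambda> (\<lambda>k. h (fi (E s k)) \<otimes>\<^bsub>B\<^esub> h (fd k))"
      by (rule fsum_mult_hom[OF assoc_algebra_F_ab B h F_ab_incl_hom])
        (auto simp: F_ab_delta_closed E_closed s E_finite)
    also have "\<dots> = fsum B \<Lambda> (\<lambda>k. \<alpha> (E s k) \<otimes>\<^bsub>B\<^esub> d k)"
      by (rule fsum_cong) (auto simp: h_fi h_fd E_closed s d alg_hom_closed[OF \<alpha>] B.M.abelian_monoid_axioms)
    finally show ?thesis .
  qed
  then have "h u = \<zero>\<^bsub>B\<^esub>" if "u \<in> env_gens" for u
    using that rel_E by (auto simp: env_gens_def)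
  then obtain h' where h': "h' \<in> alg_hom K U B"
    and eq: "\<And>u. u \<in> carrier Fab \<Longrightarrow> h' (env_id +>\<^bsub>Fab\<^esub> u) = h u"
    using alg_hom_quot_lift[OF assoc_algebra_F_ab B env_gens_closed h]
    unfolding env_alg_def env_ideal_eq by blast
  show thesis
    by (rule that[OF h'])
      (simp_all add: env_incl_def env_delta_def eq alg_hom_closed[OF F_ab_incl_hom] F_ab_delta_closed h_fi h_fd)
qed

lemma env_hom_eqI:
  assumes B: "assoc_algebra K B" and h: "h \<in> alg_hom K U B" and h': "h' \<in> alg_hom K U B"
    and ui: "\<And>a. a \<in> carrier P \<Longrightarrow> h (ui a) = h' (ui a)" and ud: "\<And>i. i \<in> \<Lambda> \<Longrightarrow> h (ud i) = h' (ud i)"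
    and u: "u \<in> carrier U"
  shows "h u = h' u"
proof (rule QU.alg_hom_quot_unique[OF _ u[unfolded env_alg_def]])
  fix w assume "w \<in> carrier Fab"
  then show "h (env_id +>\<^bsub>Fab\<^esub> w) = h' (env_id +>\<^bsub>Fab\<^esub> w)"
    by (rule F_ab_hom_eqI[OF B alg_hom_compose[OF env_proj_hom h]
          alg_hom_compose[OF env_proj_hom h'], rotated -1])
      (simp_all add: ui[unfolded env_incl_def] ud[unfolded env_delta_def])
qed

end

section \<open>Sign flips\<close>

text \<open>The uniqueness principle \<open>gen\<close> is used with two targets. With
  \<open>B = A\<close> it gives \<open>\<phi> (\<phi> u) = u\<close>, as the two signs cancel on
  generators, so \<open>\<phi>\<close> is its own inverse; with \<open>B = opp_alg A\<close> it
  gives uniqueness of the flip.\<close>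

lemma sign_flip_is_isoI:
  fixes K :: "'k ring" and A :: "('k, 'a) module"
  assumes A: "assoc_algebra K A"
    and \<iota>: "\<And>a. a \<in> C \<Longrightarrow> \<iota> a \<in> carrier A" and d: "\<And>i. i \<in> \<Lambda> \<Longrightarrow> d i \<in> carrier A"
    and gen: "\<And>(B :: ('k, 'a) module) h h' u.
      \<lbrakk>assoc_algebra K B; h \<in> alg_hom K A B; h' \<in> alg_hom K A B; \<And>a. a \<in> C \<Longrightarrow> h (\<iota> a) = h' (\<iota> a);
       \<And>i. i \<in> \<Lambda> \<Longrightarrow> h (d i) = h' (d i); u \<in> carrier A\<rbrakk> \<Longrightarrow> h u = h' u"
    and flip: "sign_flip K C \<Lambda> A \<iota> d \<phi>"
  shows "sign_flip_is_iso K C \<Lambda> A \<iota> d"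
proof -
  interpret A: assoc_algebra K A by fact
  have hom: "\<phi> \<in> alg_hom K A (opp_alg A)" and \<phi>_\<iota>: "\<And>a. a \<in> C \<Longrightarrow> \<phi> (\<iota> a) = \<iota> a"
    and \<phi>_d: "\<And>i. i \<in> \<Lambda> \<Longrightarrow> \<phi> (d i) = \<ominus>\<^bsub>A\<^esub> d i"
    using flip by (auto simp: sign_flip_def)
  note opp = assoc_algebra_opp[OF A]
  have "\<phi> (\<phi> u) = u" if "u \<in> carrier A" for u
    by (rule gen[OF A _ alg_hom_id _ _ that])
      (use alg_hom_compose[OF hom alg_hom_opp[OF hom]] in
        \<open>auto simp: \<phi>_\<iota> \<phi>_d d alg_hom_a_inv[OF hom A.ring_A opp[THEN assoc_algebra.ring_A]]\<close>)
  then have "bij_betw \<phi> (carrier A) (carrier (opp_alg A))"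
    using alg_hom_closed[OF hom] by (intro bij_betwI[of _ _ _ \<phi>]) auto
  moreover have "\<psi> u = \<phi> u" if "sign_flip K C \<Lambda> A \<iota> d \<psi>" "u \<in> carrier A" for \<psi> u
    by (rule gen[OF opp _ hom _ _ that(2)]) (use that(1) in \<open>auto simp: sign_flip_def \<phi>_\<iota> \<phi>_d\<close>)
  ultimately show ?thesis
    using flip hom by (auto simp: sign_flip_is_iso_def alg_iso_def)
qed

lemma commutator_opp_alg: "commutator (opp_alg A) u v = commutator A v u"
  by (simp add: commutator_def)

section \<open>Commutator and bracket identities\<close>

context assoc_algebra
begin

lemma commutator_leibniz:
  assumes "u \<in> carrier A" "v \<in> carrier A" "w \<in> carrier A"
  shows "u \<otimes>\<^bsub>A\<^esub> (v \<otimes>\<^bsub>A\<^esub> w) \<ominus>\<^bsub>A\<^esub> (v \<otimes>\<^bsub>A\<^esub> w) \<otimes>\<^bsub>A\<^esub> u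
    = (u \<otimes>\<^bsub>A\<^esub> v \<ominus>\<^bsub>A\<^esub> v \<otimes>\<^bsub>A\<^esub> u) \<otimes>\<^bsub>A\<^esub> w \<oplus>\<^bsub>A\<^esub> v \<otimes>\<^bsub>A\<^esub> (u \<otimes>\<^bsub>A\<^esub> w \<ominus>\<^bsub>A\<^esub> w \<otimes>\<^bsub>A\<^esub> u)"
  using assms by algebra

lemma commutator_add:
  assumes "u \<in> carrier A" "v \<in> carrier A" "w \<in> carrier A"
  shows "u \<otimes>\<^bsub>A\<^esub> (v \<oplus>\<^bsub>A\<^esub> w) \<ominus>\<^bsub>A\<^esub> (v \<oplus>\<^bsub>A\<^esub> w) \<otimes>\<^bsub>A\<^esub> u
    = (u \<otimes>\<^bsub>A\<^esub> v \<ominus>\<^bsub>A\<^esub> v \<otimes>\<^bsub>A\<^esub> u) \<oplus>\<^bsub>A\<^esub> (u \<otimes>\<^bsub>A\<^esub> w \<ominus>\<^bsub>A\<^esub> w \<otimes>\<^bsub>A\<^esub> u)"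
  using assms by algebra

lemma commutator_uminus:
  assumes "u \<in> carrier A" "v \<in> carrier A"
  shows "(\<ominus>\<^bsub>A\<^esub> u) \<otimes>\<^bsub>A\<^esub> (\<ominus>\<^bsub>A\<^esub> v) \<ominus>\<^bsub>A\<^esub> (\<ominus>\<^bsub>A\<^esub> v) \<otimes>\<^bsub>A\<^esub> (\<ominus>\<^bsub>A\<^esub> u) = \<ominus>\<^bsub>A\<^esub> (v \<otimes>\<^bsub>A\<^esub> u \<ominus>\<^bsub>A\<^esub> u \<otimes>\<^bsub>A\<^esub> v)"
    "v \<otimes>\<^bsub>A\<^esub> (\<ominus>\<^bsub>A\<^esub> u) \<ominus>\<^bsub>A\<^esub> (\<ominus>\<^bsub>A\<^esub> u) \<otimes>\<^bsub>A\<^esub> v = u \<otimes>\<^bsub>A\<^esub> v \<ominus>\<^bsub>A\<^esub> v \<otimes>\<^bsub>A\<^esub> u"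
    "v \<otimes>\<^bsub>A\<^esub> u \<ominus>\<^bsub>A\<^esub> u \<otimes>\<^bsub>A\<^esub> v = \<ominus>\<^bsub>A\<^esub> (u \<otimes>\<^bsub>A\<^esub> v \<ominus>\<^bsub>A\<^esub> v \<otimes>\<^bsub>A\<^esub> u)"
  using assms by algebra+

text \<open>The source of the correction term: for a generator \<open>u\<close> and an element
  \<open>v\<close> from \<open>P\<close>, the commutator on the right is a Poisson bracket.\<close>

lemma neg_mult_flip:
  assumes "u \<in> carrier A" "v \<in> carrier A"
  shows "(\<ominus>\<^bsub>A\<^esub> u) \<otimes>\<^bsub>A\<^esub> v = \<ominus>\<^bsub>A\<^esub> (v \<otimes>\<^bsub>A\<^esub> u) \<oplus>\<^bsub>A\<^esub> \<ominus>\<^bsub>A\<^esub> (u \<otimes>\<^bsub>A\<^esub> v \<ominus>\<^bsub>A\<^esub> v \<otimes>\<^bsub>A\<^esub> u)"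
  using assms by algebra

lemma commutator_smult:
  assumes "u \<in> carrier A" "v \<in> carrier A" "c \<in> carrier R"
  shows "u \<otimes>\<^bsub>A\<^esub> (c \<odot>\<^bsub>A\<^esub> v) \<ominus>\<^bsub>A\<^esub> (c \<odot>\<^bsub>A\<^esub> v) \<otimes>\<^bsub>A\<^esub> u = c \<odot>\<^bsub>A\<^esub> (u \<otimes>\<^bsub>A\<^esub> v \<ominus>\<^bsub>A\<^esub> v \<otimes>\<^bsub>A\<^esub> u)"
  using assms by (simp add: smult_mult_left smult_mult_right a_minus_def smult_r_distr smult_r_minus)

end

context poisson_algebra
begin

lemma br_one:
  assumes "a \<in> carrier P"
  shows "br a \<one>\<^bsub>P\<^esub> = \<zero>\<^bsub>P\<^esub>"
proof -
  have "br a \<one>\<^bsub>P\<^esub> = br a \<one>\<^bsub>P\<^esub> \<oplus>\<^bsub>P\<^esub> br a \<one>\<^bsub>P\<^esub>"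
    using br_leibniz[of a "\<one>\<^bsub>P\<^esub>" "\<one>\<^bsub>P\<^esub>"] assms by (simp add: br_closed)
  then show ?thesis
    using assms by (metis M.add.r_cancel_one' br_closed one_closed)
qed

lemma br_skew:
  assumes "a \<in> carrier P" "b \<in> carrier P"
  shows "br a b = \<ominus>\<^bsub>P\<^esub> br b a"
proof -
  have "\<zero>\<^bsub>P\<^esub> = br (a \<oplus>\<^bsub>P\<^esub> b) (a \<oplus>\<^bsub>P\<^esub> b)"
    using assms by (simp add: br_alternating)
  also have "\<dots> = br a b \<oplus>\<^bsub>P\<^esub> br b a"
    using assms by (simp add: br_alternating[of a] br_alternating[of b] br_add_left br_add_right br_closed M.a_comm)
  finally show ?thesis
    using assms by (simp add: M.minus_equality br_closed)
qed

text \<open>Since \<open>P\<close> is commutative, the image of \<open>\<alpha>\<close> is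
  commutative as well, even inside a noncommutative \<open>A\<close>, and reversing products does
  not affect it.\<close>

lemma alg_hom_into_opp:
  assumes "\<alpha> \<in> alg_hom K P A"
  shows "\<alpha> \<in> alg_hom K P (opp_alg A)"
  using assms by (intro alg_homI)
    (auto simp: alg_hom_closed alg_hom_add alg_hom_one alg_hom_smult simp flip: alg_hom_mult intro: m_comm arg_cong[of _ _ \<alpha>])

end

section \<open>Enveloping algebras\<close>

lemma
  assumes "poisson_triple K P br U \<alpha> \<beta>"
  shows poisson_triple_algebra: "assoc_algebra K U"
    and poisson_triple_hom: "\<alpha> \<in> alg_hom K P U"
    and poisson_triple_closed: "a \<in> carrier P \<Longrightarrow> \<beta> a \<in> carrier U"
    and poisson_triple_add: "\<lbrakk>a \<in> carrier P; b \<in> carrier P\<rbrakk> \<Longrightarrow> \<beta> (a \<oplus>\<^bsub>P\<^esub> b) = \<beta> a \<oplus>\<^bsub>U\<^esub> \<beta> b"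
    and poisson_triple_smult: "\<lbrakk>c \<in> carrier K; a \<in> carrier P\<rbrakk> \<Longrightarrow> \<beta> (c \<odot>\<^bsub>P\<^esub> a) = c \<odot>\<^bsub>U\<^esub> \<beta> a"
    and poisson_triple_br:
      "\<lbrakk>a \<in> carrier P; b \<in> carrier P\<rbrakk> \<Longrightarrow> \<beta> (br a b) = commutator U (\<beta> a) (\<beta> b)"
    and poisson_triple_commutator:
      "\<lbrakk>a \<in> carrier P; b \<in> carrier P\<rbrakk> \<Longrightarrow> commutator U (\<beta> a) (\<alpha> b) = \<alpha> (br a b)"
    and poisson_triple_mult:
      "\<lbrakk>a \<in> carrier P; b \<in> carrier P\<rbrakk> \<Longrightarrow> \<beta> (a \<otimes>\<^bsub>P\<^esub> b) = \<beta> a \<otimes>\<^bsub>U\<^esub> \<alpha> b \<oplus>\<^bsub>U\<^esub> \<alpha> a \<otimes>\<^bsub>U\<^esub> \<beta> b"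
  using assms by (auto simp: poisson_triple_def)

lemma poisson_triple_image:
  assumes T: "poisson_triple K P br U \<alpha> \<beta>" and B: "assoc_algebra K B" and h: "h \<in> alg_hom K U B"
  shows "poisson_triple K P br B (\<lambda>a. h (\<alpha> a)) (\<lambda>a. h (\<beta> a))"
proof -
  note U = poisson_triple_algebra[OF T]
  note rings = U[THEN assoc_algebra.ring_A] B[THEN assoc_algebra.ring_A]
  note closed = poisson_triple_closed[OF T] alg_hom_closed[OF poisson_triple_hom[OF T]]
  interpret U: ring U by (rule rings)
  show ?thesis
    unfolding poisson_triple_def
    using B alg_hom_compose[OF poisson_triple_hom[OF T] h]
    by (auto simp: closed alg_hom_closed[OF h] poisson_triple_add[OF T] alg_hom_add[OF h]
        poisson_triple_smult[OF T] alg_hom_smult[OF h] poisson_triple_br[OF T]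
        alg_hom_commutator[OF h rings] poisson_triple_commutator[OF T, symmetric]
        poisson_triple_mult[OF T] alg_hom_mult[OF h])
qed

text \<open>The universal property speaks only of triples. Pushing the triple of \<open>U\<close>
  forward along \<open>h\<close> gives a triple in \<open>B\<close> for which both \<open>h\<close>
  and \<open>h'\<close> are mediating maps, hence both equal the one provided.\<close>

lemma enveloping_hom_eqI:
  fixes U B :: "('k, 'u) module"
  assumes U: "poisson_enveloping_algebra K P br U \<alpha> \<beta>" and B: "assoc_algebra K B"
    and h: "h \<in> alg_hom K U B" and h': "h' \<in> alg_hom K U B"
    and eq: "\<And>a. a \<in> carrier P \<Longrightarrow> h (\<alpha> a) = h' (\<alpha> a)" "\<And>a. a \<in> carrier P \<Longrightarrow> h (\<beta> a) = h' (\<beta> a)"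
    and u: "u \<in> carrier U"
  shows "h u = h' u"
proof -
  have T: "poisson_triple K P br U \<alpha> \<beta>"
    using U by (simp add: poisson_enveloping_algebra_def)
  from U[unfolded poisson_enveloping_algebra_def, THEN conjunct2, THEN spec, THEN spec, THEN spec,
      THEN mp, OF poisson_triple_image[OF T B h]]
  obtain g where "g \<in> alg_hom K U B"
    and g: "(\<forall>a\<in>carrier P. g (\<alpha> a) = h (\<alpha> a) \<and> g (\<beta> a) = h (\<beta> a)) \<and>
      (\<forall>k\<in>alg_hom K U B. (\<forall>a\<in>carrier P. k (\<alpha> a) = h (\<alpha> a) \<and> k (\<beta> a) = h (\<beta> a)) \<longrightarrow>
        (\<forall>u\<in>carrier U. k u = g u))"
    by (rule bexE)
  have "h u = g u"
    using g[THEN conjunct2, THEN bspec, OF h] u by blast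
  also have "\<dots> = h' u"
    using g[THEN conjunct2, THEN bspec, OF h', THEN mp, THEN bspec, OF _ u] eq by (metis (no_types))
  finally show ?thesis .
qed

context poisson_algebra
begin

text \<open>Comparing \<open>\<beta> (a b)\<close> with \<open>\<beta> (b a)\<close> shows that the product rule of a Poisson triple holds in
  either order of the factors.\<close>

lemma poisson_triple_opp:
  assumes T: "poisson_triple K P br U \<alpha> \<beta>"
  shows "poisson_triple K P br (opp_alg U) \<alpha> (\<lambda>a. \<ominus>\<^bsub>U\<^esub> \<beta> a)"
proof -
  interpret U: assoc_algebra K U
    using T by (rule poisson_triple_algebra)
  note \<alpha> = poisson_triple_hom[OF T]
  note [simp] = poisson_triple_closed[OF T] alg_hom_closed[OF \<alpha>]
  show ?thesis
    unfolding poisson_triple_def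
  proof (intro conjI ballI)
    show "assoc_algebra K (opp_alg U)"
      by (rule assoc_algebra_opp[OF poisson_triple_algebra[OF T]])
    show "\<alpha> \<in> alg_hom K P (opp_alg U)"
      by (rule alg_hom_into_opp[OF \<alpha>])
    show "(\<lambda>a. \<ominus>\<^bsub>U\<^esub> \<beta> a) \<in> carrier P \<rightarrow> carrier (opp_alg U)"
      by simp
  next
    fix a b assume ab: "a \<in> carrier P" "b \<in> carrier P"
    show "\<ominus>\<^bsub>U\<^esub> \<beta> (a \<oplus>\<^bsub>P\<^esub> b) = \<ominus>\<^bsub>U\<^esub> \<beta> a \<oplus>\<^bsub>opp_alg U\<^esub> \<ominus>\<^bsub>U\<^esub> \<beta> b"
      using ab by (simp add: poisson_triple_add[OF T] U.M.minus_add)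
    show "\<ominus>\<^bsub>U\<^esub> \<beta> (br a b) = commutator (opp_alg U) (\<ominus>\<^bsub>U\<^esub> \<beta> a) (\<ominus>\<^bsub>U\<^esub> \<beta> b)"
      using ab by (simp add: poisson_triple_br[OF T] commutator_opp_alg commutator_def U.commutator_uminus(1))
    show "commutator (opp_alg U) (\<ominus>\<^bsub>U\<^esub> \<beta> a) (\<alpha> b) = \<alpha> (br a b)"
      using ab U.commutator_uminus(2)[of "\<beta> a" "\<alpha> b"]
      by (simp add: poisson_triple_commutator[OF T, symmetric] commutator_opp_alg commutator_def)
    have "\<beta> (a \<otimes>\<^bsub>P\<^esub> b) = \<beta> b \<otimes>\<^bsub>U\<^esub> \<alpha> a \<oplus>\<^bsub>U\<^esub> \<alpha> b \<otimes>\<^bsub>U\<^esub> \<beta> a"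
      using ab poisson_triple_mult[OF T, of b a] by (simp add: m_comm)
    then show "\<ominus>\<^bsub>U\<^esub> \<beta> (a \<otimes>\<^bsub>P\<^esub> b) =
        (\<ominus>\<^bsub>U\<^esub> \<beta> a) \<otimes>\<^bsub>opp_alg U\<^esub> \<alpha> b \<oplus>\<^bsub>opp_alg U\<^esub> \<alpha> a \<otimes>\<^bsub>opp_alg U\<^esub> (\<ominus>\<^bsub>U\<^esub> \<beta> b)"
      using ab by (simp add: U.l_minus U.r_minus U.M.minus_add U.M.a_comm)
  next
    fix c a assume "c \<in> carrier K" "a \<in> carrier P"
    then show "\<ominus>\<^bsub>U\<^esub> \<beta> (c \<odot>\<^bsub>P\<^esub> a) = c \<odot>\<^bsub>opp_alg U\<^esub> (\<ominus>\<^bsub>U\<^esub> \<beta> a)"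
      by (simp add: poisson_triple_smult[OF T] U.smult_r_minus)
  qed
qed

text \<open>The mediating map from \<open>U\<close> to the opposite triple of
  \<open>poisson_triple_opp\<close>. As \<open>opp_alg U\<close> has the type of \<open>U\<close>,
  it is an admissible target.\<close>

lemma enveloping_sign_flip:
  fixes U :: "('k, 'u) module"
  assumes U: "poisson_enveloping_algebra K P br U \<alpha> \<beta>"
  shows "\<exists>\<phi>. sign_flip K (carrier P) (carrier P) U \<alpha> \<beta> \<phi>"
proof -
  have "poisson_triple K P br (opp_alg U) \<alpha> (\<lambda>a. \<ominus>\<^bsub>U\<^esub> \<beta> a)"
    using U by (intro poisson_triple_opp) (simp add: poisson_enveloping_algebra_def)
  from U[unfolded poisson_enveloping_algebra_def, THEN conjunct2, THEN spec, THEN spec, THEN spec,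
      THEN mp, OF this]
  show ?thesis
    by (rule bexE) (auto simp: sign_flip_def)
qed

text \<open>An abstract Poisson algebra has no coordinates, so the flip is prescribed on
  \<open>\<beta>\<close> of every element, with the carrier of \<open>P\<close> as index
  set.\<close>

lemma enveloping_sign_flip_is_iso:
  fixes U :: "('k, 'u) module"
  assumes U: "poisson_enveloping_algebra K P br U \<alpha> \<beta>"
  shows "sign_flip_is_iso K (carrier P) (carrier P) U \<alpha> \<beta>"
proof -
  have T: "poisson_triple K P br U \<alpha> \<beta>"
    using U by (simp add: poisson_enveloping_algebra_def)
  obtain \<phi> where "sign_flip K (carrier P) (carrier P) U \<alpha> \<beta> \<phi>"
    using enveloping_sign_flip[OF U] by blast
  then show ?thesis
  proof (rule sign_flip_is_isoI[OF poisson_triple_algebra[OF T], rotated -1])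
    fix B :: "('k, 'u) module" and h h' u
    assume "assoc_algebra K B" "h \<in> alg_hom K U B" "h' \<in> alg_hom K U B"
      "\<And>a. a \<in> carrier P \<Longrightarrow> h (\<alpha> a) = h' (\<alpha> a)"
      "\<And>i. i \<in> carrier P \<Longrightarrow> h (\<beta> i) = h' (\<beta> i)" "u \<in> carrier U"
    then show "h u = h' u"
      by (rule enveloping_hom_eqI[OF U])
  qed (auto intro: alg_hom_closed[OF poisson_triple_hom[OF T]] poisson_triple_closed[OF T])
qed

end

text \<open>The assumption \<open>gen\<close> expresses, as an induction rule, that \<open>P\<close>
  is generated by the \<open>x i\<close> under the algebra operations and inversion of units.
  Through it the arguments below use the presentation of \<open>P\<close> by polynomials and
  fractions without mentioning it.\<close>

locale poisson_gen = poisson_vars K P br \<Lambda> x D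
  for K :: "'k ring" (structure) and P :: "('k, 'p) module" (structure) and br
    and \<Lambda> :: "'x set" and x D +
  assumes gen [consumes 1, case_names one var add mult smult inv]:
    "\<lbrakk>g \<in> carrier P; C \<one>\<^bsub>P\<^esub>; \<And>i. i \<in> \<Lambda> \<Longrightarrow> C (x i);
      \<And>a b. \<lbrakk>a \<in> carrier P; b \<in> carrier P; C a; C b\<rbrakk> \<Longrightarrow> C (a \<oplus>\<^bsub>P\<^esub> b);
      \<And>a b. \<lbrakk>a \<in> carrier P; b \<in> carrier P; C a; C b\<rbrakk> \<Longrightarrow> C (a \<otimes>\<^bsub>P\<^esub> b);
      \<And>c a. \<lbrakk>c \<in> carrier K; a \<in> carrier P; C a\<rbrakk> \<Longrightarrow> C (c \<odot>\<^bsub>P\<^esub> a);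
      \<And>a b. \<lbrakk>a \<in> carrier P; b \<in> carrier P; a \<otimes>\<^bsub>P\<^esub> b = \<one>\<^bsub>P\<^esub>; C a\<rbrakk> \<Longrightarrow> C b\<rbrakk> \<Longrightarrow> C g"
    and div_D: "g \<in> carrier P \<Longrightarrow> fsum P \<Lambda> (\<lambda>j. br (D g j) (x j)) = \<zero>\<^bsub>P\<^esub>"
begin

text \<open>Two derivations along \<open>\<alpha>\<close> that agree on the variables agree on
  everything generated from them. The element \<open>y\<close> is left general; in the application
  it is the variable \<open>x k\<close> and \<open>\<delta>\<close> is its generator.\<close>

lemma commutator_delta:
  assumes A: "assoc_algebra K A" and \<alpha>: "\<alpha> \<in> alg_hom K P A" and \<delta>: "\<delta> \<in> carrier A" and y: "y \<in> carrier P"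
    and vars: "\<And>j. j \<in> \<Lambda> \<Longrightarrow> commutator A \<delta> (\<alpha> (x j)) = \<alpha> (br y (x j))"
    and a: "a \<in> carrier P"
  shows "commutator A \<delta> (\<alpha> a) = \<alpha> (br y a)"
proof -
  interpret A: assoc_algebra K A by fact
  note [simp] = alg_hom_closed[OF \<alpha>] alg_hom_add[OF \<alpha>] alg_hom_mult[OF \<alpha>] alg_hom_one[OF \<alpha>]
    alg_hom_smult[OF \<alpha>] br_closed
  show ?thesis
    using a
  proof (induction rule: gen)
    case one
    show ?case
      using y \<delta> by (simp add: commutator_def br_one alg_hom_zero[OF \<alpha> ring_M A.ring_A])
  next
    case (var i)
    then show ?case by (rule vars)
  next
    case (add a b)
    then show ?case
      using y \<delta> by (simp add: commutator_def br_add_right A.commutator_add)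
  next
    case (mult a b)
    then show ?case
      using y \<delta> by (simp add: commutator_def br_leibniz A.commutator_leibniz)
  next
    case (smult c a)
    then show ?case
      using y \<delta> by (simp add: commutator_def br_smult_right A.commutator_smult)
  next
    case (inv a b)
    let ?d = "\<lambda>u. commutator A \<delta> (\<alpha> u)"
    have d_closed: "?d u \<in> carrier A" if "u \<in> carrier P" for u
      using that \<delta> by (simp add: commutator_def)
    have unit: "\<alpha> b \<otimes>\<^bsub>A\<^esub> \<alpha> a = \<one>\<^bsub>A\<^esub>"
      using inv by (simp add: m_comm flip: alg_hom_mult[OF \<alpha>] del: alg_hom_mult[OF \<alpha>])
    \<comment> \<open>A derivation is determined at an inverse: both derivations vanish at
      \<open>a b = 1\<close>, and after expanding by the product rule and cancelling the equal terms
      in \<open>a\<close>, the terms in \<open>b\<close> remain, multiplied by the unit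
      \<open>\<alpha> a\<close>.\<close>
    have "?d a \<otimes>\<^bsub>A\<^esub> \<alpha> b \<oplus>\<^bsub>A\<^esub> \<alpha> a \<otimes>\<^bsub>A\<^esub> ?d b = ?d (a \<otimes>\<^bsub>P\<^esub> b)"
      using inv(1,2) \<delta> by (simp add: commutator_def A.commutator_leibniz)
    also have "\<dots> = \<alpha> (br y (a \<otimes>\<^bsub>P\<^esub> b))"
      using inv \<delta> y by (simp add: commutator_def br_one alg_hom_zero[OF \<alpha> ring_M A.ring_A])
    also have "\<dots> = ?d a \<otimes>\<^bsub>A\<^esub> \<alpha> b \<oplus>\<^bsub>A\<^esub> \<alpha> a \<otimes>\<^bsub>A\<^esub> \<alpha> (br y b)"
      using inv(1,2,4) y by (simp add: br_leibniz)
    finally have "\<alpha> a \<otimes>\<^bsub>A\<^esub> ?d b = \<alpha> a \<otimes>\<^bsub>A\<^esub> \<alpha> (br y b)"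
      using inv(1,2) y by (simp add: d_closed)
    then have "\<alpha> b \<otimes>\<^bsub>A\<^esub> \<alpha> a \<otimes>\<^bsub>A\<^esub> ?d b = \<alpha> b \<otimes>\<^bsub>A\<^esub> \<alpha> a \<otimes>\<^bsub>A\<^esub> \<alpha> (br y b)"
      using inv(1,2) y by (simp add: d_closed A.m_assoc)
    then show ?case
      using inv(1,2) y by (simp add: d_closed unit)
  qed
qed

text \<open>Termwise the two sides differ by \<open>\<alpha> {v k, x k}\<close>, so their difference
  is \<open>\<alpha>\<close> of the divergence of \<open>v\<close>. It is stated for any
  divergence-free vector because it serves both \<open>D g\<close> and \<open>E s\<close>.\<close>

lemma opp_sum:
  assumes A: "assoc_algebra K A" and \<alpha>: "\<alpha> \<in> alg_hom K P A" and d: "\<And>i. i \<in> \<Lambda> \<Longrightarrow> d i \<in> carrier A"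
    and rel: "ab_relations A \<alpha> d"
    and v: "\<And>k. k \<in> \<Lambda> \<Longrightarrow> v k \<in> carrier P" "finite {k \<in> \<Lambda>. v k \<noteq> \<zero>\<^bsub>P\<^esub>}"
    and div: "fsum P \<Lambda> (\<lambda>k. br (v k) (x k)) = \<zero>\<^bsub>P\<^esub>"
  shows "fsum (opp_alg A) \<Lambda> (\<lambda>k. \<alpha> (v k) \<otimes>\<^bsub>opp_alg A\<^esub> (\<ominus>\<^bsub>A\<^esub> d k)) =
    \<ominus>\<^bsub>A\<^esub> fsum A \<Lambda> (\<lambda>k. \<alpha> (v k) \<otimes>\<^bsub>A\<^esub> d k)"
proof -
  interpret A: assoc_algebra K A by fact
  let ?N = "{k \<in> \<Lambda>. v k \<noteq> \<zero>\<^bsub>P\<^esub>}"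
  note [simp] = alg_hom_closed[OF \<alpha>] alg_hom_zero[OF \<alpha> ring_M A.ring_A] v(1) d x_closed br_closed
  have br_zero: "br \<zero>\<^bsub>P\<^esub> (x k) = \<zero>\<^bsub>P\<^esub>" if "k \<in> \<Lambda>" for k
    using br_smult_left[of "\<zero>\<^bsub>K\<^esub>" "\<zero>\<^bsub>P\<^esub>" "x k"] that by simp
  have comm: "d k \<otimes>\<^bsub>A\<^esub> \<alpha> (v k) \<ominus>\<^bsub>A\<^esub> \<alpha> (v k) \<otimes>\<^bsub>A\<^esub> d k = \<alpha> (br (x k) (v k))" if "k \<in> \<Lambda>" for k
    unfolding commutator_def[symmetric]
    by (rule commutator_delta[OF A \<alpha>]) (use that rel in \<open>auto simp: ab_relations_def\<close>)
  have "fsum (opp_alg A) \<Lambda> (\<lambda>k. \<alpha> (v k) \<otimes>\<^bsub>opp_alg A\<^esub> (\<ominus>\<^bsub>A\<^esub> d k)) =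
      finsum A (\<lambda>k. (\<ominus>\<^bsub>A\<^esub> d k) \<otimes>\<^bsub>A\<^esub> \<alpha> (v k)) ?N"
    using v(2) by (simp, intro fsum_eq_finsum A.M.abelian_monoid_axioms) auto
  \<comment> \<open>The sign is written as multiplication by \<open>-1\<close> so that
    distributivity can move it out of the sum.\<close>
  also have "\<dots> = finsum A (\<lambda>k. (\<ominus>\<^bsub>A\<^esub> \<one>\<^bsub>A\<^esub>) \<otimes>\<^bsub>A\<^esub> (\<alpha> (v k) \<otimes>\<^bsub>A\<^esub> d k) \<oplus>\<^bsub>A\<^esub> \<alpha> (br (v k) (x k))) ?N"
  proof (rule A.M.finsum_cong')
    fix k assume k: "k \<in> ?N"
    then show "(\<ominus>\<^bsub>A\<^esub> d k) \<otimes>\<^bsub>A\<^esub> \<alpha> (v k) = (\<ominus>\<^bsub>A\<^esub> \<one>\<^bsub>A\<^esub>) \<otimes>\<^bsub>A\<^esub> (\<alpha> (v k) \<otimes>\<^bsub>A\<^esub> d k) \<oplus>\<^bsub>A\<^esub> \<alpha> (br (v k) (x k))"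
      using A.neg_mult_flip[of "d k" "\<alpha> (v k)"] br_skew[of "v k" "x k"]
      by (simp add: comm alg_hom_a_inv[OF \<alpha> ring_M A.ring_A] A.l_minus)
  qed auto
  also have "\<dots> = finsum A (\<lambda>k. (\<ominus>\<^bsub>A\<^esub> \<one>\<^bsub>A\<^esub>) \<otimes>\<^bsub>A\<^esub> (\<alpha> (v k) \<otimes>\<^bsub>A\<^esub> d k)) ?N \<oplus>\<^bsub>A\<^esub> finsum A (\<lambda>k. \<alpha> (br (v k) (x k))) ?N"
    by (rule A.M.finsum_addf) auto
  also have "finsum A (\<lambda>k. (\<ominus>\<^bsub>A\<^esub> \<one>\<^bsub>A\<^esub>) \<otimes>\<^bsub>A\<^esub> (\<alpha> (v k) \<otimes>\<^bsub>A\<^esub> d k)) ?N = (\<ominus>\<^bsub>A\<^esub> \<one>\<^bsub>A\<^esub>) \<otimes>\<^bsub>A\<^esub> finsum A (\<lambda>k. \<alpha> (v k) \<otimes>\<^bsub>A\<^esub> d k) ?N"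
    using v(2) by (intro A.finsum_rdistr[symmetric]) auto
  also have "finsum A (\<lambda>k. \<alpha> (v k) \<otimes>\<^bsub>A\<^esub> d k) ?N = fsum A \<Lambda> (\<lambda>k. \<alpha> (v k) \<otimes>\<^bsub>A\<^esub> d k)"
    using v(2) by (intro fsum_eq_finsum[symmetric] A.M.abelian_monoid_axioms) auto
  also have "finsum A (\<lambda>k. \<alpha> (br (v k) (x k))) ?N = \<alpha> (finsum P (\<lambda>k. br (v k) (x k)) ?N)"
    by (intro alg_hom_finsum[OF \<alpha> ring_M A.ring_A, symmetric]) auto
  also have "finsum P (\<lambda>k. br (v k) (x k)) ?N = fsum P \<Lambda> (\<lambda>k. br (v k) (x k))"
    using v(2) by (intro fsum_eq_finsum[symmetric] M.abelian_monoid_axioms) (auto simp: br_zero)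
  finally show ?thesis
    using fsum_closed[OF A.M.abelian_monoid_axioms, of \<Lambda> "\<lambda>k. \<alpha> (v k) \<otimes>\<^bsub>A\<^esub> d k"]
    by (simp add: div A.l_minus)
qed

text \<open>In the relation with \<open>x j\<close>, the sign and the reversal of the product
  cancel. In the relation of two generators the two signs cancel each other and only the reversal
  remains, so the right side has to change sign as well; this is \<open>opp_sum\<close> for the
  vector \<open>D {x i, x j}\<close>.\<close>

lemma ab_relations_opp:
  assumes A: "assoc_algebra K A" and \<alpha>: "\<alpha> \<in> alg_hom K P A" and d: "\<And>i. i \<in> \<Lambda> \<Longrightarrow> d i \<in> carrier A"
    and rel: "ab_relations A \<alpha> d"
  shows "ab_relations (opp_alg A) \<alpha> (\<lambda>i. \<ominus>\<^bsub>A\<^esub> d i)"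
  unfolding ab_relations_def
proof (intro ballI conjI)
  interpret A: assoc_algebra K A by fact
  fix i j assume ij: "i \<in> \<Lambda>" "j \<in> \<Lambda>"
  have g: "br (x i) (x j) \<in> carrier P"
    using ij by (intro br_closed x_closed)
  have "commutator (opp_alg A) (\<ominus>\<^bsub>A\<^esub> d i) (\<ominus>\<^bsub>A\<^esub> d j) = \<ominus>\<^bsub>A\<^esub> commutator A (d i) (d j)"
    using ij d by (simp add: commutator_opp_alg commutator_def A.commutator_uminus(1))
  also have "\<dots> = \<ominus>\<^bsub>A\<^esub> fsum A \<Lambda> (\<lambda>k. \<alpha> (D (br (x i) (x j)) k) \<otimes>\<^bsub>A\<^esub> d k)"
    using rel ij by (simp add: ab_relations_def)
  also have "\<dots> = fsum (opp_alg A) \<Lambda> (\<lambda>k. \<alpha> (D (br (x i) (x j)) k) \<otimes>\<^bsub>opp_alg A\<^esub> (\<ominus>\<^bsub>A\<^esub> d k))"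
    using opp_sum[OF A \<alpha> d rel D_closed[OF g] D_finite[OF g] div_D[OF g]] by simp
  finally show "commutator (opp_alg A) (\<ominus>\<^bsub>A\<^esub> d i) (\<ominus>\<^bsub>A\<^esub> d j) =
      fsum (opp_alg A) \<Lambda> (\<lambda>k. \<alpha> (D (br (x i) (x j)) k) \<otimes>\<^bsub>opp_alg A\<^esub> (\<ominus>\<^bsub>A\<^esub> d k))" .
  have "commutator (opp_alg A) (\<ominus>\<^bsub>A\<^esub> d i) (\<alpha> (x j)) = commutator A (d i) (\<alpha> (x j))"
    using ij d x_closed alg_hom_closed[OF \<alpha>] A.commutator_uminus(2)[of "d i" "\<alpha> (x j)"]
    by (simp add: commutator_opp_alg commutator_def)
  then show "commutator (opp_alg A) (\<ominus>\<^bsub>A\<^esub> d i) (\<alpha> (x j)) = \<alpha> (br (x i) (x j))"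
    using rel ij by (simp add: ab_relations_def)
qed

lemma F_ab_sign_flip_is_iso: "sign_flip_is_iso K (carrier P) \<Lambda> Fab fi fd"
proof -
  interpret A: assoc_algebra K Fab by (rule assoc_algebra_F_ab)
  obtain h where "h \<in> alg_hom K Fab (opp_alg Fab)" "\<And>a. a \<in> carrier P \<Longrightarrow> h (fi a) = fi a"
    "\<And>i. i \<in> \<Lambda> \<Longrightarrow> h (fd i) = \<ominus>\<^bsub>Fab\<^esub> fd i"
    using F_ab_lift[OF assoc_algebra_opp[OF assoc_algebra_F_ab] alg_hom_into_opp[OF F_ab_incl_hom] _
        ab_relations_opp[OF assoc_algebra_F_ab F_ab_incl_hom _ F_ab_relations]] F_ab_delta_closed
    by (auto simp: A.M.a_inv_closed)
  then have "sign_flip K (carrier P) \<Lambda> Fab fi fd h"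
    by (simp add: sign_flip_def)
  then show ?thesis
  proof (rule sign_flip_is_isoI[OF assoc_algebra_F_ab, rotated -1])
    fix B :: "('k, ('k, 'p, 'x) word_poly set set) module" and h h' u
    assume "assoc_algebra K B" "h \<in> alg_hom K Fab B" "h' \<in> alg_hom K Fab B"
      "\<And>a. a \<in> carrier P \<Longrightarrow> h (fi a) = h' (fi a)"
      "\<And>i. i \<in> \<Lambda> \<Longrightarrow> h (fd i) = h' (fd i)" "u \<in> carrier Fab"
    then show "h u = h' u"
      by (rule F_ab_hom_eqI)
  qed (auto intro: alg_hom_closed[OF F_ab_incl_hom] F_ab_delta_closed)
qed

text \<open>The flip on all of \<open>\<beta> P\<close> already exists. The new point is
  \<open>gen_U\<close>: homomorphisms are determined by \<open>\<alpha>\<close> and the values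
  \<open>\<beta> (x i)\<close> alone, so the smaller set of prescriptions still fixes the
  map.\<close>

lemma enveloping_vars_sign_flip_is_iso:
  fixes U :: "('k, 'u) module"
  assumes U: "poisson_enveloping_algebra K P br U \<alpha> \<beta>"
  shows "sign_flip_is_iso K (carrier P) \<Lambda> U \<alpha> (\<lambda>i. \<beta> (x i))"
proof -
  have T: "poisson_triple K P br U \<alpha> \<beta>"
    using U by (simp add: poisson_enveloping_algebra_def)
  note alg = poisson_triple_algebra[OF T]
  interpret U: assoc_algebra K U by (rule alg)
  note \<alpha> = poisson_triple_hom[OF T]
  note [simp] = poisson_triple_closed[OF T] alg_hom_closed[OF \<alpha>]
  obtain \<phi> where \<phi>: "sign_flip K (carrier P) (carrier P) U \<alpha> \<beta> \<phi>"
    using enveloping_sign_flip[OF U] by blast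
  have \<beta>_one: "\<beta> \<one>\<^bsub>P\<^esub> = \<zero>\<^bsub>U\<^esub>"
  proof -
    have "\<beta> \<one>\<^bsub>P\<^esub> = \<beta> \<one>\<^bsub>P\<^esub> \<oplus>\<^bsub>U\<^esub> \<beta> \<one>\<^bsub>P\<^esub>"
      using poisson_triple_mult[OF T, of "\<one>\<^bsub>P\<^esub>" "\<one>\<^bsub>P\<^esub>"] by (simp add: alg_hom_one[OF \<alpha>])
    then show ?thesis
      by (metis U.M.add.r_cancel_one' poisson_triple_closed[OF T] one_closed)
  qed
  have gen_U: "h u = h' u"
    if B: "assoc_algebra K B" and h: "h \<in> alg_hom K U B" and h': "h' \<in> alg_hom K U B"
      and eq: "\<And>a. a \<in> carrier P \<Longrightarrow> h (\<alpha> a) = h' (\<alpha> a)"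
      and eq_x: "\<And>i. i \<in> \<Lambda> \<Longrightarrow> h (\<beta> (x i)) = h' (\<beta> (x i))" and u: "u \<in> carrier U"
    for B :: "('k, 'u) module" and h h' u
  proof -
    interpret B: assoc_algebra K B by fact
    note homs = alg_hom_closed[OF h] alg_hom_closed[OF h'] alg_hom_add[OF h] alg_hom_add[OF h']
      alg_hom_mult[OF h] alg_hom_mult[OF h'] alg_hom_smult[OF h] alg_hom_smult[OF h']
      poisson_triple_add[OF T] poisson_triple_smult[OF T] poisson_triple_mult[OF T]
    \<comment> \<open>The product rule expresses \<open>\<beta> (a b)\<close> by values of
      \<open>\<alpha>\<close> and \<open>\<beta>\<close> at the factors. For an inverse it is
      applied to \<open>a b = 1\<close>, where \<open>\<beta>\<close> vanishes, and solved for
      \<open>\<beta> b\<close> by means of the unit \<open>h (\<alpha> a)\<close>.\<close>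
    have "h (\<beta> a) = h' (\<beta> a)" if "a \<in> carrier P" for a
      using that
    proof (induction rule: gen)
      case one
      show ?case
        by (simp add: \<beta>_one alg_hom_zero[OF h U.ring_A B.ring_A] alg_hom_zero[OF h' U.ring_A B.ring_A])
    next
      case (inv a b)
      have unit: "h (\<alpha> b) \<otimes>\<^bsub>B\<^esub> h (\<alpha> a) = \<one>\<^bsub>B\<^esub>"
        using inv by (simp add: m_comm alg_hom_one[OF h] alg_hom_one[OF \<alpha>] flip: alg_hom_mult[OF h] alg_hom_mult[OF \<alpha>])
      have "h (\<beta> (a \<otimes>\<^bsub>P\<^esub> b)) = h' (\<beta> (a \<otimes>\<^bsub>P\<^esub> b))"
        using inv(3)
        by (simp add: \<beta>_one alg_hom_zero[OF h U.ring_A B.ring_A] alg_hom_zero[OF h' U.ring_A B.ring_A])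
      then have "h (\<alpha> a) \<otimes>\<^bsub>B\<^esub> h (\<beta> b) = h (\<alpha> a) \<otimes>\<^bsub>B\<^esub> h' (\<beta> b)"
        using inv(1,2,4) by (simp add: homs eq)
      then have "h (\<alpha> b) \<otimes>\<^bsub>B\<^esub> h (\<alpha> a) \<otimes>\<^bsub>B\<^esub> h (\<beta> b) = h (\<alpha> b) \<otimes>\<^bsub>B\<^esub> h (\<alpha> a) \<otimes>\<^bsub>B\<^esub> h' (\<beta> b)"
        using inv(1,2) by (simp add: homs B.m_assoc)
      then show ?case
        using inv(1,2) by (simp add: unit homs)
    qed (simp_all add: eq_x homs eq)
    with eq show ?thesis
      by (rule enveloping_hom_eqI[OF U B h h' _ _ u])
  qed
  have "sign_flip K (carrier P) \<Lambda> U \<alpha> (\<lambda>i. \<beta> (x i)) \<phi>"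
    using \<phi> x_closed by (auto simp: sign_flip_def)
  then show ?thesis
  proof (rule sign_flip_is_isoI[OF alg, rotated -1])
    fix B :: "('k, 'u) module" and h h' u
    assume "assoc_algebra K B" "h \<in> alg_hom K U B" "h' \<in> alg_hom K U B"
      "\<And>a. a \<in> carrier P \<Longrightarrow> h (\<alpha> a) = h' (\<alpha> a)"
      "\<And>i. i \<in> \<Lambda> \<Longrightarrow> h (\<beta> (x i)) = h' (\<beta> (x i))" "u \<in> carrier U"
    then show "h u = h' u"
      by (rule gen_U)
  qed (auto simp: x_closed)
qed

end

locale poisson_gen_rel = poisson_gen K P br \<Lambda> x D + poisson_vars_rel K P br \<Lambda> x D \<Gamma> E
  for K :: "'k ring" (structure) and P :: "('k, 'p) module" (structure) and br
    and \<Lambda> :: "'x set" and x D and \<Gamma> :: "'s set" and E +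
  assumes div_E: "s \<in> \<Gamma> \<Longrightarrow> fsum P \<Lambda> (\<lambda>j. br (E s j) (x j)) = \<zero>\<^bsub>P\<^esub>"
begin

text \<open>The additional relations survive the flip because \<open>E s\<close> is divergence-free:
  the flipped sum is minus the original one, which is zero in \<open>U\<close>.\<close>

lemma env_sign_flip_is_iso: "sign_flip_is_iso K (carrier P) \<Lambda> U ui ud"
proof -
  interpret A: assoc_algebra K U by (rule assoc_algebra_env)
  have "fsum (opp_alg U) \<Lambda> (\<lambda>k. ui (E s k) \<otimes>\<^bsub>opp_alg U\<^esub> (\<ominus>\<^bsub>U\<^esub> ud k)) = \<zero>\<^bsub>opp_alg U\<^esub>" if s: "s \<in> \<Gamma>" for s
  proof -
    have "fsum (opp_alg U) \<Lambda> (\<lambda>k. ui (E s k) \<otimes>\<^bsub>opp_alg U\<^esub> (\<ominus>\<^bsub>U\<^esub> ud k)) =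
        \<ominus>\<^bsub>U\<^esub> fsum U \<Lambda> (\<lambda>k. ui (E s k) \<otimes>\<^bsub>U\<^esub> ud k)"
      by (rule opp_sum[OF assoc_algebra_env env_incl_hom env_delta_closed env_ab_relations
            E_closed[OF s] E_finite[OF s] div_E[OF s]])
    also have "\<dots> = \<zero>\<^bsub>opp_alg U\<^esub>"
      by (simp add: env_relation[OF s])
    finally show ?thesis .
  qed
  then obtain h where "h \<in> alg_hom K U (opp_alg U)" "\<And>a. a \<in> carrier P \<Longrightarrow> h (ui a) = ui a"
    "\<And>i. i \<in> \<Lambda> \<Longrightarrow> h (ud i) = \<ominus>\<^bsub>U\<^esub> ud i"
    using env_lift[OF assoc_algebra_opp[OF assoc_algebra_env] alg_hom_into_opp[OF env_incl_hom] _
        ab_relations_opp[OF assoc_algebra_env env_incl_hom _ env_ab_relations]] env_delta_closed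
    by (auto simp: A.M.a_inv_closed)
  then have "sign_flip K (carrier P) \<Lambda> U ui ud h"
    by (simp add: sign_flip_def)
  then show ?thesis
  proof (rule sign_flip_is_isoI[OF assoc_algebra_env, rotated -1])
    fix B :: "('k, ('k, 'p, 'x) word_poly set set set) module" and h h' u
    assume "assoc_algebra K B" "h \<in> alg_hom K U B" "h' \<in> alg_hom K U B"
      "\<And>a. a \<in> carrier P \<Longrightarrow> h (ui a) = h' (ui a)"
      "\<And>i. i \<in> \<Lambda> \<Longrightarrow> h (ud i) = h' (ud i)" "u \<in> carrier U"
    then show "h u = h' u"
      by (rule env_hom_eqI)
  qed (auto intro: alg_hom_closed[OF env_incl_hom] env_delta_closed)
qed

end

section \<open>Divergence-free gradients\<close>

lemma fsum_add:
  assumes "abelian_monoid A" and s: "\<And>k. k \<in> J \<Longrightarrow> s k \<in> carrier A" and t: "\<And>k. k \<in> J \<Longrightarrow> t k \<in> carrier A"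
    and fin: "finite {k \<in> J. s k \<noteq> \<zero>\<^bsub>A\<^esub>}" "finite {k \<in> J. t k \<noteq> \<zero>\<^bsub>A\<^esub>}"
  shows "fsum A J (\<lambda>k. s k \<oplus>\<^bsub>A\<^esub> t k) = fsum A J s \<oplus>\<^bsub>A\<^esub> fsum A J t"
proof -
  interpret abelian_monoid A by fact
  let ?N = "{k \<in> J. s k \<noteq> \<zero>\<^bsub>A\<^esub>} \<union> {k \<in> J. t k \<noteq> \<zero>\<^bsub>A\<^esub>}"
  have eq: "fsum A J r = finsum A r ?N"
    if "\<And>k. k \<in> J \<Longrightarrow> r k \<in> carrier A" "\<And>k. k \<in> J - ?N \<Longrightarrow> r k = \<zero>\<^bsub>A\<^esub>" for r
    using fin that by (intro fsum_eq_finsum abelian_monoid_axioms) auto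
  have "fsum A J (\<lambda>k. s k \<oplus>\<^bsub>A\<^esub> t k) = finsum A (\<lambda>k. s k \<oplus>\<^bsub>A\<^esub> t k) ?N"
    by (rule eq) (auto simp: s t)
  also have "\<dots> = finsum A s ?N \<oplus>\<^bsub>A\<^esub> finsum A t ?N"
    using s t by (intro finsum_addf) auto
  also have "\<dots> = fsum A J s \<oplus>\<^bsub>A\<^esub> fsum A J t"
    using s t by (intro arg_cong2[of _ _ _ _ "(\<oplus>\<^bsub>A\<^esub>)"] eq[symmetric]) auto
  finally show ?thesis .
qed

lemma fsum_rdistr:
  assumes "ring A" and a: "a \<in> carrier A" and t: "\<And>k. k \<in> J \<Longrightarrow> t k \<in> carrier A"
    and fin: "finite {k \<in> J. t k \<noteq> \<zero>\<^bsub>A\<^esub>}"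
  shows "fsum A J (\<lambda>k. a \<otimes>\<^bsub>A\<^esub> t k) = a \<otimes>\<^bsub>A\<^esub> fsum A J t"
proof -
  interpret ring A by fact
  let ?N = "{k \<in> J. t k \<noteq> \<zero>\<^bsub>A\<^esub>}"
  have "fsum A J (\<lambda>k. a \<otimes>\<^bsub>A\<^esub> t k) = finsum A (\<lambda>k. a \<otimes>\<^bsub>A\<^esub> t k) ?N"
    using fin a t by (intro fsum_eq_finsum abelian_monoid_axioms) auto
  also have "\<dots> = a \<otimes>\<^bsub>A\<^esub> finsum A t ?N"
    using fin a t by (intro finsum_rdistr[symmetric]) auto
  finally show ?thesis
    by (simp add: fsum_def)
qed

lemma fsum_zero: "abelian_monoid A \<Longrightarrow> fsum A J (\<lambda>k. \<zero>\<^bsub>A\<^esub>) = \<zero>\<^bsub>A\<^esub>"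
  by (simp add: fsum_def abelian_monoid.finsum_empty)

locale poisson_coords = poisson_algebra K P br
  for K :: "'k ring" (structure) and P :: "('k, 'p) module" (structure) and br +
  fixes \<Lambda> :: "'x set" and x :: "'x \<Rightarrow> 'p"
  assumes x_closed [simp]: "i \<in> \<Lambda> \<Longrightarrow> x i \<in> carrier P"
begin

text \<open>The bracket clause makes the class closed under products: the divergence of the product
  rule contains \<open>\<Sum> w k {a, x k}\<close>, which only this clause evaluates, to
  \<open>{a, b}\<close>. An element may have many gradients; the relators provide possibly nonzero
  gradients of \<open>0\<close>.\<close>

definition is_gradient :: "'p \<Rightarrow> ('x \<Rightarrow> 'p) \<Rightarrow> bool" where
  "is_gradient a v \<longleftrightarrow> a \<in> carrier P \<and> (\<forall>k\<in>\<Lambda>. v k \<in> carrier P) \<and> finite {k \<in> \<Lambda>. v k \<noteq> \<zero>\<^bsub>P\<^esub>} \<and>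
     (\<forall>y\<in>carrier P. br y a = fsum P \<Lambda> (\<lambda>k. v k \<otimes>\<^bsub>P\<^esub> br y (x k))) \<and>
     fsum P \<Lambda> (\<lambda>k. br (v k) (x k)) = \<zero>\<^bsub>P\<^esub>"

lemma
  assumes "is_gradient a v"
  shows is_gradient_closed: "a \<in> carrier P" and is_gradient_vec_closed: "k \<in> \<Lambda> \<Longrightarrow> v k \<in> carrier P"
    and is_gradient_finite: "finite {k \<in> \<Lambda>. v k \<noteq> \<zero>\<^bsub>P\<^esub>}"
    and is_gradient_br: "y \<in> carrier P \<Longrightarrow> fsum P \<Lambda> (\<lambda>k. v k \<otimes>\<^bsub>P\<^esub> br y (x k)) = br y a"
    and is_gradient_div: "fsum P \<Lambda> (\<lambda>k. br (v k) (x k)) = \<zero>\<^bsub>P\<^esub>"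
  using assms by (auto simp: is_gradient_def)

lemmas is_gradientD = is_gradient_closed is_gradient_vec_closed is_gradient_finite is_gradient_br is_gradient_div

lemma br_zero_right: "a \<in> carrier P \<Longrightarrow> br a \<zero>\<^bsub>P\<^esub> = \<zero>\<^bsub>P\<^esub>"
  and br_zero_left: "a \<in> carrier P \<Longrightarrow> br \<zero>\<^bsub>P\<^esub> a = \<zero>\<^bsub>P\<^esub>"
  using br_smult_right[of "\<zero>\<^bsub>K\<^esub>" a "\<zero>\<^bsub>P\<^esub>"] br_smult_left[of "\<zero>\<^bsub>K\<^esub>" "\<zero>\<^bsub>P\<^esub>" a] by (simp_all add: br_closed)

lemma br_leibniz_left:
  assumes "a \<in> carrier P" "b \<in> carrier P" "y \<in> carrier P"
  shows "br (a \<otimes>\<^bsub>P\<^esub> b) y = a \<otimes>\<^bsub>P\<^esub> br b y \<oplus>\<^bsub>P\<^esub> b \<otimes>\<^bsub>P\<^esub> br a y"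
proof -
  have "br (a \<otimes>\<^bsub>P\<^esub> b) y = \<ominus>\<^bsub>P\<^esub> (br y a \<otimes>\<^bsub>P\<^esub> b \<oplus>\<^bsub>P\<^esub> a \<otimes>\<^bsub>P\<^esub> br y b)"
    using assms br_skew[of "a \<otimes>\<^bsub>P\<^esub> b" y] by (simp add: br_leibniz)
  also have "\<dots> = a \<otimes>\<^bsub>P\<^esub> (\<ominus>\<^bsub>P\<^esub> br y b) \<oplus>\<^bsub>P\<^esub> b \<otimes>\<^bsub>P\<^esub> (\<ominus>\<^bsub>P\<^esub> br y a)"
    using assms br_closed[of y a] br_closed[of y b] by algebra
  finally show ?thesis
    using assms br_skew[of a y] br_skew[of b y] by simp
qed

lemma finite_support_mult:
  "finite {k \<in> \<Lambda>. v k \<noteq> \<zero>\<^bsub>P\<^esub>} \<Longrightarrow> (\<And>k. k \<in> \<Lambda> \<Longrightarrow> r k \<in> carrier P) \<Longrightarrow>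
    finite {k \<in> \<Lambda>. v k \<otimes>\<^bsub>P\<^esub> r k \<noteq> \<zero>\<^bsub>P\<^esub>}"
  by (erule finite_subset[rotated]) auto

lemma finite_support_br:
  "finite {k \<in> \<Lambda>. v k \<noteq> \<zero>\<^bsub>P\<^esub>} \<Longrightarrow> finite {k \<in> \<Lambda>. br (v k) (x k) \<noteq> \<zero>\<^bsub>P\<^esub>}"
  by (erule finite_subset[rotated]) (auto simp: br_zero_left)

lemma is_gradient_cong:
  assumes "is_gradient a v" "\<And>k. k \<in> \<Lambda> \<Longrightarrow> w k = v k"
  shows "is_gradient a w"
proof -
  note v = is_gradientD[OF assms(1)]
  have "{k \<in> \<Lambda>. w k \<noteq> \<zero>\<^bsub>P\<^esub>} = {k \<in> \<Lambda>. v k \<noteq> \<zero>\<^bsub>P\<^esub>}"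
    using assms(2) by auto
  moreover have "fsum P \<Lambda> (\<lambda>k. w k \<otimes>\<^bsub>P\<^esub> br y (x k)) = fsum P \<Lambda> (\<lambda>k. v k \<otimes>\<^bsub>P\<^esub> br y (x k))"
    if "y \<in> carrier P" for y
    using that v assms(2) by (intro fsum_cong M.abelian_monoid_axioms) (auto simp: br_closed)
  moreover have "fsum P \<Lambda> (\<lambda>k. br (w k) (x k)) = fsum P \<Lambda> (\<lambda>k. br (v k) (x k))"
    using v assms(2) by (intro fsum_cong M.abelian_monoid_axioms) (auto simp: br_closed)
  ultimately show ?thesis
    using assms v by (simp add: is_gradient_def)
qed

lemma is_gradient_zero: "is_gradient \<zero>\<^bsub>P\<^esub> (\<lambda>k. \<zero>\<^bsub>P\<^esub>)"
proof -
  have "fsum P \<Lambda> (\<lambda>k. \<zero>\<^bsub>P\<^esub> \<otimes>\<^bsub>P\<^esub> br y (x k)) = \<zero>\<^bsub>P\<^esub>" if "y \<in> carrier P" for y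
    using that fsum_cong[OF M.abelian_monoid_axioms, of \<Lambda> "\<lambda>k. \<zero>\<^bsub>P\<^esub> \<otimes>\<^bsub>P\<^esub> br y (x k)" "\<lambda>k. \<zero>\<^bsub>P\<^esub>"]
    by (simp add: fsum_zero M.abelian_monoid_axioms br_closed)
  moreover have "fsum P \<Lambda> (\<lambda>k. br \<zero>\<^bsub>P\<^esub> (x k)) = \<zero>\<^bsub>P\<^esub>"
    using fsum_cong[OF M.abelian_monoid_axioms, of \<Lambda> "\<lambda>k. br \<zero>\<^bsub>P\<^esub> (x k)" "\<lambda>k. \<zero>\<^bsub>P\<^esub>"]
    by (simp add: fsum_zero M.abelian_monoid_axioms br_zero_left)
  ultimately show ?thesis
    by (simp add: is_gradient_def br_zero_right)
qed

lemma is_gradient_one: "is_gradient \<one>\<^bsub>P\<^esub> (\<lambda>k. \<zero>\<^bsub>P\<^esub>)"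
  using is_gradient_zero by (simp add: is_gradient_def br_zero_right br_one)

lemma is_gradient_var:
  assumes i: "i \<in> \<Lambda>"
  shows "is_gradient (x i) (\<lambda>k. if k = i then \<one>\<^bsub>P\<^esub> else \<zero>\<^bsub>P\<^esub>)"
proof -
  let ?v = "\<lambda>k. if k = i then \<one>\<^bsub>P\<^esub> else \<zero>\<^bsub>P\<^esub>"
  have "fsum P \<Lambda> (\<lambda>k. ?v k \<otimes>\<^bsub>P\<^esub> br y (x k)) = br y (x i)" if "y \<in> carrier P" for y
    using that i fsum_eq_finsum[OF M.abelian_monoid_axioms, of "{i}" \<Lambda> "\<lambda>k. ?v k \<otimes>\<^bsub>P\<^esub> br y (x k)"]
    by (simp add: br_closed)
  moreover have "fsum P \<Lambda> (\<lambda>k. br (?v k) (x k)) = \<zero>\<^bsub>P\<^esub>"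
    using i fsum_eq_finsum[OF M.abelian_monoid_axioms, of "{i}" \<Lambda> "\<lambda>k. br (?v k) (x k)"]
    by (simp add: br_closed br_zero_left br_one br_skew[of "\<one>\<^bsub>P\<^esub>"])
  ultimately show ?thesis
    using i by (auto simp: is_gradient_def)
qed

lemma is_gradient_add:
  assumes "is_gradient a v" "is_gradient b w"
  shows "is_gradient (a \<oplus>\<^bsub>P\<^esub> b) (\<lambda>k. v k \<oplus>\<^bsub>P\<^esub> w k)"
proof -
  note v = is_gradientD[OF assms(1)] and w = is_gradientD[OF assms(2)]
  have "finite {k \<in> \<Lambda>. v k \<oplus>\<^bsub>P\<^esub> w k \<noteq> \<zero>\<^bsub>P\<^esub>}"
    by (rule finite_subset[OF _ finite_UnI[OF v(3) w(3)]]) auto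
  moreover have "fsum P \<Lambda> (\<lambda>k. (v k \<oplus>\<^bsub>P\<^esub> w k) \<otimes>\<^bsub>P\<^esub> br y (x k)) = br y (a \<oplus>\<^bsub>P\<^esub> b)"
    if y: "y \<in> carrier P" for y
  proof -
    have "fsum P \<Lambda> (\<lambda>k. (v k \<oplus>\<^bsub>P\<^esub> w k) \<otimes>\<^bsub>P\<^esub> br y (x k)) =
        fsum P \<Lambda> (\<lambda>k. v k \<otimes>\<^bsub>P\<^esub> br y (x k) \<oplus>\<^bsub>P\<^esub> w k \<otimes>\<^bsub>P\<^esub> br y (x k))"
      using v w y by (intro fsum_cong M.abelian_monoid_axioms) (auto simp: br_closed l_distr)
    also have "\<dots> = br y a \<oplus>\<^bsub>P\<^esub> br y b"
      using v w y
      by (subst fsum_add[OF M.abelian_monoid_axioms]) (auto simp: br_closed intro!: finite_support_mult)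
    finally show ?thesis
      using v w y by (simp add: br_add_right)
  qed
  moreover have "fsum P \<Lambda> (\<lambda>k. br (v k \<oplus>\<^bsub>P\<^esub> w k) (x k)) = \<zero>\<^bsub>P\<^esub>"
  proof -
    have "fsum P \<Lambda> (\<lambda>k. br (v k \<oplus>\<^bsub>P\<^esub> w k) (x k)) = fsum P \<Lambda> (\<lambda>k. br (v k) (x k) \<oplus>\<^bsub>P\<^esub> br (w k) (x k))"
      using v w by (intro fsum_cong M.abelian_monoid_axioms) (auto simp: br_closed br_add_left)
    also have "\<dots> = \<zero>\<^bsub>P\<^esub>"
      using v w
      by (subst fsum_add[OF M.abelian_monoid_axioms]) (auto simp: br_closed intro!: finite_support_br)
    finally show ?thesis .
  qed
  ultimately show ?thesis
    using v w by (simp add: is_gradient_def)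
qed

text \<open>The divergence of the product rule is \<open>{a, b} + {b, a}\<close>.\<close>

lemma is_gradient_mult:
  assumes "is_gradient a v" "is_gradient b w"
  shows "is_gradient (a \<otimes>\<^bsub>P\<^esub> b) (\<lambda>k. a \<otimes>\<^bsub>P\<^esub> w k \<oplus>\<^bsub>P\<^esub> b \<otimes>\<^bsub>P\<^esub> v k)"
proof -
  note v = is_gradientD[OF assms(1)] and w = is_gradientD[OF assms(2)]
  note am = M.abelian_monoid_axioms
  have fin: "finite {k \<in> \<Lambda>. c \<otimes>\<^bsub>P\<^esub> u k \<noteq> \<zero>\<^bsub>P\<^esub>}" if "finite {k \<in> \<Lambda>. u k \<noteq> \<zero>\<^bsub>P\<^esub>}" "c \<in> carrier P" for c u
    using that by (elim finite_subset[rotated]) auto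
  have fin_br: "finite {k \<in> \<Lambda>. u k \<otimes>\<^bsub>P\<^esub> br y (x k) \<noteq> \<zero>\<^bsub>P\<^esub>}"
    if "finite {k \<in> \<Lambda>. u k \<noteq> \<zero>\<^bsub>P\<^esub>}" "y \<in> carrier P" for y u
    using that by (intro finite_support_mult) (auto simp: br_closed)
  have "finite {k \<in> \<Lambda>. a \<otimes>\<^bsub>P\<^esub> w k \<oplus>\<^bsub>P\<^esub> b \<otimes>\<^bsub>P\<^esub> v k \<noteq> \<zero>\<^bsub>P\<^esub>}"
    by (rule finite_subset[OF _ finite_UnI[OF v(3) w(3)]]) (use v w in auto)
  moreover have "fsum P \<Lambda> (\<lambda>k. (a \<otimes>\<^bsub>P\<^esub> w k \<oplus>\<^bsub>P\<^esub> b \<otimes>\<^bsub>P\<^esub> v k) \<otimes>\<^bsub>P\<^esub> br y (x k)) = br y (a \<otimes>\<^bsub>P\<^esub> b)"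
    if y: "y \<in> carrier P" for y
  proof -
    have "fsum P \<Lambda> (\<lambda>k. (a \<otimes>\<^bsub>P\<^esub> w k \<oplus>\<^bsub>P\<^esub> b \<otimes>\<^bsub>P\<^esub> v k) \<otimes>\<^bsub>P\<^esub> br y (x k)) =
        fsum P \<Lambda> (\<lambda>k. a \<otimes>\<^bsub>P\<^esub> (w k \<otimes>\<^bsub>P\<^esub> br y (x k)) \<oplus>\<^bsub>P\<^esub> b \<otimes>\<^bsub>P\<^esub> (v k \<otimes>\<^bsub>P\<^esub> br y (x k)))"
      using v w y by (intro fsum_cong am) (auto simp: br_closed l_distr m_assoc)
    also have "\<dots> = a \<otimes>\<^bsub>P\<^esub> br y b \<oplus>\<^bsub>P\<^esub> b \<otimes>\<^bsub>P\<^esub> br y a"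
      using v w y
      by (subst fsum_add[OF am])
        (auto simp: br_closed fsum_rdistr ring_axioms fin_br intro!: fin)
    finally show ?thesis
      using v w y by (simp add: br_leibniz br_closed M.a_comm m_comm)
  qed
  moreover have "fsum P \<Lambda> (\<lambda>k. br (a \<otimes>\<^bsub>P\<^esub> w k \<oplus>\<^bsub>P\<^esub> b \<otimes>\<^bsub>P\<^esub> v k) (x k)) = \<zero>\<^bsub>P\<^esub>"
  proof -
    have "fsum P \<Lambda> (\<lambda>k. br (a \<otimes>\<^bsub>P\<^esub> w k \<oplus>\<^bsub>P\<^esub> b \<otimes>\<^bsub>P\<^esub> v k) (x k)) =
        fsum P \<Lambda> (\<lambda>k. (a \<otimes>\<^bsub>P\<^esub> br (w k) (x k) \<oplus>\<^bsub>P\<^esub> w k \<otimes>\<^bsub>P\<^esub> br a (x k)) \<oplus>\<^bsub>P\<^esub>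
          (b \<otimes>\<^bsub>P\<^esub> br (v k) (x k) \<oplus>\<^bsub>P\<^esub> v k \<otimes>\<^bsub>P\<^esub> br b (x k)))"
      using v w by (intro fsum_cong am) (auto simp: br_closed br_add_left br_leibniz_left)
    also have "\<dots> = fsum P \<Lambda> (\<lambda>k. a \<otimes>\<^bsub>P\<^esub> br (w k) (x k) \<oplus>\<^bsub>P\<^esub> w k \<otimes>\<^bsub>P\<^esub> br a (x k)) \<oplus>\<^bsub>P\<^esub>
        fsum P \<Lambda> (\<lambda>k. b \<otimes>\<^bsub>P\<^esub> br (v k) (x k) \<oplus>\<^bsub>P\<^esub> v k \<otimes>\<^bsub>P\<^esub> br b (x k))"
    proof (rule fsum_add[OF am])
      show "finite {k \<in> \<Lambda>. a \<otimes>\<^bsub>P\<^esub> br (w k) (x k) \<oplus>\<^bsub>P\<^esub> w k \<otimes>\<^bsub>P\<^esub> br a (x k) \<noteq> \<zero>\<^bsub>P\<^esub>}"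
        by (rule finite_subset[OF _ w(3)]) (use v w in \<open>auto simp: br_zero_left br_closed\<close>)
      show "finite {k \<in> \<Lambda>. b \<otimes>\<^bsub>P\<^esub> br (v k) (x k) \<oplus>\<^bsub>P\<^esub> v k \<otimes>\<^bsub>P\<^esub> br b (x k) \<noteq> \<zero>\<^bsub>P\<^esub>}"
        by (rule finite_subset[OF _ v(3)]) (use v w in \<open>auto simp: br_zero_left br_closed\<close>)
    qed (use v w in \<open>auto simp: br_closed\<close>)
    also have "fsum P \<Lambda> (\<lambda>k. a \<otimes>\<^bsub>P\<^esub> br (w k) (x k) \<oplus>\<^bsub>P\<^esub> w k \<otimes>\<^bsub>P\<^esub> br a (x k)) = br a b"
      using v w
      by (subst fsum_add[OF am])
        (auto simp: br_closed fsum_rdistr ring_axioms fin_br finite_support_br intro!: fin)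
    also have "fsum P \<Lambda> (\<lambda>k. b \<otimes>\<^bsub>P\<^esub> br (v k) (x k) \<oplus>\<^bsub>P\<^esub> v k \<otimes>\<^bsub>P\<^esub> br b (x k)) = br b a"
      using v w
      by (subst fsum_add[OF am])
        (auto simp: br_closed fsum_rdistr ring_axioms fin_br finite_support_br intro!: fin)
    also have "br a b \<oplus>\<^bsub>P\<^esub> br b a = \<zero>\<^bsub>P\<^esub>"
      using v w br_skew[of a b] by (simp add: br_closed M.l_neg)
    finally show ?thesis .
  qed
  ultimately show ?thesis
    using v w by (simp add: is_gradient_def)
qed

text \<open>Scaling is multiplication by \<open>c 1\<close>, which has the zero vector as a
  gradient, so this is a case of the product rule.\<close>

lemma is_gradient_smult:
  assumes "is_gradient a v" "c \<in> carrier K"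
  shows "is_gradient (c \<odot>\<^bsub>P\<^esub> a) (\<lambda>k. c \<odot>\<^bsub>P\<^esub> v k)"
proof -
  note v = is_gradientD[OF assms(1)]
  have c: "is_gradient (c \<odot>\<^bsub>P\<^esub> \<one>\<^bsub>P\<^esub>) (\<lambda>k. \<zero>\<^bsub>P\<^esub>)"
    using is_gradient_zero assms(2) by (simp add: is_gradient_def br_zero_right br_one br_smult_right)
  have "(c \<odot>\<^bsub>P\<^esub> \<one>\<^bsub>P\<^esub>) \<otimes>\<^bsub>P\<^esub> b = c \<odot>\<^bsub>P\<^esub> b" if "b \<in> carrier P" for b
    using that assms(2) by (simp add: smult_assoc2)
  then show ?thesis
    using is_gradient_cong[OF is_gradient_mult[OF c assms(1)], of "\<lambda>k. c \<odot>\<^bsub>P\<^esub> v k"] v assms(2) by simp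
qed

text \<open>The vector is the usual derivative of \<open>1/a\<close>, with \<open>b = 1/a\<close>.
  For \<open>c = -b b\<close> the divergence of \<open>c v\<close> is \<open>c\<close> times that of
  \<open>v\<close> plus \<open>{c, a}\<close>. The bracket vanishes because
  \<open>{a, b} = -b b {a, a} = 0\<close>.\<close>

lemma is_gradient_inverse:
  assumes "is_gradient a v" and b: "b \<in> carrier P" and unit: "a \<otimes>\<^bsub>P\<^esub> b = \<one>\<^bsub>P\<^esub>"
  shows "is_gradient b (\<lambda>k. \<ominus>\<^bsub>P\<^esub> (b \<otimes>\<^bsub>P\<^esub> b) \<otimes>\<^bsub>P\<^esub> v k)"
proof -
  note v = is_gradientD[OF assms(1)]
  note am = M.abelian_monoid_axioms
  have unit': "b \<otimes>\<^bsub>P\<^esub> a = \<one>\<^bsub>P\<^esub>"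
    using unit v b by (simp add: m_comm)
  have br_inv: "\<ominus>\<^bsub>P\<^esub> (b \<otimes>\<^bsub>P\<^esub> b) \<otimes>\<^bsub>P\<^esub> br y a = br y b" if y: "y \<in> carrier P" for y
  proof -
    \<comment> \<open>The bracket with \<open>y\<close> is a derivation and kills
      \<open>a b = 1\<close>; multiplying by \<open>b\<close> isolates
      \<open>{y, b}\<close>.\<close>
    have "br y a \<otimes>\<^bsub>P\<^esub> b \<oplus>\<^bsub>P\<^esub> a \<otimes>\<^bsub>P\<^esub> br y b = \<zero>\<^bsub>P\<^esub>"
      using br_leibniz[OF y v(1) b] br_one[OF y] by (simp add: unit)
    then have "\<zero>\<^bsub>P\<^esub> = b \<otimes>\<^bsub>P\<^esub> (br y a \<otimes>\<^bsub>P\<^esub> b \<oplus>\<^bsub>P\<^esub> a \<otimes>\<^bsub>P\<^esub> br y b)"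
      using b by simp
    also have "\<dots> = (b \<otimes>\<^bsub>P\<^esub> b) \<otimes>\<^bsub>P\<^esub> br y a \<oplus>\<^bsub>P\<^esub> (b \<otimes>\<^bsub>P\<^esub> a) \<otimes>\<^bsub>P\<^esub> br y b"
      using y b v(1) br_closed[OF y v(1)] br_closed[OF y b] by algebra
    finally show ?thesis
      using y b v(1) by (simp add: unit' br_closed l_minus M.minus_equality M.a_comm)
  qed
  have fin: "finite {k \<in> \<Lambda>. c \<otimes>\<^bsub>P\<^esub> u k \<noteq> \<zero>\<^bsub>P\<^esub>}" if "finite {k \<in> \<Lambda>. u k \<noteq> \<zero>\<^bsub>P\<^esub>}" "c \<in> carrier P" for c u
    using that by (elim finite_subset[rotated]) auto
  have fin_br: "finite {k \<in> \<Lambda>. u k \<otimes>\<^bsub>P\<^esub> br y (x k) \<noteq> \<zero>\<^bsub>P\<^esub>}"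
    if "finite {k \<in> \<Lambda>. u k \<noteq> \<zero>\<^bsub>P\<^esub>}" "y \<in> carrier P" for y u
    using that by (intro finite_support_mult) (auto simp: br_closed)
  define c where "c = \<ominus>\<^bsub>P\<^esub> (b \<otimes>\<^bsub>P\<^esub> b)"
  have c: "c \<in> carrier P"
    using b by (simp add: c_def)
  have "fsum P \<Lambda> (\<lambda>k. (c \<otimes>\<^bsub>P\<^esub> v k) \<otimes>\<^bsub>P\<^esub> br y (x k)) = br y b" if y: "y \<in> carrier P" for y
  proof -
    have "fsum P \<Lambda> (\<lambda>k. (c \<otimes>\<^bsub>P\<^esub> v k) \<otimes>\<^bsub>P\<^esub> br y (x k)) = fsum P \<Lambda> (\<lambda>k. c \<otimes>\<^bsub>P\<^esub> (v k \<otimes>\<^bsub>P\<^esub> br y (x k)))"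
      using v y c by (intro fsum_cong am) (auto simp: br_closed m_assoc)
    also have "\<dots> = c \<otimes>\<^bsub>P\<^esub> br y a"
      using v y c by (simp add: br_closed fsum_rdistr ring_axioms fin_br)
    finally show ?thesis
      using br_inv[OF y] by (simp add: c_def)
  qed
  moreover have "fsum P \<Lambda> (\<lambda>k. br (c \<otimes>\<^bsub>P\<^esub> v k) (x k)) = \<zero>\<^bsub>P\<^esub>"
  proof -
    have "br c a = \<zero>\<^bsub>P\<^esub>"
    proof -
      have "br b a = \<zero>\<^bsub>P\<^esub>"
      proof -
        have "br a b = \<zero>\<^bsub>P\<^esub>"
          using br_inv[OF v(1), symmetric] b by (simp add: br_alternating v)
        then show ?thesis
          using br_skew[OF b v(1)] by simp
      qed
      then show ?thesis
        using b v(1) br_smult_left[of "\<ominus>\<^bsub>K\<^esub> \<one>\<^bsub>K\<^esub>" "b \<otimes>\<^bsub>P\<^esub> b" a]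
        by (simp add: c_def br_leibniz_left smult_l_minus)
    qed
    have "fsum P \<Lambda> (\<lambda>k. br (c \<otimes>\<^bsub>P\<^esub> v k) (x k)) =
        fsum P \<Lambda> (\<lambda>k. c \<otimes>\<^bsub>P\<^esub> br (v k) (x k) \<oplus>\<^bsub>P\<^esub> v k \<otimes>\<^bsub>P\<^esub> br c (x k))"
      using v c by (intro fsum_cong am) (auto simp: br_closed br_leibniz_left)
    \<comment> \<open>The first sum is \<open>c\<close> times the divergence of \<open>v\<close>;
      the second is the bracket clause for \<open>a\<close> with \<open>y = c\<close>.\<close>
    also have "\<dots> = br c a"
      using v c
      by (subst fsum_add[OF am])
        (auto simp: br_closed fsum_rdistr ring_axioms fin_br finite_support_br intro!: fin)
    finally show ?thesis
      using \<open>br c a = \<zero>\<^bsub>P\<^esub>\<close> by simp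
  qed
  ultimately show ?thesis
    unfolding c_def[symmetric] using v b c by (simp add: is_gradient_def fin)
qed

end

section \<open>Polynomial algebras\<close>

locale polynomials = K: cring K for K :: "'k ring" +
  fixes \<Lambda> :: "'x set"
begin

abbreviation "expo \<equiv> \<lparr>carrier = {m. set_mset m \<subseteq> \<Lambda>}, monoid.mult = (+), one = {#}\<rparr> :: 'x multiset monoid"
abbreviation "Po \<equiv> poly_alg K \<Lambda>"

lemma monoid_alg_expo: "monoid_alg K expo"
  by (intro monoid_alg.intro K.is_cring monoidI) (auto simp: add.assoc)

interpretation MA: monoid_alg K expo
  by (rule monoid_alg_expo)

lemma poly_alg_eq: "Po = MA.A"
  by (simp add: poly_alg_def)

lemma assoc_algebra_Po: "assoc_algebra K Po"
  unfolding poly_alg_eq by (rule MA.assoc_algebra_A)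

sublocale Po: assoc_algebra K Po
  by (rule assoc_algebra_Po)

lemma Po_comm: "\<lbrakk>p \<in> carrier Po; q \<in> carrier Po\<rbrakk> \<Longrightarrow> p \<otimes>\<^bsub>Po\<^esub> q = q \<otimes>\<^bsub>Po\<^esub> p"
  unfolding poly_alg_eq by (rule MA.mult_comm) (auto simp: add.commute)

lemma monom_closed: "set_mset m \<subseteq> \<Lambda> \<Longrightarrow> basis_elem K m \<in> carrier Po"
  unfolding poly_alg_eq by (rule MA.basis_closed) simp

lemma poly_var_closed: "i \<in> \<Lambda> \<Longrightarrow> poly_var K i \<in> carrier Po"
  unfolding poly_var_def by (rule monom_closed) simp

lemma monom_mult_var:
  assumes "set_mset m \<subseteq> \<Lambda>" "i \<in> \<Lambda>"
  shows "basis_elem K m \<otimes>\<^bsub>Po\<^esub> poly_var K i = basis_elem K (add_mset i m)"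
  using MA.basis_mult[of m "{#i#}"] assms by (simp add: poly_alg_eq poly_var_def)

lemma one_Po: "\<one>\<^bsub>Po\<^esub> = basis_elem K {#}"
  by (simp add: poly_alg_eq MA.one_eq)

text \<open>Products are built one variable at a time, so derivatives need only the product rule
  with a variable, \<open>pderiv_mult_var\<close>, instead of the general Leibniz rule for
  polynomials.\<close>

lemma poly_induct [consumes 1, case_names one var add smult]:
  assumes p: "p \<in> carrier Po" and one: "C \<one>\<^bsub>Po\<^esub>"
    and var: "\<And>q i. \<lbrakk>q \<in> carrier Po; i \<in> \<Lambda>; C q\<rbrakk> \<Longrightarrow> C (q \<otimes>\<^bsub>Po\<^esub> poly_var K i)"
    and add: "\<And>q r. \<lbrakk>q \<in> carrier Po; r \<in> carrier Po; C q; C r\<rbrakk> \<Longrightarrow> C (q \<oplus>\<^bsub>Po\<^esub> r)"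
    and smult: "\<And>c q. \<lbrakk>c \<in> carrier K; q \<in> carrier Po; C q\<rbrakk> \<Longrightarrow> C (c \<odot>\<^bsub>Po\<^esub> q)"
  shows "C p"
proof -
  have monom: "C (basis_elem K m)" if "set_mset m \<subseteq> \<Lambda>" for m
    using that
  proof (induction m)
    case empty
    then show ?case using one by (simp add: one_Po)
  next
    case (add i m)
    then show ?case using var[of "basis_elem K m" i] by (simp add: monom_mult_var monom_closed)
  qed
  have zero: "C \<zero>\<^bsub>Po\<^esub>"
    using smult[OF K.zero_closed Po.one_closed one] by simp
  have "p \<in> carrier MA.A \<Longrightarrow> C p"
  proof (induction p rule: MA.induct_basis)
    case zero
    then show ?case using \<open>C \<zero>\<^bsub>Po\<^esub>\<close> by (simp add: poly_alg_eq)
  next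
    case (add c m g)
    then show ?case
      using smult[of c "basis_elem K m"] monom[of m] monom_closed[of m]
      by (auto simp flip: poly_alg_eq intro: assms(4))
  qed
  then show ?thesis
    using p by (simp add: poly_alg_eq)
qed

lemma coeff_closed: "p \<in> carrier Po \<Longrightarrow> p m \<in> carrier K"
  unfolding poly_alg_eq by (rule MA.coeff_closed)

lemma add_apply: "(p \<oplus>\<^bsub>Po\<^esub> q) m = p m \<oplus>\<^bsub>K\<^esub> q m"
  and smult_apply: "(c \<odot>\<^bsub>Po\<^esub> p) m = c \<otimes>\<^bsub>K\<^esub> p m"
  and zero_apply: "\<zero>\<^bsub>Po\<^esub> m = \<zero>\<^bsub>K\<^esub>"
  by (simp_all add: poly_alg_eq MA.add_apply MA.smult_apply MA.zero_apply)

lemma mult_var_apply: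
  assumes "p \<in> carrier Po" and i: "i \<in> \<Lambda>"
  shows "(p \<otimes>\<^bsub>Po\<^esub> poly_var K i) n = (if i \<in># n then p (n - {#i#}) else \<zero>\<^bsub>K\<^esub>)"
proof -
  have "p \<in> carrier MA.A \<Longrightarrow> ?thesis"
  proof (induction p rule: MA.induct_basis)
    case zero
    have "\<zero>\<^bsub>Po\<^esub> \<otimes>\<^bsub>Po\<^esub> poly_var K i = \<zero>\<^bsub>Po\<^esub>"
      using i by (simp add: poly_var_closed)
    then show ?case
      unfolding poly_alg_eq[symmetric] by (simp only:) (simp add: zero_apply)
  next
    case (add c m g)
    then have m: "set_mset m \<subseteq> \<Lambda>" and g: "g \<in> carrier Po" and c: "c \<in> carrier K"
      by (simp_all add: poly_alg_eq)
    have base: "(basis_elem K m \<otimes>\<^bsub>Po\<^esub> poly_var K i) n =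
        (if i \<in># n then basis_elem K m (n - {#i#}) else \<zero>\<^bsub>K\<^esub>)"
      unfolding monom_mult_var[OF m i] by (auto simp: basis_elem_def)
    have eq: "(c \<odot>\<^bsub>Po\<^esub> basis_elem K m \<oplus>\<^bsub>Po\<^esub> g) \<otimes>\<^bsub>Po\<^esub> poly_var K i =
        c \<odot>\<^bsub>Po\<^esub> (basis_elem K m \<otimes>\<^bsub>Po\<^esub> poly_var K i) \<oplus>\<^bsub>Po\<^esub> g \<otimes>\<^bsub>Po\<^esub> poly_var K i"
      using m g c i by (simp add: Po.l_distr monom_closed poly_var_closed Po.smult_mult_left)
    show ?case
      unfolding poly_alg_eq[symmetric] unfolding eq
      unfolding add_apply smult_apply base add.IH[unfolded poly_alg_eq[symmetric]]
      using c by auto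
  qed
  then show ?thesis
    using assms by (simp add: poly_alg_eq)
qed

lemma pderiv_closed:
  assumes p: "p \<in> carrier Po"
  shows "poly_pderiv K k p \<in> carrier Po"
proof -
  have "finite {m. [Suc (count m k)] \<cdot>\<^bsub>K\<^esub> p (add_mset k m) \<noteq> \<zero>\<^bsub>K\<^esub>}"
  proof (rule finite_subset)
    show "{m. [Suc (count m k)] \<cdot>\<^bsub>K\<^esub> p (add_mset k m) \<noteq> \<zero>\<^bsub>K\<^esub>} \<subseteq> (\<lambda>m. m - {#k#}) ` {m. p m \<noteq> \<zero>\<^bsub>K\<^esub>}"
    proof
      fix m assume "m \<in> {m. [Suc (count m k)] \<cdot>\<^bsub>K\<^esub> p (add_mset k m) \<noteq> \<zero>\<^bsub>K\<^esub>}"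
      then have "p (add_mset k m) \<noteq> \<zero>\<^bsub>K\<^esub>"
        using K.add.nat_pow_one by auto
      then show "m \<in> (\<lambda>m. m - {#k#}) ` {m. p m \<noteq> \<zero>\<^bsub>K\<^esub>}"
        by (intro image_eqI[of _ _ "add_mset k m"]) auto
    qed
    show "finite ((\<lambda>m. m - {#k#}) ` {m. p m \<noteq> \<zero>\<^bsub>K\<^esub>})"
      using p by (intro finite_imageI) (simp add: poly_alg_eq MA.mem_carrier_iff)
  qed
  then show ?thesis
    using p K.add.nat_pow_one unfolding poly_alg_eq MA.mem_carrier_iff poly_pderiv_def
    by (auto intro!: K.add.nat_pow_closed)
qed

lemma pderiv_one: "poly_pderiv K k \<one>\<^bsub>Po\<^esub> = \<zero>\<^bsub>Po\<^esub>"
  using K.add.nat_pow_one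
  by (auto simp: fun_eq_iff one_Po poly_pderiv_def basis_elem_def zero_apply)

lemma pderiv_add:
  "\<lbrakk>p \<in> carrier Po; q \<in> carrier Po\<rbrakk> \<Longrightarrow>
    poly_pderiv K k (p \<oplus>\<^bsub>Po\<^esub> q) = poly_pderiv K k p \<oplus>\<^bsub>Po\<^esub> poly_pderiv K k q"
  using K.add.nat_pow_distrib
  by (auto simp: fun_eq_iff add_apply poly_pderiv_def coeff_closed simp del: K.add.nat_pow_Suc)

lemma pderiv_smult:
  "\<lbrakk>c \<in> carrier K; p \<in> carrier Po\<rbrakk> \<Longrightarrow> poly_pderiv K k (c \<odot>\<^bsub>Po\<^esub> p) = c \<odot>\<^bsub>Po\<^esub> poly_pderiv K k p"
  by (auto simp: fun_eq_iff smult_apply poly_pderiv_def coeff_closed K.add_pow_rdistr simp del: K.add.nat_pow_Suc)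

text \<open>For \<open>k = i\<close> the coefficients at \<open>n\<close> say that
  \<open>count n i + 1\<close> times \<open>p n\<close> is \<open>count n i\<close> times
  \<open>p n\<close> plus \<open>p n\<close>. The first summand comes from the shifted derivative
  and is zero when \<open>i\<close> does not occur in \<open>n\<close>. For
  \<open>k \<noteq> i\<close>, shifting by \<open>i\<close> leaves the exponent of \<open>k\<close>
  unchanged.\<close>

lemma pderiv_mult_var:
  assumes p: "p \<in> carrier Po" and i: "i \<in> \<Lambda>"
  shows "poly_pderiv K k (p \<otimes>\<^bsub>Po\<^esub> poly_var K i) =
    poly_pderiv K k p \<otimes>\<^bsub>Po\<^esub> poly_var K i \<oplus>\<^bsub>Po\<^esub> (if k = i then p else \<zero>\<^bsub>Po\<^esub>)"
proof
  fix n
  have zero: "\<zero>\<^bsub>Po\<^esub> m = \<zero>\<^bsub>K\<^esub>" for m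
    by (simp add: poly_alg_eq MA.zero_apply)
  have Suc: "[Suc a] \<cdot>\<^bsub>K\<^esub> c = [a] \<cdot>\<^bsub>K\<^esub> c \<oplus>\<^bsub>K\<^esub> c" for a :: nat and c
    using K.add.nat_pow_Suc by simp
  have null: "[a] \<cdot>\<^bsub>K\<^esub> \<zero>\<^bsub>K\<^esub> = \<zero>\<^bsub>K\<^esub>" for a :: nat
    using K.add.nat_pow_one by simp
  show "poly_pderiv K k (p \<otimes>\<^bsub>Po\<^esub> poly_var K i) n =
    (poly_pderiv K k p \<otimes>\<^bsub>Po\<^esub> poly_var K i \<oplus>\<^bsub>Po\<^esub> (if k = i then p else \<zero>\<^bsub>Po\<^esub>)) n"
  proof (cases "k = i")
    case True
    show ?thesis
    proof (cases "i \<in># n")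
      case True
      then obtain n' where "n = add_mset i n'"
        by (auto dest: multi_member_split)
      then show ?thesis
        using \<open>k = i\<close> p i
        by (simp add: add_apply mult_var_apply pderiv_closed) (simp add: poly_pderiv_def mult_var_apply)
    next
      case False
      then have "count n i = 0"
        by (simp add: count_eq_zero_iff)
      then show ?thesis
        using False \<open>k = i\<close> p i K.add.nat_pow_0
        by (simp add: add_apply mult_var_apply pderiv_closed) (simp add: poly_pderiv_def mult_var_apply Suc coeff_closed)
    qed
  next
    case False
    then show ?thesis
      using p i coeff_closed[OF pderiv_closed[OF p]]
      by (auto simp: add_apply mult_var_apply pderiv_closed zero)
        (auto simp: poly_pderiv_def mult_var_apply null add_mset_remove_trivial_If)
  qed
qed

end

section \<open>Localization at regular elements\<close>

locale regular_localization = assoc_algebra K R for K :: "'k ring" and R :: "('k, 'a) module" (structure) +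
  fixes S
  assumes comm: "\<lbrakk>a \<in> carrier R; b \<in> carrier R\<rbrakk> \<Longrightarrow> a \<otimes>\<^bsub>R\<^esub> b = b \<otimes>\<^bsub>R\<^esub> a"
    and S: "submonoid S R" and regular: "s \<in> S \<Longrightarrow> regular_elem R s"
begin

abbreviation "fr \<equiv> loc_frac R S"
abbreviation "L \<equiv> localization R S"

sublocale S: submonoid S R
  by (rule S)

lemma cring_R: "cring R"
  by (intro cringI comm_monoidI abelian_group_axioms) (auto simp: m_assoc l_distr intro: comm)

interpretation C: cring R
  by (rule cring_R)

lemma S_closed [simp]: "s \<in> S \<Longrightarrow> s \<in> carrier R"
  using S.subset by auto

lemma regular_cancel:
  assumes "s \<in> S" "a \<in> carrier R" "b \<in> carrier R" "s \<otimes>\<^bsub>R\<^esub> a = s \<otimes>\<^bsub>R\<^esub> b"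
  shows "a = b"
proof -
  have "s \<otimes>\<^bsub>R\<^esub> (a \<ominus>\<^bsub>R\<^esub> b) = \<zero>\<^bsub>R\<^esub>"
    using assms by (simp add: a_minus_def r_distr r_minus M.r_neg)
  then show ?thesis
    using assms regular[of s] by (auto simp: regular_elem_def)
qed

text \<open>The extra factor \<open>u\<close> in the definition of a fraction can be cancelled
  because elements of \<open>S\<close> are regular; equality of fractions becomes plain cross
  multiplication.\<close>

lemma mem_frac:
  assumes "a \<in> carrier R" "s \<in> S"
  shows "(b, t) \<in> fr a s \<longleftrightarrow> b \<in> carrier R \<and> t \<in> S \<and> a \<otimes>\<^bsub>R\<^esub> t = b \<otimes>\<^bsub>R\<^esub> s"
proof -
  have "(\<exists>u\<in>S. u \<otimes>\<^bsub>R\<^esub> (a \<otimes>\<^bsub>R\<^esub> t \<ominus>\<^bsub>R\<^esub> b \<otimes>\<^bsub>R\<^esub> s) = \<zero>\<^bsub>R\<^esub>) \<longleftrightarrow> a \<otimes>\<^bsub>R\<^esub> t = b \<otimes>\<^bsub>R\<^esub> s"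
    if "b \<in> carrier R" "t \<in> S"
  proof
    assume "\<exists>u\<in>S. u \<otimes>\<^bsub>R\<^esub> (a \<otimes>\<^bsub>R\<^esub> t \<ominus>\<^bsub>R\<^esub> b \<otimes>\<^bsub>R\<^esub> s) = \<zero>\<^bsub>R\<^esub>"
    then obtain u where u: "u \<in> S" "u \<otimes>\<^bsub>R\<^esub> (a \<otimes>\<^bsub>R\<^esub> t \<ominus>\<^bsub>R\<^esub> b \<otimes>\<^bsub>R\<^esub> s) = \<zero>\<^bsub>R\<^esub>"
      by (elim bexE)
    have "a \<otimes>\<^bsub>R\<^esub> t \<ominus>\<^bsub>R\<^esub> b \<otimes>\<^bsub>R\<^esub> s = \<zero>\<^bsub>R\<^esub>"
      using regular[OF u(1)] u(2) that assms unfolding regular_elem_def by simp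
    then show "a \<otimes>\<^bsub>R\<^esub> t = b \<otimes>\<^bsub>R\<^esub> s"
      using that assms by simp
  next
    assume "a \<otimes>\<^bsub>R\<^esub> t = b \<otimes>\<^bsub>R\<^esub> s"
    then show "\<exists>u\<in>S. u \<otimes>\<^bsub>R\<^esub> (a \<otimes>\<^bsub>R\<^esub> t \<ominus>\<^bsub>R\<^esub> b \<otimes>\<^bsub>R\<^esub> s) = \<zero>\<^bsub>R\<^esub>"
      using that assms by (intro bexI[of _ "\<one>\<^bsub>R\<^esub>"]) (auto simp: a_minus_def M.r_neg)
  qed
  then show ?thesis
    by (auto simp: loc_frac_def)
qed

lemma frac_eqI:
  assumes "a \<in> carrier R" "s \<in> S" "b \<in> carrier R" "t \<in> S" and eq: "a \<otimes>\<^bsub>R\<^esub> t = b \<otimes>\<^bsub>R\<^esub> s"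
  shows "fr a s = fr b t"
proof -
  \<comment> \<open>Transitivity of cross multiplication: the equation is proved after multiplying
    by \<open>s\<close>, which is then cancelled by regularity. It is used below in both
    directions.\<close>
  have *: "b \<otimes>\<^bsub>R\<^esub> v = c \<otimes>\<^bsub>R\<^esub> t"
    if "a \<in> carrier R" "s \<in> S" "b \<in> carrier R" "t \<in> S" "a \<otimes>\<^bsub>R\<^esub> t = b \<otimes>\<^bsub>R\<^esub> s"
      and "c \<in> carrier R" "v \<in> S" "a \<otimes>\<^bsub>R\<^esub> v = c \<otimes>\<^bsub>R\<^esub> s" for a b c s t v
  proof (rule regular_cancel[of s])
    have "s \<otimes>\<^bsub>R\<^esub> (b \<otimes>\<^bsub>R\<^esub> v) = (b \<otimes>\<^bsub>R\<^esub> s) \<otimes>\<^bsub>R\<^esub> v"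
      using that(1-4,6,7) by (simp add: C.m_ac)
    also have "\<dots> = (a \<otimes>\<^bsub>R\<^esub> v) \<otimes>\<^bsub>R\<^esub> t"
      unfolding that(5)[symmetric] using that(1-4,6,7) by (simp add: C.m_ac)
    also have "\<dots> = s \<otimes>\<^bsub>R\<^esub> (c \<otimes>\<^bsub>R\<^esub> t)"
      unfolding that(8) using that(1-4,6,7) by (simp add: C.m_ac)
    finally show "s \<otimes>\<^bsub>R\<^esub> (b \<otimes>\<^bsub>R\<^esub> v) = s \<otimes>\<^bsub>R\<^esub> (c \<otimes>\<^bsub>R\<^esub> t)" .
  qed (use that in auto)
  have "a \<otimes>\<^bsub>R\<^esub> v = c \<otimes>\<^bsub>R\<^esub> s \<longleftrightarrow> b \<otimes>\<^bsub>R\<^esub> v = c \<otimes>\<^bsub>R\<^esub> t" if "c \<in> carrier R" "v \<in> S" for c v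
    using *[OF assms that] *[OF assms(3,4,1,2) eq[symmetric] that] by (rule iffI)
  then show ?thesis
    using assms by (auto simp: set_eq_iff mem_frac)
qed

lemma frac_mult:
  assumes "a \<in> carrier R" "s \<in> S" "b \<in> carrier R" "t \<in> S"
  shows "fr a s \<otimes>\<^bsub>L\<^esub> fr b t = fr (a \<otimes>\<^bsub>R\<^esub> b) (s \<otimes>\<^bsub>R\<^esub> t)"
proof -
  \<comment> \<open>All representatives give the same fraction, so the nested unions defining the
    product run over constant families.\<close>
  have eq: "fr (a' \<otimes>\<^bsub>R\<^esub> b') (s' \<otimes>\<^bsub>R\<^esub> t') = fr (a \<otimes>\<^bsub>R\<^esub> b) (s \<otimes>\<^bsub>R\<^esub> t)"
    if "(a', s') \<in> fr a s" "(b', t') \<in> fr b t" for a' s' b' t'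
  proof (rule frac_eqI)
    have *: "a' \<in> carrier R" "s' \<in> S" "b' \<in> carrier R" "t' \<in> S"
      "a \<otimes>\<^bsub>R\<^esub> s' = a' \<otimes>\<^bsub>R\<^esub> s" "b \<otimes>\<^bsub>R\<^esub> t' = b' \<otimes>\<^bsub>R\<^esub> t"
      using that assms by (auto simp: mem_frac)
    have "a' \<otimes>\<^bsub>R\<^esub> b' \<otimes>\<^bsub>R\<^esub> (s \<otimes>\<^bsub>R\<^esub> t) = (a' \<otimes>\<^bsub>R\<^esub> s) \<otimes>\<^bsub>R\<^esub> (b' \<otimes>\<^bsub>R\<^esub> t)"
      using assms *(1-4) by (simp add: C.m_ac)
    also have "\<dots> = a \<otimes>\<^bsub>R\<^esub> b \<otimes>\<^bsub>R\<^esub> (s' \<otimes>\<^bsub>R\<^esub> t')"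
      unfolding *(5,6)[symmetric] using assms *(1-4) by (simp add: C.m_ac)
    finally show "a' \<otimes>\<^bsub>R\<^esub> b' \<otimes>\<^bsub>R\<^esub> (s \<otimes>\<^bsub>R\<^esub> t) = a \<otimes>\<^bsub>R\<^esub> b \<otimes>\<^bsub>R\<^esub> (s' \<otimes>\<^bsub>R\<^esub> t')" .
  qed (use that assms in \<open>auto simp: mem_frac\<close>)
  have "(a, s) \<in> fr a s" "(b, t) \<in> fr b t"
    using assms by (auto simp: mem_frac)
  then show ?thesis
    unfolding localization_def monoid.simps
    by (intro UN_constant_eq[of "(a, s)"] ballI, simp)
      (clarsimp, intro UN_constant_eq[of "(b, t)"] ballI, simp, clarsimp, rule eq)
qed

lemma frac_add:
  assumes "a \<in> carrier R" "s \<in> S" "b \<in> carrier R" "t \<in> S"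
  shows "fr a s \<oplus>\<^bsub>L\<^esub> fr b t = fr (a \<otimes>\<^bsub>R\<^esub> t \<oplus>\<^bsub>R\<^esub> b \<otimes>\<^bsub>R\<^esub> s) (s \<otimes>\<^bsub>R\<^esub> t)"
proof -
  have eq: "fr (a' \<otimes>\<^bsub>R\<^esub> t' \<oplus>\<^bsub>R\<^esub> b' \<otimes>\<^bsub>R\<^esub> s') (s' \<otimes>\<^bsub>R\<^esub> t') = fr (a \<otimes>\<^bsub>R\<^esub> t \<oplus>\<^bsub>R\<^esub> b \<otimes>\<^bsub>R\<^esub> s) (s \<otimes>\<^bsub>R\<^esub> t)"
    if "(a', s') \<in> fr a s" "(b', t') \<in> fr b t" for a' s' b' t'
  proof (rule frac_eqI)
    have *: "a' \<in> carrier R" "s' \<in> S" "b' \<in> carrier R" "t' \<in> S"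
      "a \<otimes>\<^bsub>R\<^esub> s' = a' \<otimes>\<^bsub>R\<^esub> s" "b \<otimes>\<^bsub>R\<^esub> t' = b' \<otimes>\<^bsub>R\<^esub> t"
      using that assms by (auto simp: mem_frac)
    have "(a' \<otimes>\<^bsub>R\<^esub> t' \<oplus>\<^bsub>R\<^esub> b' \<otimes>\<^bsub>R\<^esub> s') \<otimes>\<^bsub>R\<^esub> (s \<otimes>\<^bsub>R\<^esub> t) =
        (a' \<otimes>\<^bsub>R\<^esub> s) \<otimes>\<^bsub>R\<^esub> (t' \<otimes>\<^bsub>R\<^esub> t) \<oplus>\<^bsub>R\<^esub> (b' \<otimes>\<^bsub>R\<^esub> t) \<otimes>\<^bsub>R\<^esub> (s' \<otimes>\<^bsub>R\<^esub> s)"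
      using assms *(1-4) by (simp add: C.m_ac l_distr r_distr)
    also have "\<dots> = (a \<otimes>\<^bsub>R\<^esub> t \<oplus>\<^bsub>R\<^esub> b \<otimes>\<^bsub>R\<^esub> s) \<otimes>\<^bsub>R\<^esub> (s' \<otimes>\<^bsub>R\<^esub> t')"
      unfolding *(5,6)[symmetric] using assms *(1-4) by (simp add: C.m_ac l_distr r_distr)
    finally show "(a' \<otimes>\<^bsub>R\<^esub> t' \<oplus>\<^bsub>R\<^esub> b' \<otimes>\<^bsub>R\<^esub> s') \<otimes>\<^bsub>R\<^esub> (s \<otimes>\<^bsub>R\<^esub> t) =
        (a \<otimes>\<^bsub>R\<^esub> t \<oplus>\<^bsub>R\<^esub> b \<otimes>\<^bsub>R\<^esub> s) \<otimes>\<^bsub>R\<^esub> (s' \<otimes>\<^bsub>R\<^esub> t')" .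
  qed (use that assms in \<open>auto simp: mem_frac\<close>)
  have "(a, s) \<in> fr a s" "(b, t) \<in> fr b t"
    using assms by (auto simp: mem_frac)
  then show ?thesis
    unfolding localization_def ring.simps
    by (intro UN_constant_eq[of "(a, s)"] ballI, simp)
      (clarsimp, intro UN_constant_eq[of "(b, t)"] ballI, simp, clarsimp, rule eq)
qed

lemma frac_smult:
  assumes c: "c \<in> carrier K" and "a \<in> carrier R" "s \<in> S"
  shows "c \<odot>\<^bsub>L\<^esub> fr a s = fr (c \<odot>\<^bsub>R\<^esub> a) s"
proof -
  have eq: "fr (c \<odot>\<^bsub>R\<^esub> a') s' = fr (c \<odot>\<^bsub>R\<^esub> a) s" if "(a', s') \<in> fr a s" for a' s'
    by (rule frac_eqI) (use that assms in \<open>auto simp: mem_frac smult_mult_left\<close>)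
  have "(a, s) \<in> fr a s"
    using assms by (auto simp: mem_frac)
  then show ?thesis
    unfolding localization_def module.simps
    by (intro UN_constant_eq[of "(a, s)"] ballI, simp) (clarsimp, rule eq)
qed

lemma frac_closed: "\<lbrakk>a \<in> carrier R; s \<in> S\<rbrakk> \<Longrightarrow> fr a s \<in> carrier L"
  by (auto simp: localization_def)

lemma one_L: "\<one>\<^bsub>L\<^esub> = fr \<one>\<^bsub>R\<^esub> \<one>\<^bsub>R\<^esub>"
  by (simp add: localization_def)

lemma frac_one_hom: "(\<lambda>a. fr a \<one>\<^bsub>R\<^esub>) \<in> alg_hom K R L"
  by (rule alg_homI) (auto simp: frac_closed frac_mult frac_add frac_smult one_L)

text \<open>Reduces fractions to images of \<open>R\<close> and inverses of units, so that
  properties closed under products and inverses extend to the localization.\<close>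

lemma frac_eq_mult_inverse:
  assumes "a \<in> carrier R" "s \<in> S"
  shows "fr a s = fr a \<one>\<^bsub>R\<^esub> \<otimes>\<^bsub>L\<^esub> fr \<one>\<^bsub>R\<^esub> s" and "fr s \<one>\<^bsub>R\<^esub> \<otimes>\<^bsub>L\<^esub> fr \<one>\<^bsub>R\<^esub> s = \<one>\<^bsub>L\<^esub>"
proof -
  show "fr a s = fr a \<one>\<^bsub>R\<^esub> \<otimes>\<^bsub>L\<^esub> fr \<one>\<^bsub>R\<^esub> s"
    using assms by (simp add: frac_mult)
  have "fr s \<one>\<^bsub>R\<^esub> \<otimes>\<^bsub>L\<^esub> fr \<one>\<^bsub>R\<^esub> s = fr \<one>\<^bsub>R\<^esub> \<one>\<^bsub>R\<^esub>"
    using assms by (simp add: frac_mult) (rule frac_eqI, auto)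
  then show "fr s \<one>\<^bsub>R\<^esub> \<otimes>\<^bsub>L\<^esub> fr \<one>\<^bsub>R\<^esub> s = \<one>\<^bsub>L\<^esub>"
    by (simp add: one_L)
qed

end

section \<open>Poisson structures on localized coordinate algebras\<close>

locale localized_coords = polynomials K \<Lambda> for K :: "'k ring" and \<Lambda> :: "'x set" +
  fixes \<Gamma> :: "'s set" and f :: "'s \<Rightarrow> ('k, 'x) poly_fun" and S :: "('k, 'x) poly_fun set set"
  assumes f: "f \<in> \<Gamma> \<rightarrow> carrier (poly_alg K \<Lambda>)"
    and submonoid_S: "submonoid S (coord_alg K \<Lambda> \<Gamma> f)"
    and regular_S: "\<forall>s\<in>S. regular_elem (coord_alg K \<Lambda> \<Gamma> f) s"
begin

abbreviation "Co \<equiv> coord_alg K \<Lambda> \<Gamma> f"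
abbreviation "cls \<equiv> poly_class K \<Lambda> \<Gamma> f"
abbreviation "frc \<equiv> frac_image K \<Lambda> \<Gamma> f S"
abbreviation "emb p \<equiv> frc p \<one>\<^bsub>Po\<^esub>"

sublocale I: quot_algebra K Po "rel_ideal K \<Lambda> \<Gamma> f"
  unfolding rel_ideal_def using f by (intro quot_algebra_genideal assoc_algebra_Po) auto

lemma assoc_algebra_Co: "assoc_algebra K Co"
  unfolding coord_alg_def by (rule I.assoc_algebra_quot)

lemma cls_hom: "cls \<in> alg_hom K Po Co"
  using I.coset_hom by (simp add: coord_alg_def poly_class_def[abs_def])

lemma carrier_Co: "carrier Co = cls ` carrier Po"
  using I.carrier_quot by (simp add: coord_alg_def poly_class_def[abs_def])

sublocale loc: regular_localization K Co S
proof (intro regular_localization.intro regular_localization_axioms.intro assoc_algebra_Co submonoid_S)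
  show "a \<otimes>\<^bsub>Co\<^esub> b = b \<otimes>\<^bsub>Co\<^esub> a" if "a \<in> carrier Co" "b \<in> carrier Co" for a b
    using that by (auto simp: carrier_Co Po_comm simp flip: alg_hom_mult[OF cls_hom])
  show "regular_elem Co s" if "s \<in> S" for s
    using regular_S that by simp
qed

lemma emb_eq: "emb p = loc.fr (cls p) \<one>\<^bsub>Co\<^esub>"
  by (simp add: frac_image_def alg_hom_one[OF cls_hom])

lemma emb_hom: "emb \<in> alg_hom K Po loc.L"
  unfolding emb_eq by (rule alg_hom_compose[OF cls_hom loc.frac_one_hom])

lemma carrier_L:
  assumes "g \<in> carrier loc.L"
  obtains p q where "p \<in> carrier Po" "q \<in> carrier Po" "cls q \<in> S" "g = frc p q"
proof -
  obtain a s where as: "a \<in> carrier Co" "s \<in> S" "g = loc.fr a s"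
    using assms by (auto simp: localization_def)
  moreover obtain p where "p \<in> carrier Po" "a = cls p"
    using as(1) by (auto simp: carrier_Co)
  moreover obtain q where "q \<in> carrier Po" "s = cls q"
    using loc.S_closed[OF as(2)] by (auto simp: carrier_Co)
  ultimately show thesis
    using that by (simp add: frac_image_def)
qed

lemma
  assumes p: "p \<in> carrier Po" and q: "q \<in> carrier Po" "cls q \<in> S"
  shows frac_eq_mult_inv: "frc p q = emb p \<otimes>\<^bsub>loc.L\<^esub> frc \<one>\<^bsub>Po\<^esub> q"
    and emb_mult_inv: "emb q \<otimes>\<^bsub>loc.L\<^esub> frc \<one>\<^bsub>Po\<^esub> q = \<one>\<^bsub>loc.L\<^esub>"
    and frac_closed: "frc p q \<in> carrier loc.L"
  using loc.frac_eq_mult_inverse[OF alg_hom_closed[OF cls_hom p] q(2)]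
    loc.frac_closed[OF alg_hom_closed[OF cls_hom p] q(2)]
  by (simp_all add: frac_image_def alg_hom_one[OF cls_hom])

end

text \<open>The bracket is given on the localization only; brackets of variables may be genuine
  fractions. Gradients therefore live in \<open>P\<close>, and polynomials enter through
  \<open>emb\<close>.\<close>

locale localized_poisson = localized_coords K \<Lambda> \<Gamma> f S + poisson_algebra K "localization (coord_alg K \<Lambda> \<Gamma> f) S" br
  for K :: "'k ring" and \<Lambda> :: "'x set" and \<Gamma> :: "'s set" and f S br
begin

abbreviation "P \<equiv> localization (coord_alg K \<Lambda> \<Gamma> f) S"
abbreviation "x \<equiv> var_image K \<Lambda> \<Gamma> f S"

lemma x_closed: "i \<in> \<Lambda> \<Longrightarrow> x i \<in> carrier P"
  unfolding var_image_def by (intro alg_hom_closed[OF emb_hom] poly_var_closed)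

sublocale coords: poisson_coords K P br \<Lambda> x
  by unfold_locales (rule x_closed)

text \<open>The induction is over the polynomial and not over its image, since differentiation does
  not respect the kernel of \<open>emb\<close>. For \<open>p = f s\<close> this yields the
  divergence statement about the relators.\<close>

lemma is_gradient_emb: "p \<in> carrier Po \<Longrightarrow> coords.is_gradient (emb p) (\<lambda>k. emb (poly_pderiv K k p))"
proof (induction p rule: poly_induct)
  case one
  show ?case
    using coords.is_gradient_one
    by (simp add: alg_hom_one[OF emb_hom] pderiv_one alg_hom_zero[OF emb_hom Po.ring_A ring_M])
next
  case (var q i)
  have "coords.is_gradient (emb q \<otimes>\<^bsub>P\<^esub> x i)
      (\<lambda>k. emb q \<otimes>\<^bsub>P\<^esub> (if k = i then \<one>\<^bsub>P\<^esub> else \<zero>\<^bsub>P\<^esub>) \<oplus>\<^bsub>P\<^esub> x i \<otimes>\<^bsub>P\<^esub> emb (poly_pderiv K k q))"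
    using var by (intro coords.is_gradient_mult coords.is_gradient_var)
  then have "coords.is_gradient (emb q \<otimes>\<^bsub>P\<^esub> x i) (\<lambda>k. emb (poly_pderiv K k (q \<otimes>\<^bsub>Po\<^esub> poly_var K i)))"
    using var alg_hom_closed[OF emb_hom]
    by (elim coords.is_gradient_cong)
      (auto simp: pderiv_mult_var alg_hom_add[OF emb_hom] alg_hom_mult[OF emb_hom] pderiv_closed poly_var_closed
        var_image_def alg_hom_zero[OF emb_hom Po.ring_A ring_M] M.a_comm m_comm)
  moreover have "emb (q \<otimes>\<^bsub>Po\<^esub> poly_var K i) = emb q \<otimes>\<^bsub>P\<^esub> x i"
    using var by (simp add: alg_hom_mult[OF emb_hom] poly_var_closed var_image_def)
  ultimately show ?case
    by (simp only:)
next
  case (add q r)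
  then show ?case
    using coords.is_gradient_add[OF add.IH] by (simp add: alg_hom_add[OF emb_hom] pderiv_add pderiv_closed)
next
  case (smult c q)
  then show ?case
    using coords.is_gradient_smult[OF smult.IH smult.hyps(1)] by (simp add: alg_hom_smult[OF emb_hom] pderiv_smult pderiv_closed)
qed

text \<open>The quotient rule is the product rule for \<open>p\<close> times the inverse of
  \<open>q\<close>, brought to the common denominator \<open>q q\<close>.\<close>

lemma is_gradient_frac:
  assumes p: "p \<in> carrier Po" and q: "q \<in> carrier Po" "cls q \<in> S"
  shows "coords.is_gradient (frc p q) (\<lambda>k. frac_pderiv K \<Lambda> \<Gamma> f S k (p, q))"
proof -
  let ?b = "frc \<one>\<^bsub>Po\<^esub> q"
  have b: "?b \<in> carrier P"
    using q by (intro frac_closed) auto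
  have unit: "emb q \<otimes>\<^bsub>P\<^esub> ?b = \<one>\<^bsub>P\<^esub>"
    using q by (intro emb_mult_inv[OF Po.one_closed])
  note [simp] = alg_hom_closed[OF emb_hom] pderiv_closed
  have "frac_pderiv K \<Lambda> \<Gamma> f S k (p, q) =
      emb p \<otimes>\<^bsub>P\<^esub> (\<ominus>\<^bsub>P\<^esub> (?b \<otimes>\<^bsub>P\<^esub> ?b) \<otimes>\<^bsub>P\<^esub> emb (poly_pderiv K k q)) \<oplus>\<^bsub>P\<^esub> ?b \<otimes>\<^bsub>P\<^esub> emb (poly_pderiv K k p)" for k
  proof -
    let ?p' = "poly_pderiv K k p" and ?q' = "poly_pderiv K k q"
    have qq: "q \<otimes>\<^bsub>Po\<^esub> q \<in> carrier Po" "cls (q \<otimes>\<^bsub>Po\<^esub> q) \<in> S"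
      using q by (simp_all add: alg_hom_mult[OF cls_hom])
    have sq: "frc \<one>\<^bsub>Po\<^esub> (q \<otimes>\<^bsub>Po\<^esub> q) = ?b \<otimes>\<^bsub>P\<^esub> ?b"
      using q by (simp add: frac_image_def alg_hom_mult[OF cls_hom] alg_hom_one[OF cls_hom] loc.frac_mult)
    have "frac_pderiv K \<Lambda> \<Gamma> f S k (p, q) = frc (?p' \<otimes>\<^bsub>Po\<^esub> q \<ominus>\<^bsub>Po\<^esub> p \<otimes>\<^bsub>Po\<^esub> ?q') (q \<otimes>\<^bsub>Po\<^esub> q)"
      by (simp add: frac_pderiv_def Let_def)
    also have "\<dots> = emb (?p' \<otimes>\<^bsub>Po\<^esub> q \<ominus>\<^bsub>Po\<^esub> p \<otimes>\<^bsub>Po\<^esub> ?q') \<otimes>\<^bsub>P\<^esub> (?b \<otimes>\<^bsub>P\<^esub> ?b)"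
      using p q qq by (subst frac_eq_mult_inv) (auto simp: sq)
    also have "\<dots> = (emb ?p' \<otimes>\<^bsub>P\<^esub> emb q \<ominus>\<^bsub>P\<^esub> emb p \<otimes>\<^bsub>P\<^esub> emb ?q') \<otimes>\<^bsub>P\<^esub> (?b \<otimes>\<^bsub>P\<^esub> ?b)"
      using p q by (simp add: alg_hom_minus[OF emb_hom Po.ring_A ring_M] alg_hom_mult[OF emb_hom])
    \<comment> \<open>The product of \<open>emb q\<close> and its inverse is left standing, which
      makes this an identity valid in every commutative ring; it is replaced by \<open>1\<close>
      only afterwards.\<close>
    also have "\<dots> = emb p \<otimes>\<^bsub>P\<^esub> (\<ominus>\<^bsub>P\<^esub> (?b \<otimes>\<^bsub>P\<^esub> ?b) \<otimes>\<^bsub>P\<^esub> emb ?q') \<oplus>\<^bsub>P\<^esub> (emb q \<otimes>\<^bsub>P\<^esub> ?b) \<otimes>\<^bsub>P\<^esub> (?b \<otimes>\<^bsub>P\<^esub> emb ?p')"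
    proof -
      have "emb p \<in> carrier P" "emb q \<in> carrier P" "emb ?p' \<in> carrier P" "emb ?q' \<in> carrier P"
        using p q by simp_all
      then show ?thesis
        using b by algebra
    qed
    finally show ?thesis
      using p b by (simp add: unit)
  qed
  then show ?thesis
    using coords.is_gradient_mult[OF is_gradient_emb[OF p]
        coords.is_gradient_inverse[OF is_gradient_emb[OF q(1)] b unit]]
    by (simp add: frac_eq_mult_inv[OF p q])
qed

text \<open>Establishes the assumption \<open>gen\<close>: polynomials are reached from the
  variables, \<open>1/q\<close> from \<open>q\<close> by inversion, and a fraction as the product of
  its numerator and \<open>1/q\<close>.\<close>

lemma generated:
  assumes g: "g \<in> carrier P" and one: "C \<one>\<^bsub>P\<^esub>" and var: "\<And>i. i \<in> \<Lambda> \<Longrightarrow> C (x i)"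
    and add: "\<And>a b. \<lbrakk>a \<in> carrier P; b \<in> carrier P; C a; C b\<rbrakk> \<Longrightarrow> C (a \<oplus>\<^bsub>P\<^esub> b)"
    and mult: "\<And>a b. \<lbrakk>a \<in> carrier P; b \<in> carrier P; C a; C b\<rbrakk> \<Longrightarrow> C (a \<otimes>\<^bsub>P\<^esub> b)"
    and smult: "\<And>c a. \<lbrakk>c \<in> carrier K; a \<in> carrier P; C a\<rbrakk> \<Longrightarrow> C (c \<odot>\<^bsub>P\<^esub> a)"
    and inv: "\<And>a b. \<lbrakk>a \<in> carrier P; b \<in> carrier P; a \<otimes>\<^bsub>P\<^esub> b = \<one>\<^bsub>P\<^esub>; C a\<rbrakk> \<Longrightarrow> C b"
  shows "C g"
proof -
  note closed = alg_hom_closed[OF emb_hom]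
  have emb: "C (emb p)" if "p \<in> carrier Po" for p
    using that
  proof (induction p rule: poly_induct)
    case one
    then show ?case using \<open>C \<one>\<^bsub>P\<^esub>\<close> by (simp add: alg_hom_one[OF emb_hom])
  next
    case (var q i)
    then show ?case
      using assms(3)[of i] mult[of "emb q" "x i"] closed x_closed
      by (simp add: alg_hom_mult[OF emb_hom] poly_var_closed var_image_def)
  next
    case (add q r)
    then show ?case
      using assms(4)[of "emb q" "emb r"] closed by (simp add: alg_hom_add[OF emb_hom])
  next
    case (smult c q)
    then show ?case
      using assms(6)[of c "emb q"] closed by (simp add: alg_hom_smult[OF emb_hom])
  qed
  obtain p q where pq: "p \<in> carrier Po" "q \<in> carrier Po" "cls q \<in> S" "g = frc p q"
    using carrier_L[OF g] by blast
  have "C (frc \<one>\<^bsub>Po\<^esub> q)"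
    by (rule inv[of "emb q"])
      (use pq frac_closed[OF Po.one_closed pq(2,3)] emb_mult_inv[OF Po.one_closed pq(2,3)] closed emb in auto)
  then show ?thesis
    unfolding pq(4) frac_eq_mult_inv[OF pq(1-3)]
    by (intro mult closed emb pq frac_closed[OF Po.one_closed pq(2,3)])
qed

text \<open>Whatever fraction \<open>rep\<close> selects for \<open>g\<close>, it maps to
  \<open>g\<close>, so \<open>is_gradient_frac\<close> makes its derivatives a gradient of
  \<open>g\<close>. No compatibility between the choices for different elements enters.\<close>

lemma poisson_gen_rel:
  assumes rep: "\<forall>g\<in>carrier P. rep g \<in> representatives K \<Lambda> \<Gamma> f S g"
  shows "poisson_gen_rel K P br \<Lambda> x (\<lambda>g k. frac_pderiv K \<Lambda> \<Gamma> f S k (rep g)) \<Gamma> (rel_pderiv K \<Lambda> \<Gamma> f S)"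
proof -
  have D: "coords.is_gradient g (\<lambda>k. frac_pderiv K \<Lambda> \<Gamma> f S k (rep g))" if g: "g \<in> carrier P" for g
  proof -
    obtain p q where pq: "rep g = (p, q)"
      by fastforce
    then have "(p, q) \<in> representatives K \<Lambda> \<Gamma> f S g"
      using rep g by force
    then show ?thesis
      using is_gradient_frac[of p q] unfolding pq by (auto simp: representatives_def)
  qed
  have E: "coords.is_gradient (emb (f s)) (rel_pderiv K \<Lambda> \<Gamma> f S s)" if "s \<in> \<Gamma>" for s
    using is_gradient_emb[of "f s"] f that by (auto simp: rel_pderiv_def[abs_def])
  show ?thesis
    by unfold_locales
      (fact x_closed coords.is_gradientD(2,3,5)[OF D] coords.is_gradientD(2,3,5)[OF E] generated)+
qed

end

theorem theorem3p2:
  fixes K :: "'k ring" and \<Lambda> :: "'x set" and \<Gamma> :: "'s set"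
    and f :: "'s \<Rightarrow> ('k, 'x) poly_fun" and S :: "('k, 'x) poly_fun set set"
    and P :: "('k, ('k, 'x) loc_elem) module"
    and br :: "('k, 'x) loc_elem \<Rightarrow> ('k, 'x) loc_elem \<Rightarrow> ('k, 'x) loc_elem"
    and x :: "'x \<Rightarrow> ('k, 'x) loc_elem"
    and rep :: "('k, 'x) loc_elem \<Rightarrow> ('k, 'x) poly_fun \<times> ('k, 'x) poly_fun"
    and D :: "('k, 'x) loc_elem \<Rightarrow> 'x \<Rightarrow> ('k, 'x) loc_elem"
    and E :: "'s \<Rightarrow> 'x \<Rightarrow> ('k, 'x) loc_elem"
  assumes "field K"
    and "f \<in> \<Gamma> \<rightarrow> carrier (poly_alg K \<Lambda>)"
    and "submonoid S (coord_alg K \<Lambda> \<Gamma> f)"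
    and "\<forall>s\<in>S. regular_elem (coord_alg K \<Lambda> \<Gamma> f) s"
    and P_eq: "P = localization (coord_alg K \<Lambda> \<Gamma> f) S"
    and "poisson_algebra K P br"
    and x_eq: "x = var_image K \<Lambda> \<Gamma> f S"
    and rep: "\<forall>g\<in>carrier P. rep g \<in> representatives K \<Lambda> \<Gamma> f S g"
    and D_eq: "D = (\<lambda>g k. frac_pderiv K \<Lambda> \<Gamma> f S k (rep g))"
    and E_eq: "E = rel_pderiv K \<Lambda> \<Gamma> f S"
  shows
    "sign_flip_is_iso K (carrier P) \<Lambda> (F_ab K \<Lambda> P br x D)
       (F_ab_incl K \<Lambda> P br x D) (F_ab_delta K \<Lambda> P br x D) \<and>
     sign_flip_is_iso K (carrier P) \<Lambda> (env_alg K \<Lambda> P br x D \<Gamma> E)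
       (env_incl K \<Lambda> P br x D \<Gamma> E) (env_delta K \<Lambda> P br x D \<Gamma> E) \<and>
     (\<forall>(U :: ('k, 'u) module) \<alpha> \<beta>. poisson_enveloping_algebra K P br U \<alpha> \<beta> \<longrightarrow>
       sign_flip_is_iso K (carrier P) \<Lambda> U \<alpha> (\<lambda>i. \<beta> (x i))) \<and>
     (\<forall>(Q :: ('k, 'q) module) brQ (V :: ('k, 'v) module) \<alpha> \<beta>.
       poisson_algebra K Q brQ \<and> poisson_enveloping_algebra K Q brQ V \<alpha> \<beta> \<longrightarrow>
       (\<exists>\<phi>. \<phi> \<in> alg_iso K V (opp_alg V))) \<and>
     (\<forall>g\<in>carrier P. fsum P \<Lambda> (\<lambda>j. br (D g j) (x j)) = \<zero>\<^bsub>P\<^esub>)"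
proof -
  interpret lp: localized_poisson K \<Lambda> \<Gamma> f S br
    using assms(1-4,6) unfolding P_eq
    by (intro localized_poisson.intro localized_coords.intro localized_coords_axioms.intro polynomials.intro
        fieldE(1))
  interpret poisson_gen_rel K P br \<Lambda> x D \<Gamma> E
    using lp.poisson_gen_rel rep unfolding P_eq x_eq D_eq E_eq by blast
  \<comment> \<open>An arbitrary Poisson algebra comes without chosen generators, so the
    coordinate-free flip is applied here.\<close>
  have "\<exists>\<phi>. \<phi> \<in> alg_iso K V (opp_alg V)"
    if "poisson_algebra K Q brQ" "poisson_enveloping_algebra K Q brQ V \<alpha> \<beta>"
    for Q :: "('k, 'q) module" and brQ and V :: "('k, 'v) module" and \<alpha> \<beta>
    using poisson_algebra.enveloping_sign_flip_is_iso[OF that] by (auto simp: sign_flip_is_iso_def)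
  then show ?thesis
    using F_ab_sign_flip_is_iso env_sign_flip_is_iso enveloping_vars_sign_flip_is_iso div_D by blast
qed

end
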